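(* Let $R$ be a commutative complete Noetherian local ring with algebraically closed residue field, and let $\mathcal{C}$ be an additive full subcategory of $\mathrm{mod}\,R$, closed under isomorphisms, which contains the free $R$-modules and is closed under kernels of epimorphisms. Then the assignment $\mathcal{X}\mapsto\gamma\circ\Sigma(\mathcal{X})=\gamma(\Sigma(\mathcal{X}))$ on subsets of $\mathsf{Sp}\,\mathcal{C}$ is a Kuratowski closure operator. That is, for all subsets $\mathcal{X},\mathcal{Y}$ of $\mathsf{Sp}\,\mathcal{C}$: (1) $\gamma\circ\Sigma(\emptyset)=\emptyset$; (2) $\mathcal{X}\subseteq\gamma\circ\Sigma(\mathcal{X})$; (3) $\gamma\circ\Sigma(\mathcal{X}\cup\mathcal{Y})=\gamma\circ\Sigma(\mathcal{X})\cup\gamma\circ\Sigma(\mathcal{Y})$; (4) $\gamma\circ\Sigma(\gamma\circ\Sigma(\mathcal{X}))=\gamma\circ\Sigma(\mathcal{X})$.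
   Context: $\mathrm{mod}\,R$ is the category of finitely generated $R$-modules; all modules (including free ones) are finitely generated. $\mathcal{C}$ is closed under kernels of epimorphisms if the kernel of each surjection $Y\to X$ with $X,Y\in\mathcal{C}$ belongs to $\mathcal{C}$. The stable category $\underline{\mathcal{C}}$ has the same objects as $\mathcal{C}$, with morphisms $\underline{\mathrm{Hom}}_R(M,N)=\mathrm{Hom}_R(M,N)/\{\text{morphisms factoring through a free } R\text{-module}\}$. $\mathrm{mod}\,\underline{\mathcal{C}}$ is the category of finitely presented contravariant additive functors $F:\underline{\mathcal{C}}\to Ab$, i.e. those admitting an exact sequence $\underline{\mathrm{Hom}}_R(-,N)\to\underline{\mathrm{Hom}}_R(-,M)\to F\to 0$ with $M,N\in\mathcal{C}$; morphisms are natural transformations. Under these hypotheses on $\mathcal{C}$ it is known to be an abelian category. $\mathsf{Sp}\,\mathcal{C}$ is the set of isomorphism classes of indecomposable $R$-modules in $\mathcal{C}$ except $R$ and $0$. For $\mathcal{X}\subseteq\mathsf{Sp}\,\mathcal{C}$, $\Sigma(\mathcal{X})=\{F\in\mathrm{mod}\,\underline{\mathcal{C}}\mid F(X)=0\ \text{for all } X\in\mathcal{X}\}$ (a full subcategory); for a subcategory $\mathcal{F}$ of $\mathrm{mod}\,\underline{\mathcal{C}}$, $\gamma(\mathcal{F})=\{M\in\mathsf{Sp}\,\mathcal{C}\mid F(M)=0\ \text{for all } F\in\mathcal{F}\}$. *)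

theory Defs
  imports
    "HOL-Algebra.Algebraic_Closure"
    "HOL-Algebra.Ideal_Product"
    "HOL-Algebra.Ring_Divisibility"
    "Jordan_Normal_Form.Missing_VectorSpace"
begin

hide_const (open) Multiset.mult Modules.module

section \<open>Complete Noetherian local rings\<close>

primrec ideal_power :: "('a, 'r) ring_scheme \<Rightarrow> 'a set \<Rightarrow> nat \<Rightarrow> 'a set" where
  "ideal_power R I 0 = carrier R"
| "ideal_power R I (Suc n) = ideal_prod R I (ideal_power R I n)"

text \<open>
  Completeness says that the canonical map from \<open>R\<close> to the inverse limit of the
  rings \<open>R / \<mm>\<^sup>n\<close> is bijective: a sequence \<open>x\<close> as below represents an
  element of the inverse limit, existence of \<open>a\<close> is surjectivity, and uniqueness is injectivity.
\<close>

locale complete_noetherian_local_ring = cring R + noetherian_ring R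
  for R (structure) +
  fixes \<mm> :: "'a set"
  assumes maximal: "maximalideal \<mm> R"
    and unique_maximal: "maximalideal J R \<Longrightarrow> J = \<mm>"
    and complete:
      "\<lbrakk>\<And>n. x n \<in> carrier R; \<And>n. x (Suc n) \<ominus> x n \<in> ideal_power R \<mm> n\<rbrakk>
        \<Longrightarrow> \<exists>!a. a \<in> carrier R \<and> (\<forall>n. a \<ominus> x n \<in> ideal_power R \<mm> n)"


section \<open>Finitely generated modules\<close>

definition fg_modules :: "('a, 'r) ring_scheme \<Rightarrow> ('a, 'm) module set" where
  "fg_modules R =
    {M. module R M \<and>
        (\<exists>S. finite S \<and> S \<subseteq> carrier M \<and> module.span R M S = carrier M)}"

text \<open>
  Since a type has to be fixed for the elements of modules, the category \<open>mod R\<close> is modelled by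
  \<open>fg_modules R\<close> at the type below.  This loses nothing: the elements of a module generated by
  \<open>g\<^sub>0, \<dots>, g\<^sub>n\<^sub>-\<^sub>1\<close> can be represented by their sets of coefficient vectors, so that
  every finitely generated \<open>R\<close>-module, with elements of whatever type, is isomorphic to a
  module of this type; see \<open>fg_modules_universal\<close> below.
\<close>

type_synonym 'a rmodule = "('a, (nat \<Rightarrow> 'a) set) module"

definition mod_iso ::
  "('a, 'r) ring_scheme \<Rightarrow> ('a, 'm) module \<Rightarrow> ('a, 'n) module \<Rightarrow> bool" where
  "mod_iso R M N \<longleftrightarrow> (\<exists>f \<in> module_hom R M N. bij_betw f (carrier M) (carrier N))"

lemma module_transport:
  fixes N :: "('a, 'n) module" and h :: "'n \<Rightarrow> 'm"
  assumes N: "module R N" and inj: "inj_on h (carrier N)"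
  defines "k \<equiv> inv_into (carrier N) h"
  defines "M \<equiv> \<lparr>carrier = h ` carrier N, mult = (\<lambda>_ _. h \<zero>\<^bsub>N\<^esub>), one = h \<zero>\<^bsub>N\<^esub>, zero = h \<zero>\<^bsub>N\<^esub>,
      add = (\<lambda>x y. h (k x \<oplus>\<^bsub>N\<^esub> k y)), smult = (\<lambda>r x. h (r \<odot>\<^bsub>N\<^esub> k x))\<rparr>"
  shows "module R M" and "h \<in> module_hom R N M" and "bij_betw h (carrier N) (carrier M)"
proof -
  interpret N: module R N by (rule N)
  have k: "k (h x) = x" if "x \<in> carrier N" for x
    using that inj by (simp add: k_def)
  show "h \<in> module_hom R N M"
    by (auto simp: module_hom_def M_def k)
  show "bij_betw h (carrier N) (carrier M)"
    using inj by (simp add: M_def bij_betw_def)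
  have "abelian_group M"
  proof (rule abelian_groupI)
    fix x assume "x \<in> carrier M"
    then obtain a where a: "a \<in> carrier N" "x = h a" by (auto simp: M_def)
    have "h (\<ominus>\<^bsub>N\<^esub> a) \<in> carrier M" and "h (\<ominus>\<^bsub>N\<^esub> a) \<oplus>\<^bsub>M\<^esub> x = \<zero>\<^bsub>M\<^esub>"
      using a by (auto simp: M_def k N.l_neg)
    then show "\<exists>y\<in>carrier M. y \<oplus>\<^bsub>M\<^esub> x = \<zero>\<^bsub>M\<^esub>" by blast
  qed (auto simp: M_def k N.a_ac)
  then show "module R M"
    by (intro moduleI)
      (auto simp: M_def k N.smult_l_distr N.smult_r_distr N.smult_assoc1 N.is_cring)
qed

lemma fg_modules_hom_image:
  assumes N: "N \<in> fg_modules R" and M: "module R M"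
    and h: "h \<in> module_hom R N M" "bij_betw h (carrier N) (carrier M)"
  shows "M \<in> fg_modules R"
proof -
  from N obtain S where mN: "module R N"
    and S: "finite S" "S \<subseteq> carrier N" "module.span R N S = carrier N"
    by (auto simp: fg_modules_def)
  interpret N: module R N by (rule mN)
  interpret M: module R M by (rule M)
  interpret h: mod_hom R N M h
    using h(1) by unfold_locales (auto simp: mod_hom_axioms_def)
  have inj: "inj_on h (carrier N)" and surj: "h ` carrier N = carrier M"
    using h(2) by (auto simp: bij_betw_def)
  have lin: "h (N.lincomb a S) = M.lincomb (a \<circ> inv_into (carrier N) h) (h ` S)"
    if a: "a \<in> S \<rightarrow> carrier R" for a
  proof -
    have injS: "inj_on h S" using inj S(2) by (rule inj_on_subset)
    have inv: "inv_into (carrier N) h (h x) = x" if "x \<in> S" for x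
      using that S(2) inj by auto
    have "h (\<Oplus>\<^bsub>N\<^esub>v\<in>T. a v \<odot>\<^bsub>N\<^esub> v) = (\<Oplus>\<^bsub>M\<^esub>v\<in>T. a v \<odot>\<^bsub>M\<^esub> h v)"
      if "T \<subseteq> S" for T
      using finite_subset[OF that S(1)] that
    proof (induction T rule: finite_induct)
      case (insert x T)
      then have "(\<lambda>v. a v \<odot>\<^bsub>N\<^esub> v) \<in> T \<rightarrow> carrier N" "a x \<odot>\<^bsub>N\<^esub> x \<in> carrier N"
        "(\<lambda>v. a v \<odot>\<^bsub>M\<^esub> h v) \<in> T \<rightarrow> carrier M" "a x \<odot>\<^bsub>M\<^esub> h x \<in> carrier M"
        "a x \<in> carrier R" "x \<in> carrier N"
        using a S(2) by (auto intro!: N.smult_closed M.smult_closed h.f_im)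
      then show ?case
        using insert by (simp add: N.finsum_insert M.finsum_insert N.finsum_closed)
    qed simp
    then have "h (N.lincomb a S) = (\<Oplus>\<^bsub>M\<^esub>v\<in>S. a v \<odot>\<^bsub>M\<^esub> h v)"
      by (simp add: N.lincomb_def)
    also have "\<dots> = (\<Oplus>\<^bsub>M\<^esub>v\<in>S. a (inv_into (carrier N) h (h v)) \<odot>\<^bsub>M\<^esub> h v)"
      using a S(2) by (intro M.finsum_cong') (auto intro!: M.smult_closed h.f_im simp: inv)
    also have "\<dots> = M.lincomb (a \<circ> inv_into (carrier N) h) (h ` S)"
      unfolding M.lincomb_def using a S(2) injS
      by (subst M.finsum_reindex) (auto intro!: M.smult_closed h.f_im simp: inv)
    finally show ?thesis .
  qed
  have "carrier M \<subseteq> M.span (h ` S)"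
  proof
    fix y assume "y \<in> carrier M"
    then obtain x where "x \<in> carrier N" "y = h x" using surj by blast
    then obtain a where a: "a \<in> S \<rightarrow> carrier R" "x = N.lincomb a S"
      using N.finite_span[OF S(1,2)] S(3) by auto
    have "a \<circ> inv_into (carrier N) h \<in> h ` S \<rightarrow> carrier R"
      using a(1) S(2) inj by (auto simp: subset_iff Pi_iff)
    then show "y \<in> M.span (h ` S)"
      using lin[OF a(1)] a(2) \<open>y = h x\<close> S(1) by (auto simp: M.span_def)
  qed
  moreover have hS: "h ` S \<subseteq> carrier M" using S(2) surj by auto
  moreover have "M.span (h ` S) \<subseteq> carrier M"
    using hS by (rule M.span_is_subset2)
  ultimately show ?thesis
    using M S(1) unfolding fg_modules_def by blast
qed

lemma fg_modules_universal:
  fixes N :: "('a, 'n) module"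
  assumes N: "N \<in> fg_modules R"
  shows "\<exists>M :: 'a rmodule \<in> fg_modules R. mod_iso R N M"
proof -
  from N obtain S where mN: "module R N"
    and S: "finite S" "S \<subseteq> carrier N" "module.span R N S = carrier N"
    by (auto simp: fg_modules_def)
  interpret N: module R N by (rule mN)
  obtain idx :: "'n \<Rightarrow> nat" where idx: "inj_on idx S"
    using finite_imp_inj_to_nat_seg[OF S(1)] by auto
  define h where
    "h m = {c. c \<circ> idx \<in> S \<rightarrow> carrier R \<and> N.lincomb (c \<circ> idx) S = m}" for m
  have "h m \<noteq> {}" if "m \<in> carrier N" for m
  proof -
    from that obtain a where a: "a \<in> S \<rightarrow> carrier R" "N.lincomb a S = m"
      using N.finite_span[OF S(1,2)] S(3) by auto
    have "N.lincomb (a \<circ> inv_into S idx \<circ> idx) S = N.lincomb a S"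
      using idx a S(2) by (intro N.lincomb_cong) auto
    then have "a \<circ> inv_into S idx \<in> h m"
      using a idx by (auto simp: h_def)
    then show ?thesis by blast
  qed
  then have inj: "inj_on h (carrier N)"
    unfolding inj_on_def h_def by blast
  note tr = module_transport[OF mN inj]
  from fg_modules_hom_image[OF N tr] tr(2,3) show ?thesis
    unfolding mod_iso_def by blast
qed

definition zero_module :: "('a, 'm) module \<Rightarrow> bool" where
  "zero_module M \<longleftrightarrow> carrier M = {\<zero>\<^bsub>M\<^esub>}"

definition free_mod :: "('a, 'r) ring_scheme \<Rightarrow> nat \<Rightarrow> ('a, nat \<Rightarrow> 'a) module" where
  "free_mod R n = ring.func_space R {..<n}"

definition is_free :: "('a, 'r) ring_scheme \<Rightarrow> ('a, 'm) module \<Rightarrow> bool" where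
  "is_free R M \<longleftrightarrow> (\<exists>n. mod_iso R M (free_mod R n))"

text \<open>
  Direct summands of \<open>M\<close> are isomorphic to submodules of \<open>M\<close>, so it suffices to let \<open>A\<close>
  and \<open>B\<close> have elements of the same type as \<open>M\<close>.
\<close>

definition indecomposable :: "('a, 'r) ring_scheme \<Rightarrow> ('a, 'm) module \<Rightarrow> bool" where
  "indecomposable R M \<longleftrightarrow> \<not> zero_module M \<and>
    (\<forall>A :: ('a, 'm) module \<in> fg_modules R. \<forall>B :: ('a, 'm) module \<in> fg_modules R.
       mod_iso R M (direct_sum A B) \<longrightarrow> zero_module A \<or> zero_module B)"


section \<open>Full subcategories of the category of finitely generated modules\<close>

text \<open>A full subcategory is given by its set of objects.\<close>

definition iso_closed :: "('a, 'r) ring_scheme \<Rightarrow> ('a, 'm) module set \<Rightarrow> bool" where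
  "iso_closed R \<C> \<longleftrightarrow> (\<forall>M \<in> \<C>. \<forall>N \<in> fg_modules R. mod_iso R M N \<longrightarrow> N \<in> \<C>)"

definition additive_subcategory :: "('a, 'r) ring_scheme \<Rightarrow> ('a, 'm) module set \<Rightarrow> bool" where
  "additive_subcategory R \<C> \<longleftrightarrow> \<C> \<subseteq> fg_modules R \<and>
    (\<exists>Z \<in> \<C>. zero_module Z) \<and>
    (\<forall>M \<in> \<C>. \<forall>N \<in> \<C>. \<exists>S \<in> \<C>. mod_iso R S (direct_sum M N))"

definition contains_free :: "('a, 'r) ring_scheme \<Rightarrow> ('a, 'm) module set \<Rightarrow> bool" where
  "contains_free R \<C> \<longleftrightarrow> (\<forall>P \<in> fg_modules R. is_free R P \<longrightarrow> P \<in> \<C>)"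

definition closed_under_epi_kernels ::
  "('a, 'r) ring_scheme \<Rightarrow> ('a, 'm) module set \<Rightarrow> bool" where
  "closed_under_epi_kernels R \<C> \<longleftrightarrow>
    (\<forall>U \<in> \<C>. \<forall>V \<in> \<C>. \<forall>p \<in> module_hom R V U. p ` carrier V = carrier U \<longrightarrow>
       (V\<lparr>carrier := {y \<in> carrier V. p y = \<zero>\<^bsub>U\<^esub>}\<rparr>) \<in> \<C>)"


section \<open>The stable category\<close>

text \<open>
  Homomorphisms are taken to be extensional, so that equal homomorphisms are equal functions.
\<close>

definition Hom ::
  "('a, 'r) ring_scheme \<Rightarrow> ('a, 'm) module \<Rightarrow> ('a, 'n) module \<Rightarrow> ('m \<Rightarrow> 'n) set" where
  "Hom R M N = module_hom R M N \<inter> extensional (carrier M)"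

definition hom_group ::
  "('a, 'r) ring_scheme \<Rightarrow> ('a, 'm) module \<Rightarrow> ('a, 'n) module \<Rightarrow> ('m \<Rightarrow> 'n) monoid" where
  "hom_group R M N =
    \<lparr>carrier = Hom R M N,
     mult = (\<lambda>f g. \<lambda>x\<in>carrier M. f x \<oplus>\<^bsub>N\<^esub> g x),
     one = (\<lambda>x\<in>carrier M. \<zero>\<^bsub>N\<^esub>)\<rparr>"

text \<open>
  Up to isomorphism the finitely generated free modules are the \<open>free_mod R n\<close>, so these are
  the homomorphisms that factor through a free module.
\<close>

definition free_homs ::
  "('a, 'r) ring_scheme \<Rightarrow> ('a, 'm) module \<Rightarrow> ('a, 'n) module \<Rightarrow> ('m \<Rightarrow> 'n) set" where
  "free_homs R M N =
    {compose (carrier M) g f | f g n. f \<in> Hom R M (free_mod R n) \<and> g \<in> Hom R (free_mod R n) N}"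

definition stable_hom ::
  "('a, 'r) ring_scheme \<Rightarrow> ('a, 'm) module \<Rightarrow> ('a, 'n) module \<Rightarrow> ('m \<Rightarrow> 'n) set monoid" where
  "stable_hom R M N = hom_group R M N Mod free_homs R M N"

definition stable_class ::
  "('a, 'r) ring_scheme \<Rightarrow> ('a, 'm) module \<Rightarrow> ('a, 'n) module \<Rightarrow> ('m \<Rightarrow> 'n) \<Rightarrow> ('m \<Rightarrow> 'n) set" where
  "stable_class R M N f = free_homs R M N #>\<^bsub>hom_group R M N\<^esub> f"

definition stable_id :: "('a, 'r) ring_scheme \<Rightarrow> ('a, 'm) module \<Rightarrow> ('m \<Rightarrow> 'm) set" where
  "stable_id R M = stable_class R M M (\<lambda>x\<in>carrier M. x)"

text \<open>
  The classes in the following union all coincide when \<open>\<psi>\<close> and \<open>\<phi>\<close> are morphisms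
  \<open>M \<rightarrow> N\<close> and \<open>L \<rightarrow> M\<close> of the stable category.
\<close>

definition stable_comp ::
  "('a, 'r) ring_scheme \<Rightarrow> ('a, 'l) module \<Rightarrow> ('a, 'm) module \<Rightarrow> ('a, 'n) module
    \<Rightarrow> ('m \<Rightarrow> 'n) set \<Rightarrow> ('l \<Rightarrow> 'm) set \<Rightarrow> ('l \<Rightarrow> 'n) set" where
  "stable_comp R L M N \<psi> \<phi> = (\<Union>g\<in>\<psi>. \<Union>f\<in>\<phi>. stable_class R L N (compose (carrier L) g f))"


section \<open>Finitely presented functors on the stable category\<close>

text \<open>
  Abelian groups are commutative groups of \<open>HOL-Algebra\<close>, hence are written multiplicatively.
  \<open>fmap F U V \<phi>\<close> is the map from \<open>F(V)\<close> to \<open>F(U)\<close> induced by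
  the stable morphism \<open>\<phi>\<close> from \<open>U\<close> to \<open>V\<close>.
\<close>

record ('a, 'm, 'g) contra_functor =
  fobj :: "('a, 'm) module \<Rightarrow> 'g monoid"
  fmap :: "('a, 'm) module \<Rightarrow> ('a, 'm) module \<Rightarrow> ('m \<Rightarrow> 'm) set \<Rightarrow> 'g \<Rightarrow> 'g"

definition additive_functor ::
  "('a, 'r) ring_scheme \<Rightarrow> ('a, 'm) module set \<Rightarrow> ('a, 'm, 'g) contra_functor \<Rightarrow> bool" where
  "additive_functor R \<C> F \<longleftrightarrow>
    (\<forall>U \<in> \<C>. comm_group (fobj F U)) \<and>
    (\<forall>U \<in> \<C>. \<forall>V \<in> \<C>. \<forall>\<phi> \<in> carrier (stable_hom R U V).
       fmap F U V \<phi> \<in> hom (fobj F V) (fobj F U)) \<and>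
    (\<forall>U \<in> \<C>. \<forall>a \<in> carrier (fobj F U). fmap F U U (stable_id R U) a = a) \<and>
    (\<forall>U \<in> \<C>. \<forall>V \<in> \<C>. \<forall>W \<in> \<C>.
       \<forall>\<phi> \<in> carrier (stable_hom R U V). \<forall>\<psi> \<in> carrier (stable_hom R V W).
       \<forall>a \<in> carrier (fobj F W).
         fmap F U W (stable_comp R U V W \<psi> \<phi>) a = fmap F U V \<phi> (fmap F V W \<psi> a)) \<and>
    (\<forall>U \<in> \<C>. \<forall>V \<in> \<C>.
       \<forall>\<phi> \<in> carrier (stable_hom R U V). \<forall>\<psi> \<in> carrier (stable_hom R U V).
       \<forall>a \<in> carrier (fobj F V).
         fmap F U V (\<phi> \<otimes>\<^bsub>stable_hom R U V\<^esub> \<psi>) a =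
           fmap F U V \<phi> a \<otimes>\<^bsub>fobj F U\<^esub> fmap F U V \<psi> a)"

definition nat_trans ::
  "('a, 'r) ring_scheme \<Rightarrow> ('a, 'm) module set
    \<Rightarrow> ('a, 'm, 'g) contra_functor \<Rightarrow> ('a, 'm, 'h) contra_functor
    \<Rightarrow> (('a, 'm) module \<Rightarrow> 'g \<Rightarrow> 'h) \<Rightarrow> bool" where
  "nat_trans R \<C> F G \<eta> \<longleftrightarrow>
    (\<forall>U \<in> \<C>. \<eta> U \<in> hom (fobj F U) (fobj G U)) \<and>
    (\<forall>U \<in> \<C>. \<forall>V \<in> \<C>. \<forall>\<phi> \<in> carrier (stable_hom R U V). \<forall>a \<in> carrier (fobj F V).
       \<eta> U (fmap F U V \<phi> a) = fmap G U V \<phi> (\<eta> V a))"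

definition representable ::
  "('a, 'r) ring_scheme \<Rightarrow> ('a, 'm) module \<Rightarrow> ('a, 'm, ('m \<Rightarrow> 'm) set) contra_functor" where
  "representable R M =
    \<lparr>fobj = (\<lambda>U. stable_hom R U M), fmap = (\<lambda>U V \<phi> \<psi>. stable_comp R U V M \<psi> \<phi>)\<rparr>"

definition finitely_presented ::
  "('a, 'r) ring_scheme \<Rightarrow> ('a, 'm) module set \<Rightarrow> ('a, 'm, 'g) contra_functor \<Rightarrow> bool" where
  "finitely_presented R \<C> F \<longleftrightarrow>
    (\<exists>M \<in> \<C>. \<exists>N \<in> \<C>. \<exists>\<eta> \<epsilon>.
       nat_trans R \<C> (representable R N) (representable R M) \<eta> \<and>
       nat_trans R \<C> (representable R M) F \<epsilon> \<and>
       (\<forall>U \<in> \<C>.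
          \<eta> U ` carrier (fobj (representable R N) U) =
            kernel (fobj (representable R M) U) (fobj F U) (\<epsilon> U) \<and>
          \<epsilon> U ` carrier (fobj (representable R M) U) = carrier (fobj F U)))"

text \<open>
  As for modules, a type has to be fixed for the elements of the values of functors.  The values
  of a finitely presented functor are quotients of groups \<open>Hom\<^sub>R(U, M)\<close>, whose elements can be
  represented by sets of homomorphisms; so every finitely presented functor, with values in groups
  of whatever type, is naturally isomorphic to one of the following set; see
  \<open>mod_stable_universal\<close> below.
\<close>

definition mod_stable ::
  "('a, 'r) ring_scheme \<Rightarrow> ('a, 'm) module set
    \<Rightarrow> ('a, 'm, ('m \<Rightarrow> 'm) set) contra_functor set" where
  "mod_stable R \<C> = {F. additive_functor R \<C> F \<and> finitely_presented R \<C> F}"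


lemma mod_stable_universal:
  fixes F :: "('a, 'm, 'g) contra_functor"
  assumes F: "additive_functor R \<C> F" "finitely_presented R \<C> F"
  shows "\<exists>G \<in> mod_stable R \<C>. \<exists>\<theta>. nat_trans R \<C> F G \<theta> \<and>
    (\<forall>U \<in> \<C>. bij_betw (\<theta> U) (carrier (fobj F U)) (carrier (fobj G U)))"
proof -
  obtain M N \<eta> \<epsilon> where MN: "M \<in> \<C>" "N \<in> \<C>"
    and pres: "nat_trans R \<C> (representable R N) (representable R M) \<eta> \<and>
      nat_trans R \<C> (representable R M) F \<epsilon> \<and>
      (\<forall>U \<in> \<C>.
         \<eta> U ` carrier (fobj (representable R N) U) =
           kernel (fobj (representable R M) U) (fobj F U) (\<epsilon> U) \<and>
         \<epsilon> U ` carrier (fobj (representable R M) U) = carrier (fobj F U))"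
    using F(2) unfolding finitely_presented_def by (elim bexE exE)
  have \<eta>: "nat_trans R \<C> (representable R N) (representable R M) \<eta>"
    and \<epsilon>: "nat_trans R \<C> (representable R M) F \<epsilon>"
    using pres by simp_all
  have ex: "\<eta> U ` carrier (fobj (representable R N) U) =
        kernel (fobj (representable R M) U) (fobj F U) (\<epsilon> U)"
    and surj: "\<epsilon> U ` carrier (fobj (representable R M) U) = carrier (fobj F U)"
    if "U \<in> \<C>" for U
    using pres[THEN conjunct2, THEN conjunct2] that by (simp_all add: Ball_def)
  define h where "h U = inv_into (carrier (fobj (representable R M) U)) (\<epsilon> U)" for U
  have k: "\<epsilon> U (h U a) = a" if "U \<in> \<C>" "a \<in> carrier (fobj F U)" for U a
    using surj[OF that(1)] that(2) unfolding h_def by (metis f_inv_into_f)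
  define G where "G =
    \<lparr>fobj = (\<lambda>U. \<lparr>carrier = h U ` carrier (fobj F U),
        mult = (\<lambda>x y. h U (\<epsilon> U x \<otimes>\<^bsub>fobj F U\<^esub> \<epsilon> U y)), one = h U \<one>\<^bsub>fobj F U\<^esub>\<rparr>),
     fmap = (\<lambda>U V \<phi> x. h U (fmap F U V \<phi> (\<epsilon> V x)))\<rparr>"
  note ax = F(1)[unfolded additive_functor_def]
  have grp: "comm_group (fobj F U)" if "U \<in> \<C>" for U
    using ax[THEN conjunct1] that by (rule bspec)
  have hm: "fmap F U V \<phi> \<in> hom (fobj F V) (fobj F U)"
    if "U \<in> \<C>" "V \<in> \<C>" "\<phi> \<in> carrier (stable_hom R U V)" for U V \<phi>
    by (rule ax[THEN conjunct2, THEN conjunct1, rule_format, OF that])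
  then have fm: "fmap F U V \<phi> a \<in> carrier (fobj F U)"
    if "U \<in> \<C>" "V \<in> \<C>" "\<phi> \<in> carrier (stable_hom R U V)" "a \<in> carrier (fobj F V)" for U V \<phi> a
    using that unfolding hom_def by blast
  note idn = ax[THEN conjunct2, THEN conjunct2, THEN conjunct1, rule_format]
  note cmp = ax[THEN conjunct2, THEN conjunct2, THEN conjunct2, THEN conjunct1, rule_format]
  note add = ax[THEN conjunct2, THEN conjunct2, THEN conjunct2, THEN conjunct2, rule_format]
  have "comm_group (fobj G U)" if U: "U \<in> \<C>" for U
  proof -
    interpret comm_group "fobj F U" using grp[OF U] .
    show ?thesis
    proof (rule comm_groupI)
      fix x assume "x \<in> carrier (fobj G U)"
      then obtain a where a: "a \<in> carrier (fobj F U)" "x = h U a" by (auto simp: G_def)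
      then show "\<exists>y\<in>carrier (fobj G U). y \<otimes>\<^bsub>fobj G U\<^esub> x = \<one>\<^bsub>fobj G U\<^esub>"
        by (intro bexI[of _ "h U (inv\<^bsub>fobj F U\<^esub> a)"]) (auto simp: G_def k U)
    qed (auto simp: G_def k U m_ac)
  qed
  moreover have "fmap G U V \<phi> \<in> hom (fobj G V) (fobj G U)"
    if "U \<in> \<C>" "V \<in> \<C>" "\<phi> \<in> carrier (stable_hom R U V)" for U V \<phi>
  proof -
    interpret V: comm_group "fobj F V" using grp that by blast
    show ?thesis
      using that hm[OF that] by (auto simp: hom_def G_def k fm Pi_iff)
  qed
  moreover have "fmap G U U (stable_id R U) x = x" if "U \<in> \<C>" "x \<in> carrier (fobj G U)" for U x
    using that by (auto simp: G_def k idn)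
  moreover have "fmap G U W (stable_comp R U V W \<psi> \<phi>) x = fmap G U V \<phi> (fmap G V W \<psi> x)"
    if "U \<in> \<C>" "V \<in> \<C>" "W \<in> \<C>" "\<phi> \<in> carrier (stable_hom R U V)"
      "\<psi> \<in> carrier (stable_hom R V W)" "x \<in> carrier (fobj G W)" for U V W \<phi> \<psi> x
    using that by (auto simp: G_def k fm cmp)
  moreover have "fmap G U V (\<phi> \<otimes>\<^bsub>stable_hom R U V\<^esub> \<psi>) x =
      fmap G U V \<phi> x \<otimes>\<^bsub>fobj G U\<^esub> fmap G U V \<psi> x"
    if "U \<in> \<C>" "V \<in> \<C>" "\<phi> \<in> carrier (stable_hom R U V)"
      "\<psi> \<in> carrier (stable_hom R U V)" "x \<in> carrier (fobj G V)" for U V \<phi> \<psi> x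
    using that by (auto simp: G_def k fm add)
  ultimately have "additive_functor R \<C> G"
    unfolding additive_functor_def by (intro conjI ballI)
  moreover have \<theta>: "nat_trans R \<C> F G h"
    using grp unfolding nat_trans_def
    by (auto simp: hom_def G_def k comm_group_def comm_monoid_def monoid.m_closed)
  moreover have bij: "bij_betw (h U) (carrier (fobj F U)) (carrier (fobj G U))" if "U \<in> \<C>" for U
    using that k by (auto simp: bij_betw_def G_def intro!: inj_on_inverseI[of _ "\<epsilon> U"])
  moreover have "finitely_presented R \<C> G"
  proof -
    define \<epsilon>' where "\<epsilon>' U = h U \<circ> \<epsilon> U" for U
    have e: "\<epsilon> U x \<in> carrier (fobj F U)"
      if "U \<in> \<C>" "x \<in> carrier (fobj (representable R M) U)" for U x
      using surj that by blast
    have "nat_trans R \<C> (representable R M) G \<epsilon>'"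
      using \<epsilon> unfolding nat_trans_def
      by (auto simp: hom_def G_def \<epsilon>'_def k e)
    moreover have "kernel (fobj (representable R M) U) (fobj G U) (\<epsilon>' U) =
        kernel (fobj (representable R M) U) (fobj F U) (\<epsilon> U)" if U: "U \<in> \<C>" for U
    proof -
      interpret comm_group "fobj F U" using grp[OF U] .
      have "h U a = h U \<one>\<^bsub>fobj F U\<^esub> \<longleftrightarrow> a = \<one>\<^bsub>fobj F U\<^esub>" if "a \<in> carrier (fobj F U)" for a
        using k[OF U that] k[OF U one_closed] by metis
      then show ?thesis
        using e[OF U] by (auto simp: kernel_def G_def \<epsilon>'_def)
    qed
    moreover have "\<epsilon>' U ` carrier (fobj (representable R M) U) = carrier (fobj G U)"
      if "U \<in> \<C>" for U
      using surj[OF that, symmetric] by (simp add: \<epsilon>'_def G_def image_image)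
    ultimately show ?thesis
      unfolding finitely_presented_def using MN \<eta> ex
      by (intro bexI[OF _ MN(1)] bexI[OF _ MN(2)] exI[of _ \<eta>] exI[of _ \<epsilon>'] conjI ballI) simp_all
  qed
  ultimately show ?thesis
    unfolding mod_stable_def by blast
qed


section \<open>The maps between sets of indecomposables and subcategories of functors\<close>

definition vanishes :: "('a, 'm, 'g) contra_functor \<Rightarrow> ('a, 'm) module \<Rightarrow> bool" where
  "vanishes F U \<longleftrightarrow> carrier (fobj F U) = {\<one>\<^bsub>fobj F U\<^esub>}"

definition iso_class ::
  "('a, 'r) ring_scheme \<Rightarrow> ('a, 'm) module set \<Rightarrow> ('a, 'm) module \<Rightarrow> ('a, 'm) module set" where
  "iso_class R \<C> M = {N \<in> \<C>. mod_iso R N M}"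

text \<open>\<open>R\<close> as a module over itself is \<open>free_mod R 1\<close>.\<close>

definition Sp :: "('a, 'r) ring_scheme \<Rightarrow> ('a, 'm) module set \<Rightarrow> ('a, 'm) module set set" where
  "Sp R \<C> =
    {iso_class R \<C> M | M. M \<in> \<C> \<and> indecomposable R M \<and>
       \<not> mod_iso R M (free_mod R 1) \<and> \<not> zero_module M}"

definition Sigma_sub ::
  "('a, 'r) ring_scheme \<Rightarrow> ('a, 'm) module set \<Rightarrow> ('a, 'm) module set set
    \<Rightarrow> ('a, 'm, ('m \<Rightarrow> 'm) set) contra_functor set" where
  "Sigma_sub R \<C> \<U> = {F \<in> mod_stable R \<C>. \<forall>c \<in> \<U>. \<forall>U \<in> c. vanishes F U}"

definition gamma_sub ::
  "('a, 'r) ring_scheme \<Rightarrow> ('a, 'm) module set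
    \<Rightarrow> ('a, 'm, ('m \<Rightarrow> 'm) set) contra_functor set \<Rightarrow> ('a, 'm) module set set" where
  "gamma_sub R \<C> \<F> = {c \<in> Sp R \<C>. \<forall>F \<in> \<F>. \<forall>M \<in> c. vanishes F M}"

end

(* Extensivity and idempotence of the operator and the inclusion from right to left in (3) are formal
   properties of a Galois connection. For the other inclusion in (3), let M be an indecomposable
   with a in F(M) and b in G(M) nontrivial, where F vanishes on X and G on Y. By Yoneda's lemma the
   maps s : U -> M that annihilate a form a subfunctor of Hom(-, M), and a presentation of F shows
   that it is the image of Hom(-, W) for an epimorphism W -> M in C: take W to be the kernel of an
   epimorphism onto the module that represents the generators of F. The quotient of Hom(-, M) by the
   sum of the subfunctors for a and for b is therefore finitely presented, and it vanishes on X and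
   on Y. If it vanished at M, then the identity of M would be a sum f + g with f annihilating a and
   g annihilating b; as End(M) is local, f or g would be invertible, so a or b trivial. For (1), M
   would be a direct summand of a free module, hence isomorphic to R, if the stable functor
   represented by M vanished at M.

   Locality of End(M) is where completeness enters. An endomorphism f of M is a root of a monic
   polynomial p; the ring R[X]/(p) is a free R-module, so it is complete and idempotents lift from its
   reduction modulo the maximal ideal. There some power of X generates an idempotent ideal, and the
   lifted idempotent splits M into a part where f is invertible and one where 1 - f is. *)
theory Submission
  imports Defs
begin

section \<open>Lifting idempotents in complete filtered rings\<close>

text \<open>Two obstacles shape the proof. A free cover of the target, added as a further summand,
  makes the map surjective; the same summand absorbs stably trivial maps, since a map into a module
  is stably trivial exactly if it factors through one fixed free cover. All subfunctors of Hom(-, M)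
  that occur are kept in the form "maps that factor through w" with w : W -> M onto, a form that is
  stable under sums and contains the stably trivial maps. The other obstacle is that End(M) is not
  commutative and has no filtration whose completeness is evident. The lifting therefore takes place
  in a commutative ring whose elements are coordinate vectors over R, where limits are taken in each
  coordinate; the result is sent to End(M) by X -> f. The polynomial p comes from the ascending
  chain condition, and the power of X is the order of vanishing at 0 of p modulo the maximal
  ideal.\<close>

locale complete_filtered_cring = cring A for A (structure) +
  fixes I :: "nat \<Rightarrow> 'a set"
  assumes I_ideal: "ideal (I n) A"
    and I_0: "I 0 = carrier A"
    and I_antimono: "I (Suc n) \<subseteq> I n"
    and I_mult: "\<lbrakk>a \<in> I i; b \<in> I j\<rbrakk> \<Longrightarrow> a \<otimes> b \<in> I (i + j)"
    and I_complete: "\<lbrakk>\<And>n. x n \<in> carrier A; \<And>n. x (Suc n) \<ominus> x n \<in> I n\<rbrakk>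
      \<Longrightarrow> \<exists>a \<in> carrier A. \<forall>n. a \<ominus> x n \<in> I n"
    and I_separated: "\<lbrakk>a \<in> carrier A; \<And>n. a \<in> I n\<rbrakk> \<Longrightarrow> a = \<zero>"
begin

lemma I_carrier: "a \<in> I n \<Longrightarrow> a \<in> carrier A"
  using ideal.Icarr[OF I_ideal] .

lemma I_add: "\<lbrakk>a \<in> I n; b \<in> I n\<rbrakk> \<Longrightarrow> a \<oplus> b \<in> I n"
  using additive_subgroup.a_closed[OF ideal.axioms(1)[OF I_ideal]] .

lemma I_neg: "a \<in> I n \<Longrightarrow> \<ominus> a \<in> I n"
  using additive_subgroup.a_inv_closed[OF ideal.axioms(1)[OF I_ideal]] .

lemma I_diff: "\<lbrakk>a \<in> I n; b \<in> I n\<rbrakk> \<Longrightarrow> a \<ominus> b \<in> I n"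
  unfolding a_minus_def by (intro I_add I_neg)

lemma I_lmult: "\<lbrakk>a \<in> I n; b \<in> carrier A\<rbrakk> \<Longrightarrow> b \<otimes> a \<in> I n"
  using ideal.I_l_closed[OF I_ideal] .

lemma I_rmult: "\<lbrakk>a \<in> I n; b \<in> carrier A\<rbrakk> \<Longrightarrow> a \<otimes> b \<in> I n"
  using ideal.I_r_closed[OF I_ideal] .

text \<open>The geometric series 1 + t + t^2 + ... converges because t^n lies in \<open>I n\<close>,
  and its limit is the inverse.\<close>

lemma one_minus_unit:
  assumes t: "t \<in> I 1"
  shows "\<exists>u \<in> carrier A. u \<otimes> (\<one> \<ominus> t) = \<one>"
proof -
  \<comment> \<open>\<open>x n\<close> is the partial sum with n terms; with the recursion x(n+1) =
    1 + t x(n), consecutive differences gain a factor t at each step.\<close>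
  define x where "x = rec_nat \<zero> (\<lambda>_ y. \<one> \<oplus> t \<otimes> y)"
  have x: "x 0 = \<zero>" "x (Suc n) = \<one> \<oplus> t \<otimes> x n" for n by (simp_all add: x_def)
  have tc: "t \<in> carrier A" using t by (rule I_carrier)
  have xc: "x n \<in> carrier A" for n by (induction n) (use tc in \<open>auto simp: x\<close>)
  have "x (Suc n) \<ominus> x n \<in> I n" for n
  proof (induction n)
    case 0
    show ?case using I_0 xc by (simp add: a_minus_def)
  next
    case (Suc n)
    have "x (Suc (Suc n)) \<ominus> x (Suc n) = t \<otimes> (x (Suc n) \<ominus> x n)"
    proof -
      have "(\<one> \<oplus> t \<otimes> y) \<ominus> (\<one> \<oplus> t \<otimes> z) = t \<otimes> (y \<ominus> z)"
        if "y \<in> carrier A" "z \<in> carrier A" for y z using that tc by algebra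
      from this[OF xc xc, of "Suc n" n] show ?thesis by (simp add: x(2)[symmetric])
    qed
    then show ?case using I_mult[OF t Suc] by simp
  qed
  then obtain a where a: "a \<in> carrier A" "\<And>n. a \<ominus> x n \<in> I n" using I_complete[of x] xc by blast
  \<comment> \<open>The recursion for x(n+1) leaves only the errors a - x(n+1) and t (a - x(n)),
    both in \<open>I n\<close>; separatedness then gives equality.\<close>
  have "a \<otimes> (\<one> \<ominus> t) \<ominus> \<one> \<in> I n" for n
  proof -
    have "a \<otimes> (\<one> \<ominus> t) \<ominus> \<one> = (a \<ominus> x (Suc n)) \<ominus> t \<otimes> (a \<ominus> x n)"
      using a(1) xc[of n] tc unfolding x(2) by algebra
    moreover have "a \<ominus> x (Suc n) \<in> I n" using a(2)[of "Suc n"] I_antimono[of n] by blast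
    ultimately show ?thesis using I_diff[OF _ I_lmult[OF a(2)[of n] tc]] by simp
  qed
  then have "a \<otimes> (\<one> \<ominus> t) \<ominus> \<one> = \<zero>" using a(1) tc by (intro I_separated) auto
  then have "a \<otimes> (\<one> \<ominus> t) = \<one>" using a(1) tc by (simp add: r_right_minus_eq)
  then show ?thesis using a(1) by blast
qed

text \<open>Newton iteration for y^2 - y. With d = y^2 - y the new error is d^2 (4 d - 3), so the
  order of the error rises at every step.\<close>

lemma idempotent_lift:
  assumes a: "a \<in> carrier A" "a \<otimes> a \<ominus> a \<in> I 1"
  shows "\<exists>e \<in> carrier A. e \<otimes> e = e \<and> e \<ominus> a \<in> I 1"
proof -
  \<comment> \<open>This is 3 y^2 - 2 y^3. A Newton step divides d by the derivative 2 y - 1; since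
    (2 y - 1)^2 = 1 + 4 d, the derivative is its own inverse up to the error, and multiplication by
    it replaces the division.\<close>
  define nu where "nu y = y \<oplus> (y \<otimes> y \<ominus> y) \<otimes> (\<one> \<ominus> (y \<oplus> y))" for y
  define x where "x n = (nu ^^ n) a" for n
  have x: "x 0 = a" "x (Suc n) = nu (x n)" for n by (simp_all add: x_def)
  have xc: "x n \<in> carrier A" for n by (induction n) (use a in \<open>auto simp: x nu_def\<close>)
  have inv: "x n \<otimes> x n \<ominus> x n \<in> I (Suc n)" for n
  proof (induction n)
    case 0 then show ?case using a(2) by (simp add: x)
  next
    case (Suc n)
    define y where "y = x n"
    have y: "y \<in> carrier A" by (simp add: y_def xc)
    define d where "d = y \<otimes> y \<ominus> y"
    have d: "d \<in> I (Suc n)" using Suc by (simp add: d_def y_def)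
    have dc: "d \<in> carrier A" using y by (simp add: d_def)
    \<comment> \<open>Squaring doubles the order of d; only one additional order per step is
      kept.\<close>
    have dd: "d \<otimes> d \<in> I (Suc (Suc n))"
    proof -
      have "d \<otimes> d \<in> I (Suc n + Suc n)" using d by (intro I_mult)
      moreover have "I (Suc (Suc n) + k) \<subseteq> I (Suc (Suc n))" for k
        by (induction k) (use I_antimono in auto)
      from this[of n] have "I (Suc n + Suc n) \<subseteq> I (Suc (Suc n))" by simp
      ultimately show ?thesis by blast
    qed
    define w where "w = \<one> \<ominus> (y \<oplus> y)"
    have wc: "w \<in> carrier A" using y by (simp add: w_def)
    have ww: "w \<otimes> w = \<one> \<oplus> (d \<oplus> d \<oplus> d \<oplus> d)"
      unfolding w_def d_def using y by algebra
    have "nu y \<otimes> nu y \<ominus> nu y = (y \<oplus> d \<otimes> w) \<otimes> (y \<oplus> d \<otimes> w) \<ominus> (y \<oplus> d \<otimes> w)"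
      by (simp add: nu_def d_def w_def)
    also have "\<dots> = (y \<otimes> y \<ominus> y) \<ominus> d \<otimes> (w \<otimes> (\<one> \<ominus> (y \<oplus> y))) \<oplus> d \<otimes> d \<otimes> (w \<otimes> w)"
      using y dc wc by algebra
    also have "\<dots> = d \<ominus> d \<otimes> (w \<otimes> w) \<oplus> d \<otimes> d \<otimes> (w \<otimes> w)"
      by (simp add: d_def[symmetric] w_def[symmetric])
    also have "\<dots> = (d \<otimes> d) \<otimes> (d \<oplus> d \<oplus> d \<oplus> d \<ominus> (\<one> \<oplus> \<one> \<oplus> \<one>))"
      unfolding ww using dc by algebra
    finally have "nu y \<otimes> nu y \<ominus> nu y =
       (d \<otimes> d) \<otimes> (d \<oplus> d \<oplus> d \<oplus> d \<ominus> (\<one> \<oplus> \<one> \<oplus> \<one>))" .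
    then show ?case using dd dc by (simp add: x y_def[symmetric] I_rmult)
  qed
  \<comment> \<open>One order more than \<open>I_complete\<close> asks for: at n = 0 it keeps the
    first step, and with it the limit, congruent to a modulo \<open>I 1\<close>.\<close>
  have step: "x (Suc n) \<ominus> x n \<in> I (Suc n)" for n
  proof -
    have "x (Suc n) \<ominus> x n = (x n \<otimes> x n \<ominus> x n) \<otimes> (\<one> \<ominus> (x n \<oplus> x n))"
      unfolding x nu_def using xc[of n] by algebra
    then show ?thesis using inv[of n] xc[of n] by (simp add: I_rmult)
  qed
  then have "x (Suc n) \<ominus> x n \<in> I n" for n using I_antimono by blast
  then obtain e where e: "e \<in> carrier A" "\<And>n. e \<ominus> x n \<in> I n" using I_complete[of x] xc by blast
  have "e \<otimes> e \<ominus> e \<in> I n" for n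
  proof -
    have "e \<otimes> e \<ominus> e = (e \<ominus> x n) \<otimes> (e \<oplus> x n \<ominus> \<one>) \<oplus> (x n \<otimes> x n \<ominus> x n)"
      using e(1) xc[of n] by algebra
    moreover have "(e \<ominus> x n) \<otimes> (e \<oplus> x n \<ominus> \<one>) \<in> I n"
      using e(1) xc[of n] by (intro I_rmult e(2)) simp
    moreover have "x n \<otimes> x n \<ominus> x n \<in> I n" using inv[of n] I_antimono[of n] by blast
    ultimately show ?thesis by (simp add: I_add)
  qed
  then have "e \<otimes> e \<ominus> e = \<zero>" using e(1) by (intro I_separated) auto
  then have idem: "e \<otimes> e = e" using e(1) by (simp add: r_right_minus_eq)
  have "e \<ominus> a = (e \<ominus> x 1) \<oplus> (x (Suc 0) \<ominus> x 0)"
    using e(1) xc[of 1] a(1) unfolding x(1) One_nat_def by algebra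
  then have "e \<ominus> a \<in> I 1" using I_add[OF e(2)[of 1]] step[of 0] by simp
  with idem e(1) show ?thesis by blast
qed

text \<open>With t = e - c q, idempotence gives e (1 - t) = e c q, and 1 - t is a unit. So a
  factorisation of an idempotent modulo \<open>I 1\<close> becomes a factorisation in the
  ring.\<close>

lemma idempotent_absorb:
  assumes e: "e \<in> carrier A" "e \<otimes> e = e" and c: "c \<in> carrier A" "q \<in> carrier A"
    and t: "e \<ominus> c \<otimes> q \<in> I 1"
  shows "\<exists>q' \<in> carrier A. e = c \<otimes> q'"
proof -
  define t where "t = e \<ominus> c \<otimes> q"
  have t1: "t \<in> I 1" and tc: "t \<in> carrier A" using t e c by (auto simp: t_def)
  obtain u where u: "u \<in> carrier A" "u \<otimes> (\<one> \<ominus> t) = \<one>" using one_minus_unit[OF t1] by blast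
  have "e \<otimes> (\<one> \<ominus> t) = e \<ominus> e \<otimes> e \<oplus> e \<otimes> (c \<otimes> q)" unfolding t_def using e(1) c by algebra
  also have "\<dots> = e \<otimes> (c \<otimes> q)" using e(1) c unfolding e(2) by algebra
  finally have 1: "e \<otimes> (\<one> \<ominus> t) = e \<otimes> (c \<otimes> q)" .
  have "e = e \<otimes> (u \<otimes> (\<one> \<ominus> t))" using u e by simp
  also have "\<dots> = u \<otimes> (e \<otimes> (\<one> \<ominus> t))" using u(1) e(1) tc by algebra
  also have "\<dots> = c \<otimes> (u \<otimes> e \<otimes> q)" unfolding 1 using u(1) e(1) c by algebra
  finally show ?thesis using u(1) e(1) c by blast
qed

text \<open>Modulo \<open>I 1\<close> the powers of \<open>c\<close> stabilise as ideals, so some power of \<open>c\<close> times a ring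
  element is idempotent there; lifting it yields the splitting.\<close>

lemma fitting_idempotent:
  assumes c: "c \<in> carrier A" and h: "h \<in> carrier A"
    and r: "c [^] (r :: nat) \<ominus> c [^] Suc r \<otimes> h \<in> I 1"
  shows "\<exists>e \<in> carrier A. \<exists>q \<in> carrier A. \<exists>q' \<in> carrier A.
    e \<otimes> e = e \<and> e = c \<otimes> q \<and> \<one> \<ominus> e = (\<one> \<ominus> c) \<otimes> q'"
proof -
  \<comment> \<open>The exponent is raised by one so that c^s has a factor c to spare; this factor
    later exhibits e as a multiple of c.\<close>
  define s where "s = Suc r"
  have s: "c [^] s \<ominus> c [^] s \<otimes> (c \<otimes> h) \<in> I 1"
  proof -
    have "c [^] s \<ominus> c [^] s \<otimes> (c \<otimes> h) = c \<otimes> (c [^] r \<ominus> c [^] Suc r \<otimes> h)"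
      unfolding s_def nat_pow_Suc using c h nat_pow_closed[OF c, of r] by algebra
    then show ?thesis using I_lmult[OF r c] by simp
  qed
  have pk: "c [^] s \<ominus> c [^] s \<otimes> (c \<otimes> h) [^] (k::nat) \<in> I 1" for k
  proof (induction k)
    case 0 then show ?case using c by (simp add: a_minus_def r_neg
        additive_subgroup.zero_closed[OF ideal.axioms(1)[OF I_ideal]])
  next
    case (Suc k)
    have cs: "c [^] s \<in> carrier A" "(c \<otimes> h) [^] k \<in> carrier A" using c h by auto
    have "c [^] s \<ominus> c [^] s \<otimes> (c \<otimes> h) [^] Suc k =
      (c [^] s \<ominus> c [^] s \<otimes> (c \<otimes> h) [^] k) \<oplus> (c [^] s \<ominus> c [^] s \<otimes> (c \<otimes> h)) \<otimes> (c \<otimes> h) [^] k"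
      unfolding nat_pow_Suc using c h cs by algebra
    then show ?case using I_add[OF Suc I_rmult[OF s cs(2)]] by simp
  qed
  \<comment> \<open>Modulo \<open>I 1\<close>, multiplication by a fixes c^s, and a is a multiple of
    c^s; hence a^2 is congruent to a.\<close>
  define a where "a = (c \<otimes> h) [^] s"
  have ac: "a \<in> carrier A" and hs: "h [^] s \<in> carrier A" and cs: "c [^] s \<in> carrier A"
    using c h by (auto simp: a_def)
  have acs: "a = c [^] s \<otimes> h [^] s" unfolding a_def using c h by (simp add: nat_pow_distrib)
  have 1: "c [^] s \<ominus> c [^] s \<otimes> a \<in> I 1" using pk[of s] by (simp add: a_def)
  have "a \<otimes> a \<ominus> a = \<ominus> (h [^] s \<otimes> (c [^] s \<ominus> c [^] s \<otimes> a))"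
  proof -
    have "\<ominus> (h [^] s \<otimes> (c [^] s \<ominus> c [^] s \<otimes> a)) = c [^] s \<otimes> h [^] s \<otimes> a \<ominus> c [^] s \<otimes> h [^] s"
      using hs cs ac by algebra
    then show ?thesis by (simp add: acs[symmetric])
  qed
  then have "a \<otimes> a \<ominus> a \<in> I 1" using 1 hs by (simp add: I_neg I_lmult)
  then obtain e where e: "e \<in> carrier A" "e \<otimes> e = e" "e \<ominus> a \<in> I 1"
    using idempotent_lift ac by blast
  have "a = c \<otimes> (c [^] r \<otimes> h [^] s)" unfolding acs unfolding s_def nat_pow_Suc
    using c h nat_pow_closed[OF c, of r] nat_pow_closed[OF h, of r] by algebra
  then obtain q where q: "q \<in> carrier A" "e = c \<otimes> q"
    using idempotent_absorb[OF e(1,2) c, of "c [^] r \<otimes> h [^] s"] e(3) c h by auto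
  \<comment> \<open>The finite geometric sum: 1 - c divides 1 - c^k. The case k = s serves to factor
    1 - e.\<close>
  have geo: "\<exists>p \<in> carrier A. \<one> \<ominus> c [^] (k::nat) = (\<one> \<ominus> c) \<otimes> p" for k
  proof (induction k)
    case 0 show ?case by (rule bexI[of _ \<zero>]) (use c in \<open>auto simp: a_minus_def r_neg\<close>)
  next
    case (Suc k)
    then obtain p where p: "p \<in> carrier A" "\<one> \<ominus> c [^] k = (\<one> \<ominus> c) \<otimes> p" by blast
    have "\<one> \<ominus> c [^] Suc k = (\<one> \<ominus> c [^] k) \<otimes> c \<oplus> (\<one> \<ominus> c)"
      unfolding nat_pow_Suc using c nat_pow_closed[OF c, of k] by algebra
    also have "\<dots> = (\<one> \<ominus> c) \<otimes> (p \<otimes> c \<oplus> \<one>)" unfolding p(2) using p(1) c by algebra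
    finally show ?case using p(1) c by blast
  qed
  then obtain p where p: "p \<in> carrier A" "\<one> \<ominus> c [^] s = (\<one> \<ominus> c) \<otimes> p" by blast
  have ec: "\<one> \<ominus> e \<in> carrier A" using e by simp
  have eid: "(\<one> \<ominus> e) \<otimes> (\<one> \<ominus> e) = \<one> \<ominus> e"
  proof -
    have "(\<one> \<ominus> e) \<otimes> (\<one> \<ominus> e) = \<one> \<ominus> e \<ominus> e \<oplus> e \<otimes> e" using e(1) by algebra
    also have "\<dots> = \<one> \<ominus> e" unfolding e(2) using e(1) by algebra
    finally show ?thesis .
  qed
  \<comment> \<open>The product (1 - c^s) (1 - a) is 1 - a up to c^s - c^s a, hence congruent to 1 -
    e; so 1 - e is congruent to a multiple of 1 - c.\<close>
  have "\<one> \<ominus> e \<ominus> (\<one> \<ominus> c) \<otimes> (p \<otimes> (\<one> \<ominus> a)) \<in> I 1"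
  proof -
    have "\<one> \<ominus> e \<ominus> (\<one> \<ominus> c) \<otimes> (p \<otimes> (\<one> \<ominus> a)) = \<one> \<ominus> e \<ominus> ((\<one> \<ominus> c) \<otimes> p) \<otimes> (\<one> \<ominus> a)"
      using e(1) p(1) c ac by algebra
    also have "\<dots> = (c [^] s \<ominus> c [^] s \<otimes> a) \<ominus> (e \<ominus> a)"
      unfolding p(2)[symmetric] using e(1) cs ac by algebra
    finally show ?thesis using 1 e(3) by (simp add: I_diff)
  qed
  then obtain q' where "q' \<in> carrier A" "\<one> \<ominus> e = (\<one> \<ominus> c) \<otimes> q'"
    using idempotent_absorb[OF ec eid, of "\<one> \<ominus> c" "p \<otimes> (\<one> \<ominus> a)"] p(1) c ac by auto
  with e q show ?thesis by blast
qed

end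

section \<open>Sequences of vectors over a Noetherian ring\<close>

context cring
begin

text \<open>Linear dependence of \<open>u\<close> on the first \<open>n\<close> vectors, tested only
  at the coordinates in \<open>J\<close>. Values elsewhere are ignored, so the same functions can be
  read as vectors over a smaller index set.\<close>

definition seq_comb :: "'i set \<Rightarrow> (nat \<Rightarrow> 'i \<Rightarrow> 'a) \<Rightarrow> nat \<Rightarrow> ('i \<Rightarrow> 'a) \<Rightarrow> bool" where
  "seq_comb J v n u \<longleftrightarrow>
    (\<exists>c. range c \<subseteq> carrier R \<and> (\<forall>b\<in>J. u b = (\<Oplus>i\<in>{..<n}. c i \<otimes> v i b)))"

lemma seq_combI:
  "\<lbrakk>\<And>i. c i \<in> carrier R; \<And>b. b \<in> J \<Longrightarrow> u b = (\<Oplus>i\<in>{..<n}. c i \<otimes> v i b)\<rbrakk> \<Longrightarrow> seq_comb J v n u"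
  unfolding seq_comb_def by (intro exI[of _ c]) auto

lemma seq_combE:
  assumes "seq_comb J v n u"
  obtains c where "\<And>i. c i \<in> carrier R" "\<And>b. b \<in> J \<Longrightarrow> u b = (\<Oplus>i\<in>{..<n}. c i \<otimes> v i b)"
proof -
  from assms obtain c where "range c \<subseteq> carrier R \<and> (\<forall>b\<in>J. u b = (\<Oplus>i\<in>{..<n}. c i \<otimes> v i b))"
    unfolding seq_comb_def ..
  then show thesis by (intro that[of c]) auto
qed

lemma seq_comb_cong:
  assumes "seq_comb J v n u" "\<And>b. b \<in> J \<Longrightarrow> u b = u' b"
  shows "seq_comb J v n u'"
  using assms(1) by (rule seq_combE) (rule seq_combI, auto simp: assms(2)[symmetric])

context
  fixes J :: "'i set" and v :: "nat \<Rightarrow> 'i \<Rightarrow> 'a"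
  assumes v: "\<And>i b. b \<in> J \<Longrightarrow> v i b \<in> carrier R"
begin

lemma seq_comb_add:
  assumes "seq_comb J v n u" "seq_comb J v n w"
  shows "seq_comb J v n (\<lambda>b. u b \<oplus> w b)"
proof -
  obtain c where c: "\<And>i. c i \<in> carrier R" "\<And>b. b \<in> J \<Longrightarrow> u b = (\<Oplus>i\<in>{..<n}. c i \<otimes> v i b)"
    by (rule seq_combE[OF assms(1)]) (rule that, assumption, assumption)
  obtain c' where c': "\<And>i. c' i \<in> carrier R" "\<And>b. b \<in> J \<Longrightarrow> w b = (\<Oplus>i\<in>{..<n}. c' i \<otimes> v i b)"
    by (rule seq_combE[OF assms(2)]) (rule that, assumption, assumption)
  have "u b \<oplus> w b = (\<Oplus>i\<in>{..<n}. (c i \<oplus> c' i) \<otimes> v i b)" if "b \<in> J" for b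
    using that v c(1) c'(1) by (simp add: c(2) c'(2) l_distr finsum_addf)
  then show ?thesis by (rule seq_combI[rotated]) (use c c' assms in auto)
qed

lemma seq_comb_smult:
  assumes "seq_comb J v n u" "a \<in> carrier R"
  shows "seq_comb J v n (\<lambda>b. a \<otimes> u b)"
proof -
  obtain c where c: "\<And>i. c i \<in> carrier R" "\<And>b. b \<in> J \<Longrightarrow> u b = (\<Oplus>i\<in>{..<n}. c i \<otimes> v i b)"
    by (rule seq_combE[OF assms(1)]) (rule that, assumption, assumption)
  have "a \<otimes> u b = (\<Oplus>i\<in>{..<n}. (a \<otimes> c i) \<otimes> v i b)" if "b \<in> J" for b
    using that v c(1) assms(2) by (simp add: c(2) finsum_rdistr m_assoc)
  then show ?thesis by (rule seq_combI[rotated]) (use c assms in auto)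
qed

lemma seq_comb_Suc:
  assumes "seq_comb J v n u"
  shows "seq_comb J v (Suc n) u"
proof -
  obtain c where c: "\<And>i. c i \<in> carrier R" "\<And>b. b \<in> J \<Longrightarrow> u b = (\<Oplus>i\<in>{..<n}. c i \<otimes> v i b)"
    by (rule seq_combE[OF assms(1)]) (rule that, assumption, assumption)
  have "u b = (\<Oplus>i\<in>{..<Suc n}. (c(n := \<zero>)) i \<otimes> v i b)" if "b \<in> J" for b
  proof -
    have "(\<Oplus>i\<in>{..<n}. (c(n := \<zero>)) i \<otimes> v i b) = (\<Oplus>i\<in>{..<n}. c i \<otimes> v i b)"
      using that v c(1) by (intro finsum_cong') auto
    then show ?thesis using that v c(1) by (simp add: lessThan_Suc finsum_insert Pi_iff c(2) finsum_closed)
  qed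
  then show ?thesis by (rule seq_combI[rotated]) (use c assms in auto)
qed

lemma seq_comb_mono: "\<lbrakk>seq_comb J v n u; n \<le> m\<rbrakk> \<Longrightarrow> seq_comb J v m u"
  by (induction m) (auto simp: le_Suc_eq seq_comb_Suc)

lemma seq_comb_zero: "seq_comb J v n (\<lambda>_. \<zero>)"
  using v by (intro seq_combI[of "\<lambda>_. \<zero>"]) (auto cong: finsum_cong')

lemma seq_comb_base: "i < n \<Longrightarrow> seq_comb J v n (v i)"
proof -
  assume "i < n"
  have "v i b = (\<Oplus>j\<in>{..<n}. (if i = j then \<one> else \<zero>) \<otimes> v j b)" if b: "b \<in> J" for b
  proof -
    have "(\<Oplus>j\<in>{..<n}. (if i = j then \<one> else \<zero>) \<otimes> v j b) = (\<Oplus>j\<in>{..<n}. if i = j then v j b else \<zero>)"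
      using b v by (intro finsum_cong') auto
    then show ?thesis using add.finprod_singleton[of i "{..<n}" "\<lambda>j. v j b"] \<open>i < n\<close> v b by simp
  qed
  then show ?thesis by (rule seq_combI[rotated]) auto
qed

lemma seq_comb_sum:
  assumes "finite A" "\<And>i. i \<in> A \<Longrightarrow> seq_comb J v n (u i)" "\<And>i b. \<lbrakk>i \<in> A; b \<in> J\<rbrakk> \<Longrightarrow> u i b \<in> carrier R"
  shows "seq_comb J v n (\<lambda>b. \<Oplus>i\<in>A. u i b)"
  using assms
proof (induction A rule: finite_induct)
  case empty then show ?case by (simp add: seq_comb_zero)
next
  case (insert a A)
  then have "seq_comb J v n (\<lambda>b. u a b \<oplus> (\<Oplus>i\<in>A. u i b))" by (intro seq_comb_add) auto
  moreover have "u a b \<oplus> (\<Oplus>i\<in>A. u i b) = (\<Oplus>i\<in>insert a A. u i b)" if "b \<in> J" for b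
    using insert that by (subst finsum_insert) auto
  ultimately show ?case by (rule seq_comb_cong)
qed

end
end

text \<open>A concrete form of the fact that R^J is a Noetherian module, by induction on
  \<open>J\<close>. The chain condition on ideals settles one coordinate b; subtracting suitable
  combinations kills that coordinate, and the induction hypothesis applies to the
  differences.\<close>

lemma seq_eventually_comb:
  fixes v :: "nat \<Rightarrow> 'i \<Rightarrow> 'a" and R (structure)
  assumes R: "cring R" "noetherian_ring R" and "finite J"
    and v: "\<And>i b. b \<in> J \<Longrightarrow> v i b \<in> carrier R"
  shows "\<exists>d. cring.seq_comb R J v d (v d)"
proof -
  interpret cring R by (rule R)
  interpret noetherian_ring R by (rule R)
  show ?thesis using \<open>finite J\<close> v
  proof (induction J arbitrary: v rule: finite_induct)
    case empty
    then show ?case by (intro exI[of _ 0] seq_combI[of "\<lambda>_. \<zero>"]) auto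
  next
    case (insert b J)
    have vb: "v i x \<in> carrier R" if "x \<in> {b}" for i x using insert.prems that by simp
    \<comment> \<open>The ideal generated by the values at b of the first n vectors.\<close>
    define K where "K n = {u \<in> carrier R. seq_comb {b} v n (\<lambda>_. u)}" for n
    have ideal: "ideal (K n) R" for n
    proof (rule idealI)
      show "subgroup (K n) (add_monoid R)"
      proof (rule add.subgroupI)
        show "K n \<noteq> {}" using seq_comb_zero[where J="{b}" and v=v, OF vb] by (auto simp: K_def)
      next
        fix u assume "u \<in> K n"
        then show "\<ominus> u \<in> K n"
          using seq_comb_smult[where J="{b}" and v=v, OF vb, of n "\<lambda>_. u" "\<ominus> \<one>"]
          by (auto simp: K_def l_minus)
      next
        fix u w assume "u \<in> K n" "w \<in> K n"
        then show "u \<oplus> w \<in> K n"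
          using seq_comb_add[where J="{b}" and v=v, OF vb, of n "\<lambda>_. u" "\<lambda>_. w"] by (auto simp: K_def)
      qed (auto simp: K_def)
    next
      fix u a assume "u \<in> K n" "a \<in> carrier R"
      then show "a \<otimes> u \<in> K n" using seq_comb_smult[where J="{b}" and v=v, OF vb, of n "\<lambda>_. u" a] by (auto simp: K_def)
      then show "u \<otimes> a \<in> K n" using \<open>u \<in> K n\<close> \<open>a \<in> carrier R\<close> by (auto simp: m_comm K_def)
    qed (rule ring_axioms)
    have mono: "K n \<subseteq> K m" if "n \<le> m" for n m
      using seq_comb_mono[where J="{b}" and v=v, OF vb _ that] by (auto simp: K_def)
    have "subset.chain {I. ideal I R} (range K)"
    proof -
      have "K n \<subset> K m \<or> K m \<subset> K n \<or> K n = K m" for n m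
        using mono[of n m] mono[of m n] by (cases "n \<le> m") auto
      then show ?thesis unfolding subset.chain_def using ideal by auto
    qed
    \<comment> \<open>In a Noetherian ring a chain of ideals contains its union; the index of that
      member is the k from which the ideals no longer grow.\<close>
    then have "\<Union> (range K) \<in> range K" using ideal_chain_is_trivial by blast
    then obtain k where k: "\<Union> (range K) = K k" by blast
    have "v i b \<in> K k" for i
    proof -
      have "seq_comb {b} v (Suc i) (\<lambda>_. v i b)"
        using seq_comb_base[where J="{b}" and v=v, OF vb, of i "Suc i"] by (simp add: seq_comb_def)
      then have "v i b \<in> K (Suc i)" using insert.prems by (simp add: K_def)
      then show ?thesis using k by blast
    qed
    then have "\<exists>c. range c \<subseteq> carrier R \<and> v (k + i) b = (\<Oplus>j\<in>{..<k}. c j \<otimes> v j b)" for i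
      by (simp add: K_def seq_comb_def)
    then obtain c where c: "\<And>i. range (c i) \<subseteq> carrier R"
        "\<And>i. v (k + i) b = (\<Oplus>j\<in>{..<k}. c i j \<otimes> v j b)" by metis
    have cc: "c i j \<in> carrier R" for i j using c(1)[of i] by auto
    \<comment> \<open>\<open>s i\<close> combines the first k vectors and agrees with
      \<open>v (k + i)\<close> at b, so the difference \<open>w i\<close> vanishes there.\<close>
    define s where "s i x = (\<Oplus>j\<in>{..<k}. c i j \<otimes> v j x)" for i x
    define w where "w i x = v (k + i) x \<ominus> s i x" for i x
    have sc: "s i x \<in> carrier R" if "x \<in> insert b J" for i x
      unfolding s_def using cc insert.prems that by (auto intro!: finsum_closed)
    have wc: "w i x \<in> carrier R" if "x \<in> insert b J" for i x
      unfolding w_def using sc insert.prems that by auto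
    have wb: "w i b = \<zero>" for i
      using sc[of b] unfolding w_def c(2) s_def[symmetric] by (simp add: a_minus_def r_neg)
    have "\<exists>d. seq_comb J w d (w d)" by (rule insert.IH) (simp add: wc)
    then obtain d where "seq_comb J w d (w d)" ..
    then obtain a where ac: "\<And>i. a i \<in> carrier R"
        and a: "\<And>x. x \<in> J \<Longrightarrow> w d x = (\<Oplus>i\<in>{..<d}. a i \<otimes> w i x)"
      by (rule seq_combE) (rule that, assumption, assumption)
    let ?S = "seq_comb (insert b J) v (k + d)"
    note cl = insert.prems
    have S1: "?S (s i)" for i
    proof -
      have "seq_comb (insert b J) v k (s i)"
        by (rule seq_combI[of "c i"]) (simp_all add: cc s_def)
      then show ?thesis using seq_comb_mono[where J="insert b J" and v=v, OF cl, of k "s i" "k+d"] by simp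
    qed
    have S2: "?S (w i)" if "i < d" for i
    proof -
      have "?S (\<lambda>x. v (k + i) x \<oplus> (\<ominus> \<one>) \<otimes> s i x)"
        using that S1 by (intro seq_comb_add seq_comb_smult seq_comb_base cl) auto
      then show ?thesis
        by (rule seq_comb_cong)
          (use sc in \<open>auto simp: w_def a_minus_def l_minus\<close>)
    qed
    \<comment> \<open>Adding \<open>s d\<close> back turns the relation for \<open>w d\<close> into
      one for \<open>v (k + d)\<close>: each \<open>s i\<close>, and each \<open>w i\<close> with i
      < d, depends on the first k + d vectors.\<close>
    have "?S (\<lambda>x. (\<Oplus>i\<in>{..<d}. a i \<otimes> w i x) \<oplus> s d x)"
      using S1 S2 ac wc by (intro seq_comb_add seq_comb_sum seq_comb_smult cl) auto
    then have "?S (v (k + d))"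
    proof (rule seq_comb_cong)
      fix x assume x: "x \<in> insert b J"
      have "w d x = (\<Oplus>i\<in>{..<d}. a i \<otimes> w i x)"
      \<comment> \<open>The induction hypothesis speaks about \<open>J\<close> only; at b both sides
        are zero.\<close>
      proof (cases "x = b")
        case True
        have "(\<Oplus>i\<in>{..<d}. a i \<otimes> w i b) = (\<Oplus>i\<in>{..<d}. \<zero>)"
          using ac by (intro finsum_cong') (auto simp: wb)
        then show ?thesis using True wb by simp
      qed (use a x in auto)
      then have "(\<Oplus>i\<in>{..<d}. a i \<otimes> w i x) = v (k + d) x \<ominus> s d x" by (simp add: w_def)
      moreover have "(v (k + d) x \<ominus> s d x) \<oplus> s d x = v (k + d) x"
        using sc[OF x, of d] cl[OF x, of "k+d"] by algebra
      ultimately show "(\<Oplus>i\<in>{..<d}. a i \<otimes> w i x) \<oplus> s d x = v (k + d) x" by simp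
    qed
    then show ?case by blast
  qed
qed

section \<open>Adjoining a root of a monic polynomial\<close>

lemma module_homD:
  assumes "f \<in> module_hom R M N"
  shows "x \<in> carrier M \<Longrightarrow> f x \<in> carrier N"
    and "\<lbrakk>x \<in> carrier M; y \<in> carrier M\<rbrakk> \<Longrightarrow> f (x \<oplus>\<^bsub>M\<^esub> y) = f x \<oplus>\<^bsub>N\<^esub> f y"
    and "\<lbrakk>r \<in> carrier R; x \<in> carrier M\<rbrakk> \<Longrightarrow> f (r \<odot>\<^bsub>M\<^esub> x) = r \<odot>\<^bsub>N\<^esub> f x"
  using assms by (auto simp: module_hom_def)

lemma module_homI:
  assumes "\<And>x. x \<in> carrier M \<Longrightarrow> f x \<in> carrier N"
    and "\<And>x y. \<lbrakk>x \<in> carrier M; y \<in> carrier M\<rbrakk> \<Longrightarrow> f (x \<oplus>\<^bsub>M\<^esub> y) = f x \<oplus>\<^bsub>N\<^esub> f y"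
    and "\<And>r x. \<lbrakk>r \<in> carrier R; x \<in> carrier M\<rbrakk> \<Longrightarrow> f (r \<odot>\<^bsub>M\<^esub> x) = r \<odot>\<^bsub>N\<^esub> f x"
  shows "f \<in> module_hom R M N"
  using assms by (auto simp: module_hom_def)

lemma module_hom_zero:
  assumes "module R M" "module R N" "f \<in> module_hom R M N"
  shows "f \<zero>\<^bsub>M\<^esub> = \<zero>\<^bsub>N\<^esub>"
proof -
  interpret M: module R M by fact
  interpret N: module R N by fact
  have "f \<zero>\<^bsub>M\<^esub> = f (\<zero>\<^bsub>R\<^esub> \<odot>\<^bsub>M\<^esub> \<zero>\<^bsub>M\<^esub>)" by simp
  also have "\<dots> = \<zero>\<^bsub>R\<^esub> \<odot>\<^bsub>N\<^esub> f \<zero>\<^bsub>M\<^esub>" by (rule module_homD(3)[OF assms(3)]) simp_all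
  also have "\<dots> = \<zero>\<^bsub>N\<^esub>" using module_homD(1)[OF assms(3)] by simp
  finally show ?thesis .
qed

lemma module_hom_minus:
  assumes "module R M" "module R N" "f \<in> module_hom R M N" "x \<in> carrier M" "y \<in> carrier M"
  shows "f (x \<ominus>\<^bsub>M\<^esub> y) = f x \<ominus>\<^bsub>N\<^esub> f y"
proof -
  interpret M: module R M by fact
  interpret N: module R N by fact
  have "f (\<ominus>\<^bsub>M\<^esub> y) \<oplus>\<^bsub>N\<^esub> f y = \<zero>\<^bsub>N\<^esub>"
    using assms module_homD(2)[OF assms(3), of "\<ominus>\<^bsub>M\<^esub> y" y] module_hom_zero[OF assms(1-3)]
    by (simp add: M.l_neg)
  then have "f (\<ominus>\<^bsub>M\<^esub> y) = \<ominus>\<^bsub>N\<^esub> f y"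
    using assms module_homD(1)[OF assms(3)] by (metis M.a_inv_closed N.minus_equality)
  then show ?thesis using assms module_homD[OF assms(3)] by (simp add: a_minus_def)
qed

lemma module_hom_finsum:
  assumes "module R M" "module R N" "f \<in> module_hom R M N" "finite A" "u \<in> A \<rightarrow> carrier M"
  shows "f (\<Oplus>\<^bsub>M\<^esub>i\<in>A. u i) = (\<Oplus>\<^bsub>N\<^esub>i\<in>A. f (u i))"
proof -
  interpret M: module R M by fact
  interpret N: module R N by fact
  show ?thesis using assms(4,5)
  proof (induction A rule: finite_induct)
    case empty show ?case using module_hom_zero[OF assms(1-3)] by simp
  next
    case (insert a A)
    then have "f (\<Oplus>\<^bsub>M\<^esub>i\<in>A. u i) = (\<Oplus>\<^bsub>N\<^esub>i\<in>A. f (u i))" "(\<Oplus>\<^bsub>M\<^esub>i\<in>A. u i) \<in> carrier M"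
      by (auto intro!: M.finsum_closed)
    then show ?case using insert module_homD[OF assms(3)]
      by (simp add: M.finsum_insert N.finsum_insert Pi_iff)
  qed
qed

lemma (in abelian_group) minus_eq_zero_iff:
  assumes "a \<in> carrier G" "b \<in> carrier G"
  shows "a \<ominus> b = \<zero> \<longleftrightarrow> a = b"
proof
  assume 0: "a \<ominus> b = \<zero>"
  have "a = (a \<ominus> b) \<oplus> b" using assms by (simp add: a_minus_def a_assoc l_neg)
  then show "a = b" unfolding 0 using assms by simp
qed (use assms in \<open>simp add: a_minus_def r_neg\<close>)

lemma module_hom_diff:
  assumes M: "module R M" and N: "module R N" and f: "f \<in> module_hom R M N" and g: "g \<in> module_hom R M N"
  shows "(\<lambda>x. f x \<ominus>\<^bsub>N\<^esub> g x) \<in> module_hom R M N"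
proof -
  interpret M: module R M by (rule M)
  interpret N: module R N by (rule N)
  note fD = module_homD[OF f] and gD = module_homD[OF g]
  show ?thesis
  proof (rule module_homI)
    fix x y assume xy: "x \<in> carrier M" "y \<in> carrier M"
    show "f (x \<oplus>\<^bsub>M\<^esub> y) \<ominus>\<^bsub>N\<^esub> g (x \<oplus>\<^bsub>M\<^esub> y) = f x \<ominus>\<^bsub>N\<^esub> g x \<oplus>\<^bsub>N\<^esub> (f y \<ominus>\<^bsub>N\<^esub> g y)"
      using xy fD(1) gD(1) by (simp add: fD(2) gD(2) a_minus_def N.minus_add N.a_assoc N.a_lcomm)
  next
    fix r x assume rx: "r \<in> carrier R" "x \<in> carrier M"
    show "f (r \<odot>\<^bsub>M\<^esub> x) \<ominus>\<^bsub>N\<^esub> g (r \<odot>\<^bsub>M\<^esub> x) = r \<odot>\<^bsub>N\<^esub> (f x \<ominus>\<^bsub>N\<^esub> g x)"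
      using rx fD(1) gD(1) by (simp add: fD(3) gD(3) a_minus_def N.smult_r_distr N.smult_r_minus)
  qed (use fD gD in simp)
qed

lemma module_hom_add:
  assumes M: "module R M" and N: "module R N" and f: "f \<in> module_hom R M N" and g: "g \<in> module_hom R M N"
  shows "(\<lambda>x. f x \<oplus>\<^bsub>N\<^esub> g x) \<in> module_hom R M N"
proof -
  interpret N: module R N by (rule N)
  note fD = module_homD[OF f] and gD = module_homD[OF g]
  show ?thesis
    by (rule module_homI) (auto simp: fD gD N.a_ac N.smult_r_distr)
qed

lemma module_hom_comp:
  "\<lbrakk>f \<in> module_hom R L M; g \<in> module_hom R M N\<rbrakk> \<Longrightarrow> (\<lambda>x. g (f x)) \<in> module_hom R L N"
  by (rule module_homI) (auto simp: module_homD)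

lemma module_hom_inverse:
  assumes M: "module R M" and f: "f \<in> module_hom R M N" and bij: "bij_betw f (carrier M) (carrier N)"
  obtains g where "g \<in> module_hom R N M" "\<And>x. x \<in> carrier M \<Longrightarrow> g (f x) = x"
    "\<And>y. y \<in> carrier N \<Longrightarrow> f (g y) = y"
proof -
  interpret M: module R M by (rule M)
  define g where "g = inv_into (carrier M) f"
  have gf: "g (f x) = x" if "x \<in> carrier M" for x
    using that bij by (simp add: g_def bij_betw_inv_into_left)
  have fg: "f (g y) = y" if "y \<in> carrier N" for y
    using that bij by (simp add: g_def bij_betw_inv_into_right)
  have gc: "g y \<in> carrier M" if "y \<in> carrier N" for y
    using that bij unfolding g_def by (metis bij_betw_imp_surj_on inv_into_into)
  have "g \<in> module_hom R N M"
  proof (rule module_homI)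
    fix x y assume xy: "x \<in> carrier N" "y \<in> carrier N"
    show "g (x \<oplus>\<^bsub>N\<^esub> y) = g x \<oplus>\<^bsub>M\<^esub> g y"
      using gf[of "g x \<oplus>\<^bsub>M\<^esub> g y"] module_homD(2)[OF f gc[OF xy(1)] gc[OF xy(2)]] gc xy fg by simp
  next
    fix r x assume rx: "r \<in> carrier R" "x \<in> carrier N"
    show "g (r \<odot>\<^bsub>N\<^esub> x) = r \<odot>\<^bsub>M\<^esub> g x"
      using gf[of "r \<odot>\<^bsub>M\<^esub> g x"] module_homD(3)[OF f rx(1) gc[OF rx(2)]] gc rx fg by simp
  qed (rule gc)
  then show thesis using gf fg that by blast
qed

lemma mod_iso_sym:
  assumes M: "module R M" and iso: "mod_iso R M N"
  shows "mod_iso R N M"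
proof -
  obtain f where f: "f \<in> module_hom R M N" "bij_betw f (carrier M) (carrier N)"
    using iso by (auto simp: mod_iso_def)
  obtain g where g: "g \<in> module_hom R N M" "\<And>x. x \<in> carrier M \<Longrightarrow> g (f x) = x"
    "\<And>y. y \<in> carrier N \<Longrightarrow> f (g y) = y" using module_hom_inverse[OF M f] by blast
  have "bij_betw g (carrier N) (carrier M)"
    using g module_homD(1)[OF f(1)] module_homD(1)[OF g(1)] by (intro bij_betw_byWitness[of _ f]) auto
  then show ?thesis using g(1) by (auto simp: mod_iso_def)
qed

lemma module_hom_id: "(\<lambda>x. x) \<in> module_hom R M M"
  by (rule module_homI) simp_all

lemma module_hom_scale:
  assumes M: "module R M" and r: "r \<in> carrier R"
  shows "(\<lambda>x. r \<odot>\<^bsub>M\<^esub> x) \<in> module_hom R M M"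
proof -
  interpret M: module R M by (rule M)
  show ?thesis
    using r by (intro module_homI) (auto simp: M.smult_r_distr M.smult_assoc1[symmetric] M.m_comm)
qed

section \<open>Polynomials in an endomorphism\<close>

lemma (in abelian_monoid) finsum_lessThan_Suc:
  "a \<in> {..<Suc k} \<rightarrow> carrier G \<Longrightarrow> (\<Oplus>i\<in>{..<Suc k}. a i) = a k \<oplus> (\<Oplus>i\<in>{..<k}. a i)"
  by (simp add: lessThan_Suc finsum_insert Pi_iff)

lemma (in abelian_monoid) finsum_lessThan_Suc2:
  "a \<in> {..<Suc k} \<rightarrow> carrier G \<Longrightarrow> (\<Oplus>i\<in>{..<Suc k}. a i) = a 0 \<oplus> (\<Oplus>i\<in>{..<k}. a (Suc i))"
proof (induction k)
  case (Suc k)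
  then have "(\<Oplus>i\<in>{..<Suc k}. a i) = a 0 \<oplus> (\<Oplus>i\<in>{..<k}. a (Suc i))" by (auto simp: Pi_iff)
  then show ?case
    using Suc.prems finsum_lessThan_Suc[of a "Suc k"] finsum_lessThan_Suc[of "\<lambda>i. a (Suc i)" k]
      finsum_closed[of "\<lambda>i. a (Suc i)" "{..<k}"]
    by (auto simp: Pi_iff a_ac)
qed (simp add: lessThan_Suc finsum_insert Pi_iff)

text \<open>The polynomial with coefficients v_0, ..., v_(d-1), evaluated at f and applied to x. The
  coefficients are a bare function, so that both a relation and an element of
  \<open>free_mod R d\<close> can be inserted.\<close>

definition poly_act :: "('a, 'm) module \<Rightarrow> ('m \<Rightarrow> 'm) \<Rightarrow> nat \<Rightarrow> (nat \<Rightarrow> 'a) \<Rightarrow> 'm \<Rightarrow> 'm" where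
  "poly_act M f d v x = (\<Oplus>\<^bsub>M\<^esub>i\<in>{..<d}. v i \<odot>\<^bsub>M\<^esub> (f ^^ i) x)"

lemma funpow_module_hom: "f \<in> module_hom R M M \<Longrightarrow> f ^^ i \<in> module_hom R M M"
  by (induction i) (auto simp: module_hom_def Pi_iff)

text \<open>If h f = g h, then h carries every polynomial in f to the same polynomial in g. Taking
  for h a scalar, f itself, another polynomial in f, or an evaluation map yields the linearity,
  commutation and product rules that follow.\<close>

lemma poly_act_intertwine:
  assumes M: "module R M" and N: "module R N" and f: "f \<in> module_hom R M M" and g: "g \<in> module_hom R N N"
    and h: "h \<in> module_hom R M N" and comm: "\<And>x. x \<in> carrier M \<Longrightarrow> h (f x) = g (h x)"
    and v: "v \<in> {..<d} \<rightarrow> carrier R" and x: "x \<in> carrier M"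
  shows "h (poly_act M f d v x) = poly_act N g d v (h x)"
proof -
  interpret M: module R M by fact
  interpret N: module R N by fact
  note fi = module_homD(1)[OF funpow_module_hom[OF f] x]
  note gi = module_homD(1)[OF funpow_module_hom[OF g] module_homD(1)[OF h x]]
  have pw: "h ((f ^^ i) x) = (g ^^ i) (h x)" for i
    by (induction i) (use fi comm in auto)
  have "h (poly_act M f d v x) = (\<Oplus>\<^bsub>N\<^esub>i\<in>{..<d}. h (v i \<odot>\<^bsub>M\<^esub> (f ^^ i) x))"
    unfolding poly_act_def using v fi by (intro module_hom_finsum[OF M N h]) (auto simp: Pi_iff)
  also have "\<dots> = poly_act N g d v (h x)"
    unfolding poly_act_def using v fi gi
    by (intro N.finsum_cong') (auto simp: module_homD(3)[OF h] pw Pi_iff)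
  finally show ?thesis .
qed

lemma poly_act_module_hom:
  assumes M: "module R M" and f: "f \<in> module_hom R M M" and v: "v \<in> {..<d} \<rightarrow> carrier R"
  shows "poly_act M f d v \<in> module_hom R M M"
proof -
  interpret M: module R M by fact
  note fi = module_homD[OF funpow_module_hom[OF f]]
  show ?thesis
  proof (rule module_homI)
    fix x y assume xy: "x \<in> carrier M" "y \<in> carrier M"
    have "poly_act M f d v (x \<oplus>\<^bsub>M\<^esub> y) =
      (\<Oplus>\<^bsub>M\<^esub>i\<in>{..<d}. v i \<odot>\<^bsub>M\<^esub> (f ^^ i) x \<oplus>\<^bsub>M\<^esub> v i \<odot>\<^bsub>M\<^esub> (f ^^ i) y)"
      unfolding poly_act_def using v fi xy by (intro M.finsum_cong') (auto simp: Pi_iff M.smult_r_distr)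
    also have "\<dots> = poly_act M f d v x \<oplus>\<^bsub>M\<^esub> poly_act M f d v y"
      unfolding poly_act_def using v fi xy by (intro M.finsum_addf) (auto simp: Pi_iff)
    finally show "poly_act M f d v (x \<oplus>\<^bsub>M\<^esub> y) = poly_act M f d v x \<oplus>\<^bsub>M\<^esub> poly_act M f d v y" .
  next
    fix r x assume rx: "r \<in> carrier R" "x \<in> carrier M"
    \<comment> \<open>Scalar multiplication commutes with f, hence with every polynomial in
      f.\<close>
    have "(\<lambda>x. r \<odot>\<^bsub>M\<^esub> x) \<in> module_hom R M M" by (rule module_hom_scale[OF M rx(1)])
    then show "poly_act M f d v (r \<odot>\<^bsub>M\<^esub> x) = r \<odot>\<^bsub>M\<^esub> poly_act M f d v x"
      using poly_act_intertwine[OF M M f f _ _ v rx(2), of "\<lambda>x. r \<odot>\<^bsub>M\<^esub> x"]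
        module_homD(3)[OF f rx(1)] by simp
  qed (use v fi in \<open>auto simp: poly_act_def Pi_iff intro!: M.finsum_closed\<close>)
qed

lemma poly_act_add:
  assumes M: "module R M" and f: "f \<in> module_hom R M M"
    and v: "v \<in> {..<d} \<rightarrow> carrier R" "w \<in> {..<d} \<rightarrow> carrier R" and x: "x \<in> carrier M"
    and u: "\<And>i. i < d \<Longrightarrow> u i = v i \<oplus>\<^bsub>R\<^esub> w i"
  shows "poly_act M f d u x = poly_act M f d v x \<oplus>\<^bsub>M\<^esub> poly_act M f d w x"
proof -
  interpret M: module R M by fact
  note fi = module_homD(1)[OF funpow_module_hom[OF f] x]
  have "poly_act M f d u x = (\<Oplus>\<^bsub>M\<^esub>i\<in>{..<d}. v i \<odot>\<^bsub>M\<^esub> (f ^^ i) x \<oplus>\<^bsub>M\<^esub> w i \<odot>\<^bsub>M\<^esub> (f ^^ i) x)"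
    unfolding poly_act_def using v fi by (intro M.finsum_cong') (auto simp: Pi_iff u M.smult_l_distr)
  also have "\<dots> = poly_act M f d v x \<oplus>\<^bsub>M\<^esub> poly_act M f d w x"
    unfolding poly_act_def using v fi by (intro M.finsum_addf) (auto simp: Pi_iff)
  finally show ?thesis .
qed

lemma poly_act_smult:
  assumes M: "module R M" and f: "f \<in> module_hom R M M"
    and v: "v \<in> {..<d} \<rightarrow> carrier R" and r: "r \<in> carrier R" and x: "x \<in> carrier M"
    and u: "\<And>i. i < d \<Longrightarrow> u i = r \<otimes>\<^bsub>R\<^esub> v i"
  shows "poly_act M f d u x = r \<odot>\<^bsub>M\<^esub> poly_act M f d v x"
proof -
  interpret M: module R M by fact
  note fi = module_homD(1)[OF funpow_module_hom[OF f] x]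
  note h = module_hom_scale[OF M r]
  have "poly_act M f d u x = (\<Oplus>\<^bsub>M\<^esub>i\<in>{..<d}. r \<odot>\<^bsub>M\<^esub> (v i \<odot>\<^bsub>M\<^esub> (f ^^ i) x))"
    unfolding poly_act_def using v r fi by (intro M.finsum_cong') (auto simp: Pi_iff u M.smult_assoc1)
  also have "\<dots> = r \<odot>\<^bsub>M\<^esub> poly_act M f d v x"
    unfolding poly_act_def using v fi
    by (intro module_hom_finsum[OF M M h, symmetric]) (auto simp: Pi_iff)
  finally show ?thesis .
qed

lemma poly_act_commute:
  assumes M: "module R M" and f: "f \<in> module_hom R M M"
    and v: "v \<in> {..<d} \<rightarrow> carrier R" "w \<in> {..<d'} \<rightarrow> carrier R" and x: "x \<in> carrier M"
  shows "poly_act M f d v (f x) = f (poly_act M f d v x)"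
    and "poly_act M f d v (poly_act M f d' w x) = poly_act M f d' w (poly_act M f d v x)"
proof -
  have c: "poly_act M f d v (f x) = f (poly_act M f d v x)" if "x \<in> carrier M" for x
    using poly_act_intertwine[OF M M f f f _ v(1) that] by simp
  then show "poly_act M f d v (f x) = f (poly_act M f d v x)" using x .
  show "poly_act M f d v (poly_act M f d' w x) = poly_act M f d' w (poly_act M f d v x)"
    using poly_act_intertwine[OF M M f f poly_act_module_hom[OF M f v(1)] c v(2) x] .
qed

section \<open>Free modules in coordinates\<close>

lemma free_mod_module: "cring R \<Longrightarrow> module R (free_mod R n)"
  unfolding free_mod_def by (rule cring.func_space_is_module)

lemma free_mod_simps:
  assumes "cring R"
  shows "carrier (free_mod R n) = {..<n} \<rightarrow>\<^sub>E carrier R"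
    and "\<zero>\<^bsub>free_mod R n\<^esub> = (\<lambda>i\<in>{..<n}. \<zero>\<^bsub>R\<^esub>)"
    and "v \<oplus>\<^bsub>free_mod R n\<^esub> w = (\<lambda>i\<in>{..<n}. v i \<oplus>\<^bsub>R\<^esub> w i)"
    and "r \<odot>\<^bsub>free_mod R n\<^esub> v = (\<lambda>i\<in>{..<n}. r \<otimes>\<^bsub>R\<^esub> v i)"
proof -
  interpret cring R by fact
  show "carrier (free_mod R n) = {..<n} \<rightarrow>\<^sub>E carrier R"
    "\<zero>\<^bsub>free_mod R n\<^esub> = (\<lambda>i\<in>{..<n}. \<zero>\<^bsub>R\<^esub>)"
    "v \<oplus>\<^bsub>free_mod R n\<^esub> w = (\<lambda>i\<in>{..<n}. v i \<oplus>\<^bsub>R\<^esub> w i)"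
    "r \<odot>\<^bsub>free_mod R n\<^esub> v = (\<lambda>i\<in>{..<n}. r \<otimes>\<^bsub>R\<^esub> v i)"
    by (simp_all add: free_mod_def func_space_def)
qed

definition free_unit :: "('a, 'r) ring_scheme \<Rightarrow> nat \<Rightarrow> nat \<Rightarrow> nat \<Rightarrow> 'a" where
  "free_unit R n k = (\<lambda>i\<in>{..<n}. if i = k then \<one>\<^bsub>R\<^esub> else \<zero>\<^bsub>R\<^esub>)"

lemma free_unit_carrier:
  assumes "cring R"
  shows "free_unit R n k \<in> carrier (free_mod R n)"
proof -
  interpret cring R by fact
  show ?thesis by (auto simp: free_unit_def free_mod_simps[OF assms])
qed

lemma free_mod_expand:
  fixes R (structure)
  assumes R: "cring R" and v: "v \<in> carrier (free_mod R n)"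
  shows "(\<Oplus>\<^bsub>free_mod R n\<^esub>i\<in>{..<n}. v i \<odot>\<^bsub>free_mod R n\<^esub> free_unit R n i) = v"
proof -
  interpret cring R by fact
  interpret F: module R "free_mod R n" by (rule free_mod_module[OF R])
  note F_simps = free_mod_simps[OF R, of n]
  note uc = free_unit_carrier[OF R, of n]
  have vc: "v i \<in> carrier R" if "i < n" for i using v that by (auto simp: F_simps)
  let ?s = "\<lambda>m. \<Oplus>\<^bsub>free_mod R n\<^esub>i\<in>{..<m}. v i \<odot>\<^bsub>free_mod R n\<^esub> free_unit R n i"
  have sc: "?s m \<in> carrier (free_mod R n)" if "m \<le> n" for m
    using that vc uc by (intro F.finsum_closed) auto
  have "?s m j = (if j < m then v j else \<zero>)" if "m \<le> n" "j < n" for m j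
    using that
  proof (induction m)
    case (Suc m)
    have "(\<lambda>i. v i \<odot>\<^bsub>free_mod R n\<^esub> free_unit R n i) \<in> {..<Suc m} \<rightarrow> carrier (free_mod R n)"
      using Suc.prems vc uc by auto
    from F.finsum_lessThan_Suc[OF this]
    have "?s (Suc m) j = v m \<otimes> free_unit R n m j \<oplus> ?s m j"
      using Suc.prems by (simp add: F_simps)
    moreover have "?s m j = (if j < m then v j else \<zero>)" using Suc by simp
    moreover have "free_unit R n m j = (if j = m then \<one> else \<zero>)" using Suc.prems by (simp add: free_unit_def)
    ultimately show ?case using Suc.prems vc by (auto simp: less_Suc_eq)
  qed (simp add: F_simps)
  from this[of n] have "?s n j = v j" if "j < n" for j using that by simp
  then show ?thesis
    using sc[of n] v unfolding F_simps(1) by (intro PiE_ext) auto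
qed

text \<open>The data of a monic relation X^d = sum of c_i X^i over i < d. Positivity of d gives the
  vectors a coordinate 0, which carries the unit, and a top coordinate d - 1.\<close>

locale monic_relation = cring R for R (structure) +
  fixes d :: nat and c :: "nat \<Rightarrow> 'a"
  assumes d: "0 < d" and c: "c i \<in> carrier R"
begin

text \<open>A vector \<open>v\<close> stands for the class of \<open>\<Sum> v\<^sub>i X\<^sup>i\<close> in
  \<open>R[X] / (X\<^sup>d - \<Sum> c\<^sub>i X\<^sup>i)\<close>, and \<open>companion\<close> is multiplication by \<open>X\<close>.\<close>

definition companion :: "(nat \<Rightarrow> 'a) \<Rightarrow> nat \<Rightarrow> 'a" where
  "companion v = (\<lambda>i\<in>{..<d}. (if i = 0 then \<zero> else v (i - 1)) \<oplus> v (d - 1) \<otimes> c i)"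

abbreviation "unit_vec \<equiv> free_unit R d"

text \<open>The product of v and w is the polynomial v in \<open>companion\<close>, applied to w.
  This realises R[X]/(p) directly on coordinate vectors, with no quotient to form, so that its
  elements have visible coordinates in R.\<close>

definition adjoin_root :: "(nat \<Rightarrow> 'a) ring" where
  "adjoin_root = \<lparr>carrier = carrier (free_mod R d), mult = poly_act (free_mod R d) companion d,
    one = unit_vec 0, zero = \<zero>\<^bsub>free_mod R d\<^esub>, add = add (free_mod R d)\<rparr>"

abbreviation "F \<equiv> free_mod R d"

abbreviation "A \<equiv> adjoin_root"

sublocale F: module R F by (rule free_mod_module) (rule is_cring)

lemmas F_simps = free_mod_simps[OF is_cring, of d]

lemma F_app: "v \<in> carrier F \<Longrightarrow> i < d \<Longrightarrow> v i \<in> carrier R"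
  by (auto simp: F_simps)

lemma F_Pi: "v \<in> carrier F \<Longrightarrow> v \<in> {..<d} \<rightarrow> carrier R"
  by (auto simp: F_simps)

lemma F_eqI: "\<lbrakk>v \<in> carrier F; w \<in> carrier F; \<And>i. i < d \<Longrightarrow> v i = w i\<rbrakk> \<Longrightarrow> v = w"
  unfolding F_simps by (rule PiE_ext) auto

lemma companion_hom: "companion \<in> module_hom R F F"
proof (rule module_homI)
  have d1: "d - 1 < d" using d by simp
  fix v assume v: "v \<in> carrier F"
  show "companion v \<in> carrier F"
    using F_app[OF v] F_app[OF v d1] c by (auto simp: companion_def F_simps)
  { fix w assume w: "w \<in> carrier F"
    show "companion (v \<oplus>\<^bsub>F\<^esub> w) = companion v \<oplus>\<^bsub>F\<^esub> companion w"
      unfolding companion_def F_simps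
      using F_app[OF v] F_app[OF w] F_app[OF v d1] F_app[OF w d1] c d1
      by (intro restrict_ext) (auto simp: l_distr a_ac) }
  fix r assume r: "r \<in> carrier R"
  show "companion (r \<odot>\<^bsub>F\<^esub> v) = r \<odot>\<^bsub>F\<^esub> companion v"
    unfolding companion_def F_simps
    using F_app[OF v] F_app[OF v d1] c d1 r
    by (intro restrict_ext) (auto simp: r_distr m_assoc)
qed

lemmas unit_vec_carrier [simp] = free_unit_carrier[OF is_cring, of d]

text \<open>Below exponent d the powers of X are basis vectors; the relation first enters at
  exponent d.\<close>

lemma companion_pow_unit_vec: "k < d \<Longrightarrow> (companion ^^ k) (unit_vec 0) = unit_vec k"
proof (induction k)
  case (Suc k)
  then show ?case
    using c by (auto simp: companion_def free_unit_def restrict_def fun_eq_iff)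
qed simp

text \<open>Every element is recovered from its action on 1. Identities between polynomials in
  \<open>companion\<close> therefore need to be compared only at \<open>unit_vec 0\<close>.\<close>

lemma poly_act_unit_vec:
  assumes v: "v \<in> carrier F"
  shows "poly_act F companion d v (unit_vec 0) = v"
proof -
  have "poly_act F companion d v (unit_vec 0) = (\<Oplus>\<^bsub>F\<^esub>i\<in>{..<d}. v i \<odot>\<^bsub>F\<^esub> unit_vec i)"
    unfolding poly_act_def using F_app[OF v]
    by (intro F.finsum_cong') (auto simp: companion_pow_unit_vec)
  then show ?thesis by (simp add: free_mod_expand[OF is_cring v])
qed

text \<open>The relation makes \<open>v \<mapsto> \<Sum> v\<^sub>i f\<^sup>i x\<close> intertwine \<open>companion\<close> with \<open>f\<close>.  Applied to
  the companion map itself, this yields the ring laws of \<open>adjoin_root\<close>; applied to a module, it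
  yields the action of that ring.\<close>

lemma poly_act_companion:
  assumes M: "module R M" and f: "f \<in> module_hom R M M"
    and rel: "\<And>x. x \<in> carrier M \<Longrightarrow> (f ^^ d) x = poly_act M f d c x"
    and v: "v \<in> carrier F" and x: "x \<in> carrier M"
  shows "poly_act M f d (companion v) x = f (poly_act M f d v x)"
proof -
  interpret M: module R M by fact
  note fi = module_homD(1)[OF funpow_module_hom[OF f] x]
  obtain k where k: "d = Suc k" using d by (cases d) auto
  then have dk: "d - Suc 0 = k" "k < d" by auto
  note vd = F_app[OF v]
  note va = vd[unfolded k]
  \<comment> \<open>The shift of v; \<open>companion v\<close> is this shift plus the top coordinate
    of v times c.\<close>
  define a where "a i = (if i = 0 then \<zero> else v (i - 1))" for i
  have ac: "a i \<in> carrier R" if "i < Suc k" for i using va that by (auto simp: a_def)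
  have "poly_act M f d (companion v) x = poly_act M f d a x \<oplus>\<^bsub>M\<^esub> poly_act M f d (\<lambda>i. v k \<otimes> c i) x"
    using ac[folded k] vd dk c by (intro poly_act_add[OF M f _ _ x]) (auto simp: a_def companion_def)
  also have "poly_act M f d (\<lambda>i. v k \<otimes> c i) x = v k \<odot>\<^bsub>M\<^esub> poly_act M f d c x"
    using c vd dk by (intro poly_act_smult[OF M f _ _ x]) auto
  \<comment> \<open>The relation enters here: the overflow term becomes v_(d-1) f^d x, the missing
    top term of the shifted sum.\<close>
  also have "\<dots> = v k \<odot>\<^bsub>M\<^esub> (f ^^ Suc k) x" using rel[OF x] k by simp
  also have "poly_act M f d a x = (\<Oplus>\<^bsub>M\<^esub>i\<in>{..<k}. v i \<odot>\<^bsub>M\<^esub> (f ^^ Suc i) x)"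
  proof -
    have "poly_act M f d a x = a 0 \<odot>\<^bsub>M\<^esub> (f ^^ 0) x \<oplus>\<^bsub>M\<^esub> (\<Oplus>\<^bsub>M\<^esub>i\<in>{..<k}. a (Suc i) \<odot>\<^bsub>M\<^esub> (f ^^ Suc i) x)"
      unfolding poly_act_def k using ac fi by (intro M.finsum_lessThan_Suc2) auto
    moreover have "(\<Oplus>\<^bsub>M\<^esub>i\<in>{..<k}. v i \<odot>\<^bsub>M\<^esub> (f ^^ Suc i) x) \<in> carrier M"
      using va fi[of "Suc _"] by (intro M.finsum_closed) auto
    ultimately show ?thesis using x by (simp add: a_def)
  qed
  also have "(\<Oplus>\<^bsub>M\<^esub>i\<in>{..<k}. v i \<odot>\<^bsub>M\<^esub> (f ^^ Suc i) x) \<oplus>\<^bsub>M\<^esub> v k \<odot>\<^bsub>M\<^esub> (f ^^ Suc k) x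
    = (\<Oplus>\<^bsub>M\<^esub>i\<in>{..<Suc k}. v i \<odot>\<^bsub>M\<^esub> (f ^^ Suc i) x)"
    using va fi[of "Suc _"] fi[of "Suc k"]
    by (subst M.finsum_lessThan_Suc) (auto intro!: M.a_comm M.finsum_closed)
  also have "\<dots> = poly_act M f d v (f x)"
    unfolding poly_act_def k using va fi[of "Suc _"]
    by (intro M.finsum_cong') (auto simp: funpow_swap1)
  also have "\<dots> = f (poly_act M f d v x)"
    by (rule poly_act_commute(1)[OF M f F_Pi[OF v] F_Pi[OF v] x])
  finally show ?thesis .
qed

text \<open>For fixed x the evaluation \<open>?h\<close> is linear and turns
  \<open>companion\<close> into f; hence it turns the polynomial v in \<open>companion\<close> into
  the polynomial v in f.\<close>

lemma poly_act_mult: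
  assumes M: "module R M" and f: "f \<in> module_hom R M M"
    and rel: "\<And>x. x \<in> carrier M \<Longrightarrow> (f ^^ d) x = poly_act M f d c x"
    and v: "v \<in> carrier F" "w \<in> carrier F" and x: "x \<in> carrier M"
  shows "poly_act M f d (poly_act F companion d v w) x = poly_act M f d v (poly_act M f d w x)"
proof -
  interpret M: module R M by fact
  let ?h = "\<lambda>v. poly_act M f d v x"
  have "?h \<in> module_hom R F M"
  proof (rule module_homI)
    fix v assume v: "v \<in> carrier F"
    show "?h v \<in> carrier M" using module_homD(1)[OF poly_act_module_hom[OF M f F_Pi[OF v]] x] .
    show "?h (v \<oplus>\<^bsub>F\<^esub> w) = ?h v \<oplus>\<^bsub>M\<^esub> ?h w" if "w \<in> carrier F" for w
      by (rule poly_act_add[OF M f F_Pi[OF v] F_Pi[OF that] x]) (simp add: F_simps)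
    show "?h (r \<odot>\<^bsub>F\<^esub> v) = r \<odot>\<^bsub>M\<^esub> ?h v" if "r \<in> carrier R" for r
      by (rule poly_act_smult[OF M f F_Pi[OF v] that x]) (simp add: F_simps)
  qed
  from poly_act_intertwine[OF F.module_axioms M companion_hom f this
      poly_act_companion[OF M f rel _ x] F_Pi[OF v(1)] v(2)]
  show ?thesis by simp
qed

text \<open>At the vector 1 this is the definition of \<open>companion\<close>. It spreads to all x
  because x is a polynomial in \<open>companion\<close> applied to 1, and such polynomials
  commute.\<close>

lemma companion_relation:
  assumes x: "x \<in> carrier F"
  shows "(companion ^^ d) x = poly_act F companion d c x"
proof -
  note M = F.module_axioms
  \<comment> \<open>Elements of F are extensional, so c must be cut off at d before it counts as one
    of them.\<close>
  define c' where "c' = restrict c {..<d}"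
  have c': "c' \<in> carrier F" using c by (auto simp: c'_def F_simps)
  have cc: "poly_act F companion d c y = poly_act F companion d c' y" if y: "y \<in> carrier F" for y
    unfolding poly_act_def
    using c module_homD(1)[OF funpow_module_hom[OF companion_hom] y]
    by (intro F.finsum_cong') (auto simp: c'_def)
  have x0: "(companion ^^ d) (unit_vec 0) = c'"
  proof -
    obtain k where k: "d = Suc k" using d by (cases d) auto
    have "(companion ^^ d) (unit_vec 0) = companion (unit_vec k)"
      using companion_pow_unit_vec[of k] by (simp add: k)
    also have "\<dots> = c'" unfolding companion_def free_unit_def c'_def
      using c k by (auto simp: fun_eq_iff restrict_def)
    finally show ?thesis .
  qed
  have pw: "poly_act F companion d x ((companion ^^ n) y) = (companion ^^ n) (poly_act F companion d x y)"
    if y: "y \<in> carrier F" for n y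
  proof (induction n)
    case (Suc n)
    then show ?case
      using poly_act_commute(1)[OF M companion_hom F_Pi[OF x] F_Pi[OF x], of "(companion ^^ n) y"]
        module_homD(1)[OF funpow_module_hom[OF companion_hom] y] by simp
  qed simp
  have "(companion ^^ d) x = (companion ^^ d) (poly_act F companion d x (unit_vec 0))"
    by (simp add: poly_act_unit_vec[OF x])
  also have "\<dots> = poly_act F companion d x (poly_act F companion d c' (unit_vec 0))"
    by (simp add: pw[symmetric] x0 poly_act_unit_vec[OF c'])
  also have "\<dots> = poly_act F companion d c' (poly_act F companion d x (unit_vec 0))"
    by (rule poly_act_commute(2)[OF M companion_hom F_Pi[OF x] F_Pi[OF c']]) simp
  finally show ?thesis using cc[OF x] by (simp add: poly_act_unit_vec[OF x])
qed

lemma adjoin_root_simps: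
  "carrier A = carrier F" "\<one>\<^bsub>A\<^esub> = unit_vec 0" "\<zero>\<^bsub>A\<^esub> = \<zero>\<^bsub>F\<^esub>"
  "v \<oplus>\<^bsub>A\<^esub> w = v \<oplus>\<^bsub>F\<^esub> w" "v \<otimes>\<^bsub>A\<^esub> w = poly_act F companion d v w"
  by (simp_all add: adjoin_root_def)

text \<open>Both products arise by applying to 1 two polynomials in the same endomorphism, in either
  order.\<close>

lemma adjoin_root_mult_comm:
  assumes "v \<in> carrier F" "w \<in> carrier F"
  shows "poly_act F companion d v w = poly_act F companion d w v"
  using poly_act_commute(2)[OF F.module_axioms companion_hom F_Pi[OF assms(1)] F_Pi[OF assms(2)],
      of "unit_vec 0"]
  by (simp add: poly_act_unit_vec assms)

text \<open>Associativity is the product rule \<open>poly_act_mult\<close> for the module F itself,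
  where \<open>companion_relation\<close> supplies the required relation.\<close>

lemma adjoin_root_cring: "cring A"
proof (rule cringI)
  note cl = module_homD[OF poly_act_module_hom[OF F.module_axioms companion_hom F_Pi]]
  show "abelian_group A"
  proof (rule abelian_groupI)
    fix x assume x: "x \<in> carrier A"
    show "\<exists>y\<in>carrier A. y \<oplus>\<^bsub>A\<^esub> x = \<zero>\<^bsub>A\<^esub>"
      using x by (intro bexI[of _ "\<ominus>\<^bsub>F\<^esub> x"]) (auto simp: adjoin_root_simps F.l_neg)
  qed (auto simp: adjoin_root_simps F.a_ac)
  show "Group.comm_monoid A"
  proof (rule comm_monoidI)
    fix x y z assume xyz: "x \<in> carrier A" "y \<in> carrier A" "z \<in> carrier A"
    then show "x \<otimes>\<^bsub>A\<^esub> y \<otimes>\<^bsub>A\<^esub> z = x \<otimes>\<^bsub>A\<^esub> (y \<otimes>\<^bsub>A\<^esub> z)"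
      using poly_act_mult[OF F.module_axioms companion_hom companion_relation]
      by (simp add: adjoin_root_simps)
  next
    fix x assume "x \<in> carrier A"
    then show "\<one>\<^bsub>A\<^esub> \<otimes>\<^bsub>A\<^esub> x = x"
      by (simp add: adjoin_root_simps adjoin_root_mult_comm[of "unit_vec 0"] poly_act_unit_vec)
  qed (auto simp: adjoin_root_simps cl adjoin_root_mult_comm)
  fix x y z assume xyz: "x \<in> carrier A" "y \<in> carrier A" "z \<in> carrier A"
  then show "(x \<oplus>\<^bsub>A\<^esub> y) \<otimes>\<^bsub>A\<^esub> z = x \<otimes>\<^bsub>A\<^esub> z \<oplus>\<^bsub>A\<^esub> y \<otimes>\<^bsub>A\<^esub> z"
    using cl(2)[of z x y] by (simp add: adjoin_root_simps adjoin_root_mult_comm[of _ z])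
qed

end

lemma (in abelian_monoid) finsum_mem:
  assumes "finite A" "\<And>i. i \<in> A \<Longrightarrow> u i \<in> H" "H \<subseteq> carrier G" "\<zero> \<in> H"
    "\<And>a b. \<lbrakk>a \<in> H; b \<in> H\<rbrakk> \<Longrightarrow> a \<oplus> b \<in> H"
  shows "(\<Oplus>i\<in>A. u i) \<in> H"
  using assms(1,2)
proof (induction A rule: finite_induct)
  case (insert a A)
  then have "u \<in> A \<rightarrow> carrier G" "u a \<in> carrier G" using assms(3) by auto
  then show ?case using insert assms(5) by (simp add: finsum_insert)
qed (simp add: assms(4))

section \<open>The filtration of R by the powers of its maximal ideal\<close>

context complete_noetherian_local_ring
begin

abbreviation "\<mm>pow \<equiv> ideal_power R \<mm>"

lemma \<mm>_ideal: "ideal \<mm> R"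
  using maximal by (rule maximalideal.axioms)

lemma \<mm>pow_ideal: "ideal (\<mm>pow n) R"
  by (induction n) (auto intro: ideal_prod_is_ideal oneideal \<mm>_ideal)

lemma \<mm>pow_antimono: "\<mm>pow (Suc n) \<subseteq> \<mm>pow n"
  using ideal_prod_inter[OF \<mm>_ideal \<mm>pow_ideal[of n]] by simp

lemma \<mm>pow_mult: "\<lbrakk>a \<in> \<mm>pow i; b \<in> \<mm>pow j\<rbrakk> \<Longrightarrow> a \<otimes> b \<in> \<mm>pow (i + j)"
proof (induction i arbitrary: a)
  case 0
  then show ?case using ideal.I_l_closed[OF \<mm>pow_ideal[of j]] by simp
next
  case (Suc i)
  have b: "b \<in> carrier R" using Suc.prems(2) ideal.Icarr[OF \<mm>pow_ideal] by blast
  have "a \<in> ideal_prod R \<mm> (\<mm>pow i)" using Suc.prems by simp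
  then show ?case
  proof (induction rule: ideal_prod.induct)
    case (prod m p)
    have "m \<in> carrier R" "p \<in> carrier R"
      using prod ideal.Icarr[OF \<mm>pow_ideal] ideal.Icarr[OF \<mm>_ideal] by blast+
    then have "m \<otimes> p \<otimes> b = m \<otimes> (p \<otimes> b)" using b by (simp add: m_assoc)
    then show ?case using Suc.IH[OF prod(2) Suc.prems(2)] prod(1) by (simp add: ideal_prod.prod)
  next
    case (sum s t)
    have "s \<in> carrier R" "t \<in> carrier R"
      using sum ideal.Icarr[OF \<mm>pow_ideal[of "Suc i"]] by auto
    then have "(s \<oplus> t) \<otimes> b = s \<otimes> b \<oplus> t \<otimes> b" using b by (simp add: l_distr)
    then show ?case using sum by (simp add: ideal_prod.sum)
  qed
qed

lemma \<mm>pow_1: "\<mm>pow 1 = \<mm>"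
proof
  show "\<mm>pow 1 \<subseteq> \<mm>" using ideal_prod_inter[OF \<mm>_ideal oneideal] by simp
  show "\<mm> \<subseteq> \<mm>pow 1"
  proof
    fix a assume a: "a \<in> \<mm>"
    then have "a \<otimes> \<one> \<in> ideal_prod R \<mm> (carrier R)" by (intro ideal_prod.prod) auto
    then show "a \<in> \<mm>pow 1" using a ideal.Icarr[OF \<mm>_ideal] by simp
  qed
qed

text \<open>The base ring as first instance of the abstract setting: it provides units of the form 1
  - t, and the limits in the coordinates of \<open>adjoin_root\<close>.\<close>

lemma complete_filtered: "complete_filtered_cring R \<mm>pow"
proof (intro complete_filtered_cring.intro complete_filtered_cring_axioms.intro)
  show "cring R" by (rule is_cring)
next
  show "ideal (\<mm>pow n) R" for n by (rule \<mm>pow_ideal)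
next
  show "\<mm>pow 0 = carrier R" by simp
next
  show "\<mm>pow (Suc n) \<subseteq> \<mm>pow n" for n by (rule \<mm>pow_antimono)
next
  show "a \<otimes> b \<in> \<mm>pow (i + j)" if "a \<in> \<mm>pow i" "b \<in> \<mm>pow j" for a b i j
    using that by (rule \<mm>pow_mult)
next
  show "\<exists>a\<in>carrier R. \<forall>n. a \<ominus> x n \<in> \<mm>pow n"
    if "\<And>n. x n \<in> carrier R" "\<And>n. x (Suc n) \<ominus> x n \<in> \<mm>pow n" for x
    using complete[OF that] by blast
next
  fix a assume a: "a \<in> carrier R" "\<And>n. a \<in> \<mm>pow n"
  have z: "\<zero> \<in> \<mm>pow n" for n
    using additive_subgroup.zero_closed[OF ideal.axioms(1)[OF \<mm>pow_ideal]] .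
  \<comment> \<open>Separatedness is the uniqueness half of completeness for the constant sequence
    0: both 0 and a are limits of it.\<close>
  have "\<exists>!b. b \<in> carrier R \<and> (\<forall>n. b \<ominus> (\<lambda>_. \<zero>) n \<in> \<mm>pow n)"
    by (rule complete) (simp_all add: z a_minus_def)
  moreover have "\<zero> \<ominus> \<zero> \<in> \<mm>pow n" "a \<ominus> \<zero> \<in> \<mm>pow n" for n using a z by (simp_all add: a_minus_def)
  ultimately show "a = \<zero>" using a(1) zero_closed by blast
qed

text \<open>By maximality 1 = t + a u with t in the maximal ideal; then a u = 1 - t is invertible by
  the geometric series.\<close>

lemma left_inverse_if_notin_\<mm>:
  assumes u: "u \<in> carrier R" "u \<notin> \<mm>"
  shows "\<exists>v \<in> carrier R. v \<otimes> u = \<one>"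
proof -
  interpret filt: complete_filtered_cring R \<mm>pow by (rule complete_filtered)
  let ?J = "\<mm> <+>\<^bsub>R\<^esub> PIdl u"
  have J: "ideal ?J R" by (intro add_ideals \<mm>_ideal cgenideal_ideal u)
  have z: "\<zero> \<in> \<mm>" "\<zero> \<in> PIdl u"
    using additive_subgroup.zero_closed[OF ideal.axioms(1)] \<mm>_ideal cgenideal_ideal[OF u(1)] by blast+
  have "\<mm> \<subseteq> ?J"
  proof
    fix a assume "a \<in> \<mm>"
    moreover have "a = a \<oplus> \<zero>" using calculation ideal.Icarr[OF \<mm>_ideal] by simp
    ultimately show "a \<in> ?J" using z unfolding set_add_def' by blast
  qed
  moreover have "u \<in> ?J"
  proof -
    have "u = \<zero> \<oplus> u" using u by simp
    then show ?thesis using z cgenideal_self[OF u(1)] unfolding set_add_def' by blast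
  qed
  ultimately have "?J = carrier R"
    using maximalideal.I_maximal[OF maximal J] u(2) ideal.Icarr[OF J] by blast
  then have "\<one> \<in> ?J" by simp
  then obtain t a where t: "t \<in> \<mm>" "a \<in> carrier R" "\<one> = t \<oplus> a \<otimes> u"
    unfolding set_add_def' cgenideal_def by blast
  have tc: "t \<in> carrier R" using t(1) ideal.Icarr[OF \<mm>_ideal] by blast
  obtain w where w: "w \<in> carrier R" "w \<otimes> (\<one> \<ominus> t) = \<one>"
    using filt.one_minus_unit t(1) \<mm>pow_1 by metis
  have "\<one> \<ominus> t = (t \<oplus> a \<otimes> u) \<ominus> t" using t(3) by simp
  also have "\<dots> = a \<otimes> u" using tc t(2) u(1) by algebra
  finally have "(w \<otimes> a) \<otimes> u = \<one>" using w t(2) u(1) by (simp add: m_assoc)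
  then show ?thesis using w t(2) by blast
qed

end

section \<open>Completeness of the adjoined ring, and the powers of its root\<close>

locale complete_monic_relation = complete_noetherian_local_ring R \<mm> + monic_relation R d c
  for R (structure) and \<mm> d c
begin

text \<open>The filtration of F by the submodules generated by the powers of the maximal ideal,
  written in coordinates so that convergence can be checked in each coordinate.\<close>

definition adic :: "nat \<Rightarrow> (nat \<Rightarrow> 'a) set" where
  "adic n = {v \<in> carrier F. \<forall>i<d. v i \<in> \<mm>pow n}"

sublocale A: cring A by (rule adjoin_root_cring)

lemma adjoin_root_minus: "v \<ominus>\<^bsub>A\<^esub> w = v \<ominus>\<^bsub>F\<^esub> w"
  by (simp add: a_minus_def a_inv_def m_inv_def adjoin_root_def)

lemma F_minus_app:
  assumes "v \<in> carrier F" "w \<in> carrier F" "i < d"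
  shows "(v \<ominus>\<^bsub>F\<^esub> w) i = v i \<ominus> w i"
proof -
  have "(v \<ominus>\<^bsub>F\<^esub> w) \<oplus>\<^bsub>F\<^esub> w = v" using assms by (simp add: a_minus_def F.a_assoc F.l_neg)
  then have "((v \<ominus>\<^bsub>F\<^esub> w) \<oplus>\<^bsub>F\<^esub> w) i = v i" by simp
  then have "(v \<ominus>\<^bsub>F\<^esub> w) i \<oplus> w i = v i" using assms(3) by (simp add: F_simps(3))
  moreover have "(v \<ominus>\<^bsub>F\<^esub> w) i \<in> carrier R" "w i \<in> carrier R" using assms by (auto intro!: F_app)
  then have "((v \<ominus>\<^bsub>F\<^esub> w) i \<oplus> w i) \<ominus> w i = (v \<ominus>\<^bsub>F\<^esub> w) i" by algebra
  ultimately show ?thesis by simp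
qed

lemma adic_closed:
  shows "adic n \<subseteq> carrier F" and "\<zero>\<^bsub>F\<^esub> \<in> adic n"
    and "\<lbrakk>v \<in> adic n; w \<in> adic n\<rbrakk> \<Longrightarrow> v \<oplus>\<^bsub>F\<^esub> w \<in> adic n"
    and "\<lbrakk>v \<in> adic n; w \<in> adic n\<rbrakk> \<Longrightarrow> v \<ominus>\<^bsub>F\<^esub> w \<in> adic n"
    and "\<lbrakk>r \<in> \<mm>pow i; v \<in> adic j\<rbrakk> \<Longrightarrow> r \<odot>\<^bsub>F\<^esub> v \<in> adic (i + j)"
    and "v \<in> adic n \<Longrightarrow> companion v \<in> adic n"
proof -
  interpret filt: complete_filtered_cring R \<mm>pow by (rule complete_filtered)
  have z: "\<zero> \<in> \<mm>pow n" for n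
    using additive_subgroup.zero_closed[OF ideal.axioms(1)[OF \<mm>pow_ideal]] .
  show sub: "adic n \<subseteq> carrier F" for n by (auto simp: adic_def)
  show "\<zero>\<^bsub>F\<^esub> \<in> adic n" using z F.zero_closed by (auto simp: adic_def F_simps(2))
  show "v \<oplus>\<^bsub>F\<^esub> w \<in> adic n" if vw: "v \<in> adic n" "w \<in> adic n"
    using vw F.a_closed[of v w] by (auto simp: adic_def F_simps(3) filt.I_add)
  show "v \<ominus>\<^bsub>F\<^esub> w \<in> adic n" if vw: "v \<in> adic n" "w \<in> adic n"
    using vw F.minus_closed[of v w] by (auto simp: adic_def F_minus_app filt.I_diff)
  show "r \<odot>\<^bsub>F\<^esub> v \<in> adic (i + j)" if "r \<in> \<mm>pow i" "v \<in> adic j"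
    using that F.smult_closed[of r v] filt.I_carrier[of r i] by (auto simp: adic_def F_simps(4) \<mm>pow_mult)
  show "companion v \<in> adic n" if v: "v \<in> adic n"
  proof -
    have "companion v i \<in> \<mm>pow n" if i: "i < d" for i
    proof -
      have "(if i = 0 then \<zero> else v (i - 1)) \<in> \<mm>pow n" using v i z by (auto simp: adic_def)
      moreover have "v (d - 1) \<otimes> c i \<in> \<mm>pow n" using v d c by (intro filt.I_rmult) (auto simp: adic_def)
      ultimately show ?thesis using i filt.I_add by (simp add: companion_def)
    qed
    then show ?thesis using module_homD(1)[OF companion_hom] v by (auto simp: adic_def)
  qed
qed

lemma adic_0: "adic 0 = carrier F"
  using F_app by (auto simp: adic_def)

text \<open>The product is the sum of v_k X^k w: multiplication by X preserves
  \<open>adic j\<close>, and each coefficient v_k adds i to the order.\<close>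

lemma adic_mult: "\<lbrakk>v \<in> adic i; w \<in> adic j\<rbrakk> \<Longrightarrow> poly_act F companion d v w \<in> adic (i + j)"
proof -
  assume v: "v \<in> adic i" and w: "w \<in> adic j"
  have "(companion ^^ k) w \<in> adic j" for k by (induction k) (auto simp: w adic_closed(6))
  then show ?thesis
    unfolding poly_act_def using v by (intro F.finsum_mem adic_closed) (auto simp: adic_def)
qed

lemma adic_ideal: "ideal (adic n) A"
proof (rule idealI)
  show "ring A" by (rule A.ring_axioms)
  show "subgroup (adic n) (add_monoid A)"
  proof (rule A.add.subgroupI)
    fix v assume v: "v \<in> adic n"
    have "v \<in> carrier A" using v adic_closed(1) unfolding adjoin_root_simps(1) ..
    then have "\<ominus>\<^bsub>A\<^esub> v = \<zero>\<^bsub>A\<^esub> \<ominus>\<^bsub>A\<^esub> v" by (simp add: A.minus_eq)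
    also have "\<dots> = \<zero>\<^bsub>F\<^esub> \<ominus>\<^bsub>F\<^esub> v" by (simp only: adjoin_root_minus adjoin_root_simps(3))
    finally have "\<ominus>\<^bsub>A\<^esub> v = \<zero>\<^bsub>F\<^esub> \<ominus>\<^bsub>F\<^esub> v" .
    then show "\<ominus>\<^bsub>A\<^esub> v \<in> adic n" using v adic_closed(2,4) by simp
  next
    fix v w assume "v \<in> adic n" "w \<in> adic n"
    then show "v \<oplus>\<^bsub>A\<^esub> w \<in> adic n" by (simp add: adjoin_root_simps adic_closed(3))
  qed (use adic_closed(1,2) in \<open>auto simp: adjoin_root_simps\<close>)
  fix v w assume "v \<in> adic n" "w \<in> carrier A"
  then show "w \<otimes>\<^bsub>A\<^esub> v \<in> adic n" "v \<otimes>\<^bsub>A\<^esub> w \<in> adic n"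
    using adic_mult[of v n w 0] adic_mult[of w 0 v n] by (simp_all add: adjoin_root_simps adic_0)
qed

text \<open>A limit is assembled from limits in R of the d coordinate sequences; separatedness is
  inherited in the same way.\<close>

lemma adjoin_root_complete_filtered: "complete_filtered_cring A adic"
proof -
  interpret filt: complete_filtered_cring R \<mm>pow by (rule complete_filtered)
  show ?thesis
  proof (intro complete_filtered_cring.intro complete_filtered_cring_axioms.intro)
    show "cring A" by (rule A.is_cring)
  next
    show "ideal (adic n) A" for n by (rule adic_ideal)
  next
    show "adic 0 = carrier A" by (simp add: adic_0 adjoin_root_simps)
  next
    show "adic (Suc n) \<subseteq> adic n" for n using \<mm>pow_antimono[of n] by (auto simp: adic_def)
  next
    show "a \<otimes>\<^bsub>A\<^esub> b \<in> adic (i + j)" if "a \<in> adic i" "b \<in> adic j" for a b i j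
      using adic_mult[OF that] by (simp add: adjoin_root_simps)
  next
    fix x assume x: "\<And>n. x n \<in> carrier A"
      and dx: "\<And>n. x (Suc n) \<ominus>\<^bsub>A\<^esub> x n \<in> adic n"
    have xF: "x n \<in> carrier F" for n using x by (simp add: adjoin_root_simps)
    have "\<exists>b\<in>carrier R. \<forall>n. b \<ominus> x n i \<in> \<mm>pow n" if i: "i < d" for i
    proof (rule filt.I_complete)
      show "x n i \<in> carrier R" for n using F_app[OF xF i] .
      show "x (Suc n) i \<ominus> x n i \<in> \<mm>pow n" for n
      proof -
        have "(x (Suc n) \<ominus>\<^bsub>F\<^esub> x n) i \<in> \<mm>pow n"
          using dx[of n] i by (simp add: adjoin_root_minus adic_def)
        then show ?thesis using F_minus_app[OF xF xF i, of "Suc n" n] by simp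
      qed
    qed
    then obtain b where b: "\<And>i. i < d \<Longrightarrow> b i \<in> carrier R" "\<And>i n. i < d \<Longrightarrow> b i \<ominus> x n i \<in> \<mm>pow n"
      by metis
    have bF: "restrict b {..<d} \<in> carrier F" using b by (auto simp: F_simps)
    have "restrict b {..<d} \<ominus>\<^bsub>A\<^esub> x n \<in> adic n" for n
      using b(2) bF xF by (auto simp: adjoin_root_minus adic_def F_minus_app)
    then show "\<exists>a\<in>carrier A. \<forall>n. a \<ominus>\<^bsub>A\<^esub> x n \<in> adic n"
      using bF by (auto simp: adjoin_root_simps)
  next
    fix a assume a: "a \<in> carrier A" "\<And>n. a \<in> adic n"
    then show "a = \<zero>\<^bsub>A\<^esub>"
      using F_app filt.I_separated F.zero_closed
      by (intro F_eqI) (auto simp: adjoin_root_simps adic_def F_simps(2))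
  qed
qed

definition root :: "nat \<Rightarrow> 'a" where
  "root = companion (unit_vec 0)"

lemma root_carrier: "root \<in> carrier A"
  using module_homD(1)[OF companion_hom] by (simp add: root_def adjoin_root_simps)

lemma root_mult:
  assumes "v \<in> carrier F"
  shows "root \<otimes>\<^bsub>A\<^esub> v = companion v"
  using poly_act_companion[OF F.module_axioms companion_hom companion_relation _ assms, of "unit_vec 0"]
    A.l_one[of v] assms by (simp add: root_def adjoin_root_simps)

lemma root_pow: "root [^]\<^bsub>A\<^esub> (n::nat) = (companion ^^ n) (unit_vec 0)"
proof (induction n)
  case (Suc n)
  have "root [^]\<^bsub>A\<^esub> n \<in> carrier A" using root_carrier by simp
  then show ?case
    using Suc root_mult[of "root [^]\<^bsub>A\<^esub> n"] root_carrier
    by (simp add: A.m_comm adjoin_root_simps(1))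
qed (simp add: adjoin_root_simps)

text \<open>Modulo the maximal ideal the relation reads X^r times a polynomial with unit constant
  term = 0, so X^r is a multiple of X^(r+1) there.\<close>

lemma root_stabilises:
  "\<exists>(r::nat) h. h \<in> carrier A \<and>
    root [^]\<^bsub>A\<^esub> r \<ominus>\<^bsub>A\<^esub> root [^]\<^bsub>A\<^esub> Suc r \<otimes>\<^bsub>A\<^esub> h \<in> adic 1"
proof -
  let ?p = "\<lambda>n::nat. root [^]\<^bsub>A\<^esub> n"
  have pF: "?p n \<in> carrier F" for n using root_carrier A.nat_pow_closed adjoin_root_simps(1) by blast
  have rel: "?p d = (\<Oplus>\<^bsub>F\<^esub>i\<in>{..<d}. c i \<odot>\<^bsub>F\<^esub> ?p i)"
    using companion_relation[of "unit_vec 0"] by (simp add: poly_act_def root_pow)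
  have small: "c i \<odot>\<^bsub>F\<^esub> ?p i \<in> adic 1" if "c i \<in> \<mm>" for i
    using adic_closed(5)[of "c i" 1 "?p i" 0] that pF[of i] by (simp add: \<mm>pow_1[simplified] adic_0)
  \<comment> \<open>The value d stands for the leading coefficient 1. The least r with
    \<open>P r\<close> is thus the order of vanishing at 0 of the monic polynomial modulo the
    maximal ideal.\<close>
  define P where "P r \<longleftrightarrow> r = d \<or> c r \<notin> \<mm>" for r
  define r where "r = (LEAST r. P r)"
  have "P d" by (simp add: P_def)
  then have Pr: "P r" and rd: "r \<le> d" and least: "\<And>i. i < r \<Longrightarrow> c i \<in> \<mm>"
    unfolding r_def by (auto intro: LeastI Least_le dest: not_less_Least) 
      (use P_def not_less_Least in blast)
  have pA: "?p (Suc r) \<in> carrier A" using root_carrier by simp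
  let ?J = "PIdl\<^bsub>A\<^esub> ?p (Suc r)"
  \<comment> \<open>The elements that are multiples of X^(r+1) modulo the maximal ideal; the goal is
    that X^r belongs to L.\<close>
  define L where "L = adic 1 <+>\<^bsub>A\<^esub> ?J"
  have L_mem: "y \<in> L \<longleftrightarrow> (\<exists>a \<in> adic 1. \<exists>h \<in> carrier A. y = a \<oplus>\<^bsub>A\<^esub> h \<otimes>\<^bsub>A\<^esub> ?p (Suc r))" for y
    unfolding L_def set_add_def' cgenideal_def by auto
  have L: "ideal L A" unfolding L_def by (intro A.add_ideals adic_ideal A.cgenideal_ideal pA)
  have L_add: "a \<oplus>\<^bsub>A\<^esub> b \<in> L" if "a \<in> L" "b \<in> L" for a b
    using additive_subgroup.a_closed[OF ideal.axioms(1)[OF L] that] .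
  have LF: "L \<subseteq> carrier F" using ideal.Icarr[OF L] by (auto simp: adjoin_root_simps(1))
  \<comment> \<open>A scalar s acts as the ring element s times 1, so the ideal L is also closed
    under scalars.\<close>
  have L_smult: "s \<odot>\<^bsub>F\<^esub> a \<in> L" if a: "a \<in> L" and s: "s \<in> carrier R" for a s
  proof -
    have aF: "a \<in> carrier F" using a LF by blast
    have sA: "s \<odot>\<^bsub>F\<^esub> unit_vec 0 \<in> carrier A" using s by (simp add: adjoin_root_simps(1))
    have "a \<otimes>\<^bsub>A\<^esub> (s \<odot>\<^bsub>F\<^esub> unit_vec 0) = s \<odot>\<^bsub>F\<^esub> a"
      using module_homD(3)[OF poly_act_module_hom[OF F.module_axioms companion_hom F_Pi[OF aF]] s, of "unit_vec 0"]
      by (simp add: adjoin_root_simps poly_act_unit_vec aF)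
    then show ?thesis using ideal.I_r_closed[OF L a sA] by simp
  qed
  have adL: "y \<in> L" if y: "y \<in> adic 1" for y
  proof -
    have "y \<in> carrier A" using y adic_closed(1) unfolding adjoin_root_simps(1) by blast
    then have "y = y \<oplus>\<^bsub>A\<^esub> \<zero>\<^bsub>A\<^esub> \<otimes>\<^bsub>A\<^esub> ?p (Suc r)" using pA by (simp del: A.nat_pow_Suc)
    then show ?thesis unfolding L_mem using y by blast
  qed
  have powL: "?p n \<in> L" if "n > r" for n
  proof -
    obtain k where k: "n = k + Suc r" using \<open>n > r\<close> by (metis Suc_leI le_add_diff_inverse2)
    have "?p n = ?p k \<otimes>\<^bsub>A\<^esub> ?p (Suc r)"
      unfolding k using root_carrier by (rule A.nat_pow_mult[symmetric])
    then have "?p n = \<zero>\<^bsub>A\<^esub> \<oplus>\<^bsub>A\<^esub> ?p k \<otimes>\<^bsub>A\<^esub> ?p (Suc r)" using pA root_carrier by simp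
    then show ?thesis unfolding L_mem using adic_closed(2)[of 1] root_carrier
      by (metis A.nat_pow_closed adjoin_root_simps(3))
  qed
  have Lsum: "(\<Oplus>\<^bsub>F\<^esub>i\<in>B. u i) \<in> L" if "finite B" "\<And>i. i \<in> B \<Longrightarrow> u i \<in> L" for B u
    using that LF adL[OF adic_closed(2)] L_add by (intro F.finsum_mem) (auto simp: adjoin_root_simps)
  have "?p r \<in> L"
  proof (cases "r = d")
    case True
    \<comment> \<open>All coefficients c_i lie in the maximal ideal, so X^d itself is in
      \<open>adic 1\<close>.\<close>
    then have "?p r = (\<Oplus>\<^bsub>F\<^esub>i\<in>{..<d}. c i \<odot>\<^bsub>F\<^esub> ?p i)" using rel by simp
    also have "\<dots> \<in> L" using small least True by (intro Lsum adL) auto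
    finally show ?thesis .
  next
    case False
    then have r: "r < d" "c r \<notin> \<mm>" using rd Pr by (auto simp: P_def)
    define T where "T = (\<Oplus>\<^bsub>F\<^esub>i\<in>{..<d}-{r}. c i \<odot>\<^bsub>F\<^esub> ?p i)"
    have T: "T \<in> L" unfolding T_def
    proof (rule Lsum)
      fix i assume "i \<in> {..<d}-{r}"
      then consider "i < r" | "i > r" by fastforce
      then show "c i \<odot>\<^bsub>F\<^esub> ?p i \<in> L"
        by cases (use small least adL powL L_smult c in auto)
    qed simp
    \<comment> \<open>The relation is solved for its term of index r. Terms of lower index lie in
      \<open>adic 1\<close>, those of higher index and X^d in the ideal of X^(r+1), and c_r is
      invertible.\<close>
    have "?p d = (\<Oplus>\<^bsub>F\<^esub>i\<in>insert r ({..<d}-{r}). c i \<odot>\<^bsub>F\<^esub> ?p i)"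
      using r rel by (simp add: insert_absorb)
    also have "\<dots> = c r \<odot>\<^bsub>F\<^esub> ?p r \<oplus>\<^bsub>F\<^esub> T"
      unfolding T_def using c pF by (intro F.finsum_insert) auto
    finally have "c r \<odot>\<^bsub>F\<^esub> ?p r = ?p d \<oplus>\<^bsub>F\<^esub> (\<ominus> \<one>) \<odot>\<^bsub>F\<^esub> T"
      using c pF T LF by (simp add: F.smult_l_minus F.a_assoc F.r_neg subset_iff)
    moreover have "(\<ominus> \<one>) \<odot>\<^bsub>F\<^esub> T \<in> L" using T by (intro L_smult) auto
    ultimately have crL: "c r \<odot>\<^bsub>F\<^esub> ?p r \<in> L"
      using L_add[OF powL[of d]] r by (simp add: adjoin_root_simps)
    obtain u where u: "u \<in> carrier R" "u \<otimes> c r = \<one>" using left_inverse_if_notin_\<mm>[OF c r(2)] by blast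
    have "?p r = u \<odot>\<^bsub>F\<^esub> (c r \<odot>\<^bsub>F\<^esub> ?p r)"
      using u c pF F.smult_assoc1[of u "c r" "?p r"] by simp
    then show ?thesis using L_smult[OF crL u(1)] by simp
  qed
  then obtain a h where ah: "a \<in> adic 1" "h \<in> carrier A" "?p r = a \<oplus>\<^bsub>A\<^esub> h \<otimes>\<^bsub>A\<^esub> ?p (Suc r)"
    unfolding L_mem by blast
  have aA: "a \<in> carrier A" using ah(1) adic_closed(1) unfolding adjoin_root_simps(1) by blast
  have "(a \<oplus>\<^bsub>A\<^esub> h \<otimes>\<^bsub>A\<^esub> q) \<ominus>\<^bsub>A\<^esub> q \<otimes>\<^bsub>A\<^esub> h = a" if "q \<in> carrier A" for q
    using aA ah(2) that by algebra
  from this[OF pA] have "?p r \<ominus>\<^bsub>A\<^esub> ?p (Suc r) \<otimes>\<^bsub>A\<^esub> h \<in> adic 1" using ah(1) by (simp only: ah(3)[symmetric])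
  then show ?thesis using ah(2) by blast
qed

lemma root_idempotent:
  "\<exists>e \<in> carrier A. \<exists>q \<in> carrier A. \<exists>q' \<in> carrier A.
    e \<otimes>\<^bsub>A\<^esub> e = e \<and> e = root \<otimes>\<^bsub>A\<^esub> q \<and>
    \<one>\<^bsub>A\<^esub> \<ominus>\<^bsub>A\<^esub> e = (\<one>\<^bsub>A\<^esub> \<ominus>\<^bsub>A\<^esub> root) \<otimes>\<^bsub>A\<^esub> q'"
proof -
  interpret filt: complete_filtered_cring A adic by (rule adjoin_root_complete_filtered)
  show ?thesis using root_stabilises filt.fitting_idempotent[OF root_carrier] by blast
qed

end

section \<open>Endomorphisms of indecomposable modules\<close>

lemma fg_modulesE:
  assumes "M \<in> fg_modules R"
  obtains S where "module R M" "finite S" "S \<subseteq> carrier M"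
    "\<And>x. x \<in> carrier M \<Longrightarrow> \<exists>a \<in> S \<rightarrow> carrier R. x = (\<Oplus>\<^bsub>M\<^esub>v\<in>S. a v \<odot>\<^bsub>M\<^esub> v)"
proof -
  obtain S where M: "module R M" and S: "finite S" "S \<subseteq> carrier M" "module.span R M S = carrier M"
    using assms by (auto simp: fg_modules_def)
  interpret M: module R M by (rule M)
  show thesis
  proof (rule that[OF M S(1,2)])
    fix x assume "x \<in> carrier M"
    then show "\<exists>a \<in> S \<rightarrow> carrier R. x = (\<Oplus>\<^bsub>M\<^esub>v\<in>S. a v \<odot>\<^bsub>M\<^esub> v)"
      using M.finite_span[OF S(1,2)] S(3) by (auto simp: M.lincomb_def)
  qed
qed

lemma fg_modules_module: "M \<in> fg_modules R \<Longrightarrow> module R M"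
  by (simp add: fg_modules_def)

text \<open>Images of the generators generate. The application is to images of projections, which
  are the candidates for direct summands.\<close>

lemma fg_modules_surj_image:
  assumes N: "N \<in> fg_modules R" and M: "module R M"
    and h: "h \<in> module_hom R N M" "h ` carrier N = carrier M"
  shows "M \<in> fg_modules R"
proof -
  obtain S where mN: "module R N" and S: "finite S" "S \<subseteq> carrier N"
    and gen: "\<And>x. x \<in> carrier N \<Longrightarrow> \<exists>a \<in> S \<rightarrow> carrier R. x = (\<Oplus>\<^bsub>N\<^esub>v\<in>S. a v \<odot>\<^bsub>N\<^esub> v)"
    using fg_modulesE[OF N] by blast
  interpret N: module R N by (rule mN)
  interpret M: module R M by (rule M)
  have hS: "h ` S \<subseteq> carrier M" using S(2) h(2) by blast
  have sub: "submodule R (M.span (h ` S)) M" using hS by (rule M.span_is_submodule)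
  have "carrier M \<subseteq> M.span (h ` S)"
  proof
    fix y assume "y \<in> carrier M"
    then obtain x where x: "x \<in> carrier N" "y = h x" using h(2) by blast
    then obtain a where a: "a \<in> S \<rightarrow> carrier R" "x = (\<Oplus>\<^bsub>N\<^esub>v\<in>S. a v \<odot>\<^bsub>N\<^esub> v)" using gen by blast
    have "h x = (\<Oplus>\<^bsub>M\<^esub>v\<in>S. h (a v \<odot>\<^bsub>N\<^esub> v))"
      unfolding a(2) using a(1) S(2) by (intro module_hom_finsum[OF mN M h(1) S(1)]) (auto simp: Pi_iff)
    also have "\<dots> \<in> M.span (h ` S)"
    proof (rule M.finsum_mem[OF S(1)])
      fix v assume v: "v \<in> S"
      have "h (a v \<odot>\<^bsub>N\<^esub> v) = a v \<odot>\<^bsub>M\<^esub> h v" using a(1) S(2) v by (intro module_homD(3)[OF h(1)]) auto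
      also have "\<dots> \<in> M.span (h ` S)"
        using a(1) v M.in_own_span[OF hS] by (intro submodule.smult_closed[OF sub]) auto
      finally show "h (a v \<odot>\<^bsub>N\<^esub> v) \<in> M.span (h ` S)" .
    qed (simp_all add: submodule.subset[OF sub] submodule.zero_closed[OF sub] submodule.m_closed[OF sub])
    finally show "y \<in> M.span (h ` S)" using x(2) by simp
  qed
  then have "M.span (h ` S) = carrier M" using submodule.subset[OF sub] by blast
  then show ?thesis using M S(1) hS unfolding fg_modules_def by blast
qed

lemma image_module:
  assumes M: "module R M" and N: "module R N" and h: "h \<in> module_hom R M N"
  shows "module R (N\<lparr>carrier := h ` carrier M\<rparr>)"
proof -
  interpret M: module R M by (rule M)
  interpret N: module R N by (rule N)
  have "submodule R (h ` carrier M) N"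
  proof (rule submodule.intro)
    show "module R N" by (rule N)
    show "h ` carrier M \<subseteq> carrier N" using module_homD(1)[OF h] by blast
    show "\<zero>\<^bsub>N\<^esub> \<in> h ` carrier M" using module_hom_zero[OF M N h] by (metis M.zero_closed image_eqI)
  next
    fix v w assume "v \<in> h ` carrier M" "w \<in> h ` carrier M"
    then show "v \<oplus>\<^bsub>N\<^esub> w \<in> h ` carrier M"
      by (metis (no_types, lifting) M.a_closed image_iff module_homD(2)[OF h])
  next
    fix r v assume "r \<in> carrier R" "v \<in> h ` carrier M"
    then show "r \<odot>\<^bsub>N\<^esub> v \<in> h ` carrier M"
      by (metis (no_types, lifting) M.smult_closed image_iff module_homD(3)[OF h])
  qed
  then show ?thesis by (rule N.submodule_is_module)
qed

lemma image_fg: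
  assumes M: "M \<in> fg_modules R" and N: "module R N" and h: "h \<in> module_hom R M N"
  shows "N\<lparr>carrier := h ` carrier M\<rparr> \<in> fg_modules R"
  using fg_modules_surj_image[OF M image_module[OF fg_modules_module[OF M] N h], of h] h
  by (auto simp: module_hom_def)

text \<open>Write f^i on the generators S in coordinates: each i gives a vector indexed by S x S. By
  the chain condition some such vector depends on the earlier ones, and this dependence holds for
  the maps themselves, first on S and then everywhere.\<close>

lemma (in complete_noetherian_local_ring) endo_relation:
  assumes Mfg: "M \<in> fg_modules R" and f: "f \<in> module_hom R M M"
  shows "\<exists>d c. 0 < d \<and> (\<forall>i. c i \<in> carrier R) \<and>
    (\<forall>x \<in> carrier M. (f ^^ d) x = poly_act M f d c x)"
proof -
  obtain S where mM: "module R M" and S: "finite S" "S \<subseteq> carrier M"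
    and gen: "\<And>x. x \<in> carrier M \<Longrightarrow> \<exists>a \<in> S \<rightarrow> carrier R. x = (\<Oplus>\<^bsub>M\<^esub>v\<in>S. a v \<odot>\<^bsub>M\<^esub> v)"
    using fg_modulesE[OF Mfg] by blast
  interpret M: module R M by (rule mM)
  note fi = funpow_module_hom[OF f]
  have ex: "\<exists>a. a \<in> S \<rightarrow> carrier R \<and> (f ^^ i) x = (\<Oplus>\<^bsub>M\<^esub>v\<in>S. a v \<odot>\<^bsub>M\<^esub> v)" if "x \<in> S" for i x
    using gen[of "(f ^^ i) x"] module_homD(1)[OF fi] S(2) that by blast
  \<comment> \<open>The generators need not be independent, so coordinates are chosen arbitrarily.
    This is harmless: relations pass only from coordinates to maps.\<close>
  define a where "a i x = (SOME a. a \<in> S \<rightarrow> carrier R \<and> (f ^^ i) x = (\<Oplus>\<^bsub>M\<^esub>v\<in>S. a v \<odot>\<^bsub>M\<^esub> v))" for i x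
  have a: "a i x \<in> S \<rightarrow> carrier R" "(f ^^ i) x = (\<Oplus>\<^bsub>M\<^esub>v\<in>S. a i x v \<odot>\<^bsub>M\<^esub> v)" if "x \<in> S" for i x
    using someI_ex[OF ex[OF that, of i]] unfolding a_def by blast+
  define v where "v i p = a i (fst p) (snd p)" for i p
  have vc: "v i p \<in> carrier R" if "p \<in> S \<times> S" for i p using a(1) that by (auto simp: v_def Pi_iff)
  obtain d where "seq_comb (S \<times> S) v d (v d)"
    using seq_eventually_comb[OF is_cring noetherian_ring_axioms finite_cartesian_product[OF S(1) S(1)], of v] vc
    by blast
  then obtain c where c: "\<And>i. c i \<in> carrier R"
      and vd: "\<And>p. p \<in> S \<times> S \<Longrightarrow> v d p = (\<Oplus>i\<in>{..<d}. c i \<otimes> v i p)"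
    by (rule seq_combE) (rule that, assumption, assumption)
  have cP: "c \<in> {..<n} \<rightarrow> carrier R" for n using c by simp
  have onS: "(f ^^ d) x = poly_act M f d c x" if x: "x \<in> S" for x
  proof -
    have xM: "x \<in> carrier M" using x S by blast
    have fix': "(f ^^ i) x \<in> carrier M" for i using module_homD(1)[OF fi xM] .
    have ac: "a i x y \<in> carrier R" if "y \<in> S" for i y using a(1)[OF x] that by auto
    \<comment> \<open>Interchange of the sum over generators with the sum over exponents.\<close>
    have sum: "(\<Oplus>\<^bsub>M\<^esub>y\<in>S. (\<Oplus>i\<in>{..<n}. c i \<otimes> a i x y) \<odot>\<^bsub>M\<^esub> y) = (\<Oplus>\<^bsub>M\<^esub>i\<in>{..<n}. c i \<odot>\<^bsub>M\<^esub> (f ^^ i) x)" for n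
    proof (induction n)
      case 0
      have "(\<Oplus>\<^bsub>M\<^esub>y\<in>S. \<zero> \<odot>\<^bsub>M\<^esub> y) = (\<Oplus>\<^bsub>M\<^esub>y\<in>S. \<zero>\<^bsub>M\<^esub>)" using S(2) by (intro M.finsum_cong') auto
      then show ?case by simp
    next
      case (Suc n)
      note scal = module_hom_scale[OF mM c[of n]]
      have "(\<Oplus>\<^bsub>M\<^esub>y\<in>S. (\<Oplus>i\<in>{..<Suc n}. c i \<otimes> a i x y) \<odot>\<^bsub>M\<^esub> y) =
        (\<Oplus>\<^bsub>M\<^esub>y\<in>S. c n \<odot>\<^bsub>M\<^esub> (a n x y \<odot>\<^bsub>M\<^esub> y) \<oplus>\<^bsub>M\<^esub> (\<Oplus>i\<in>{..<n}. c i \<otimes> a i x y) \<odot>\<^bsub>M\<^esub> y)"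
      proof (rule M.finsum_cong')
        fix y assume y: "y \<in> S"
        have yM: "y \<in> carrier M" using y S by blast
        have "(\<Oplus>i\<in>{..<Suc n}. c i \<otimes> a i x y) = c n \<otimes> a n x y \<oplus> (\<Oplus>i\<in>{..<n}. c i \<otimes> a i x y)"
          using c ac[OF y] by (intro finsum_lessThan_Suc) auto
        moreover have "(\<Oplus>i\<in>{..<n}. c i \<otimes> a i x y) \<in> carrier R" using c ac[OF y] by (intro finsum_closed) auto
        ultimately show "(\<Oplus>i\<in>{..<Suc n}. c i \<otimes> a i x y) \<odot>\<^bsub>M\<^esub> y =
            c n \<odot>\<^bsub>M\<^esub> (a n x y \<odot>\<^bsub>M\<^esub> y) \<oplus>\<^bsub>M\<^esub> (\<Oplus>i\<in>{..<n}. c i \<otimes> a i x y) \<odot>\<^bsub>M\<^esub> y"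
          using c ac[OF y] yM by (simp add: M.smult_l_distr M.smult_assoc1)
      qed (use S c ac in \<open>auto intro!: M.a_closed M.smult_closed finsum_closed\<close>)
      also have "\<dots> = (\<Oplus>\<^bsub>M\<^esub>y\<in>S. c n \<odot>\<^bsub>M\<^esub> (a n x y \<odot>\<^bsub>M\<^esub> y)) \<oplus>\<^bsub>M\<^esub>
          (\<Oplus>\<^bsub>M\<^esub>y\<in>S. (\<Oplus>i\<in>{..<n}. c i \<otimes> a i x y) \<odot>\<^bsub>M\<^esub> y)"
        using S c ac by (intro M.finsum_addf) (auto intro!: M.smult_closed finsum_closed)
      also have "(\<Oplus>\<^bsub>M\<^esub>y\<in>S. c n \<odot>\<^bsub>M\<^esub> (a n x y \<odot>\<^bsub>M\<^esub> y)) = c n \<odot>\<^bsub>M\<^esub> (f ^^ n) x"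
        unfolding a(2)[OF x] using S ac
        by (intro module_hom_finsum[OF mM mM scal, symmetric]) auto
      also have "c n \<odot>\<^bsub>M\<^esub> (f ^^ n) x \<oplus>\<^bsub>M\<^esub> (\<Oplus>\<^bsub>M\<^esub>y\<in>S. (\<Oplus>i\<in>{..<n}. c i \<otimes> a i x y) \<odot>\<^bsub>M\<^esub> y) =
          (\<Oplus>\<^bsub>M\<^esub>i\<in>{..<Suc n}. c i \<odot>\<^bsub>M\<^esub> (f ^^ i) x)"
        unfolding Suc using c fix' by (intro M.finsum_lessThan_Suc[symmetric]) auto
      finally show ?case .
    qed
    have "(f ^^ d) x = (\<Oplus>\<^bsub>M\<^esub>y\<in>S. (\<Oplus>i\<in>{..<d}. c i \<otimes> a i x y) \<odot>\<^bsub>M\<^esub> y)"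
      unfolding a(2)[OF x]
    proof (rule M.finsum_cong')
      fix y assume "y \<in> S"
      then show "a d x y \<odot>\<^bsub>M\<^esub> y = (\<Oplus>i\<in>{..<d}. c i \<otimes> a i x y) \<odot>\<^bsub>M\<^esub> y"
        using vd[of "(x, y)"] x by (simp add: v_def)
    qed (use S c ac in \<open>auto intro!: M.smult_closed finsum_closed\<close>)
    then show ?thesis unfolding sum poly_act_def .
  qed
  have rel: "(f ^^ d) x = poly_act M f d c x" if x: "x \<in> carrier M" for x
  proof -
    obtain b where b: "b \<in> S \<rightarrow> carrier R" "x = (\<Oplus>\<^bsub>M\<^esub>v\<in>S. b v \<odot>\<^bsub>M\<^esub> v)" using gen[OF x] by blast
    have hom: "h x = (\<Oplus>\<^bsub>M\<^esub>v\<in>S. b v \<odot>\<^bsub>M\<^esub> h v)" if h: "h \<in> module_hom R M M" for h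
    proof -
      have "h x = (\<Oplus>\<^bsub>M\<^esub>v\<in>S. h (b v \<odot>\<^bsub>M\<^esub> v))"
        unfolding b(2) using b(1) S(2) by (intro module_hom_finsum[OF mM mM h S(1)]) (auto simp: Pi_iff)
      also have "\<dots> = (\<Oplus>\<^bsub>M\<^esub>v\<in>S. b v \<odot>\<^bsub>M\<^esub> h v)"
        using b(1) S(2) module_homD(1,3)[OF h] by (intro M.finsum_cong') (auto simp: Pi_iff subset_iff)
      finally show ?thesis .
    qed
    note ph = poly_act_module_hom[OF mM f cP]
    have "(\<Oplus>\<^bsub>M\<^esub>v\<in>S. b v \<odot>\<^bsub>M\<^esub> (f ^^ d) v) = (\<Oplus>\<^bsub>M\<^esub>v\<in>S. b v \<odot>\<^bsub>M\<^esub> poly_act M f d c v)"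
      using b(1) S(2) onS module_homD(1)[OF ph] by (intro M.finsum_cong') (auto simp: Pi_iff subset_iff)
    then show ?thesis using hom[OF fi] hom[OF ph] by simp
  qed
  show ?thesis
  \<comment> \<open>An empty relation says x = 0 for all x; then M is zero and any relation of
    degree 1 holds.\<close>
  proof (cases "d = 0")
    case True
    then have z: "x = \<zero>\<^bsub>M\<^esub>" if "x \<in> carrier M" for x using rel[OF that] by (simp add: poly_act_def)
    have "(f ^^ 1) x = poly_act M f 1 c x" if x: "x \<in> carrier M" for x
      using z[of "(f ^^ 1) x"] z[of "poly_act M f 1 c x"] module_homD(1)[OF fi x, of 1]
        module_homD(1)[OF poly_act_module_hom[OF mM f cP] x] by simp
    then show ?thesis using c by (intro exI[of _ 1] exI[of _ c]) simp
  next
    case False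
    then show ?thesis using rel c by blast
  qed
qed

text \<open>Since f satisfies the relation, \<open>adjoin_root\<close> acts on M with its root
  acting as f; e, q and q' are the actions of the elements from \<open>root_idempotent\<close>.
  Commutativity of the ring yields each factorisation in both orders, as two-sided inverses
  require.\<close>

lemma (in complete_noetherian_local_ring) endo_split:
  assumes Mfg: "M \<in> fg_modules R" and f: "f \<in> module_hom R M M"
  shows "\<exists>e \<in> module_hom R M M. \<exists>q \<in> module_hom R M M. \<exists>q' \<in> module_hom R M M.
    (\<forall>x \<in> carrier M. e (e x) = e x \<and> e x = f (q x) \<and> e x = q (f x) \<and>
      x \<ominus>\<^bsub>M\<^esub> e x = q' (x \<ominus>\<^bsub>M\<^esub> f x) \<and> x \<ominus>\<^bsub>M\<^esub> e x = q' x \<ominus>\<^bsub>M\<^esub> f (q' x))"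
proof -
  have M: "module R M" using Mfg by (rule fg_modules_module)
  interpret M: module R M by (rule M)
  obtain d c where d: "0 < d" and c: "\<And>i. c i \<in> carrier R"
    and rel: "\<And>x. x \<in> carrier M \<Longrightarrow> (f ^^ d) x = poly_act M f d c x"
    using endo_relation[OF Mfg f] by blast
  interpret rel: complete_monic_relation R \<mm> d c
    by (intro complete_monic_relation.intro complete_noetherian_local_ring_axioms
        monic_relation.intro monic_relation_axioms.intro is_cring d c)
  let ?A = rel.adjoin_root
  define act where "act v x = poly_act M f d v x" for v x
  note AF = rel.adjoin_root_simps(1)
  have hom: "act v \<in> module_hom R M M" if "v \<in> carrier ?A" for v
    using poly_act_module_hom[OF M f rel.F_Pi] that unfolding act_def AF by blast
  have mult: "act (v \<otimes>\<^bsub>?A\<^esub> w) x = act v (act w x)"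
    if "v \<in> carrier ?A" "w \<in> carrier ?A" "x \<in> carrier M" for v w x
    using rel.poly_act_mult[OF M f rel] that unfolding act_def AF rel.adjoin_root_simps(5) by blast
  have one: "act \<one>\<^bsub>?A\<^esub> x = x" if x: "x \<in> carrier M" for x
  proof -
    obtain k where k: "d = Suc k" using d by (cases d) auto
    note fi = module_homD(1)[OF funpow_module_hom[OF f] x]
    have u: "rel.unit_vec 0 0 = \<one>" "\<And>i. Suc i < d \<Longrightarrow> rel.unit_vec 0 (Suc i) = \<zero>"
      using d by (simp_all add: free_unit_def)
    have uc: "rel.unit_vec 0 i \<in> carrier R" if "i < d" for i using that by (simp add: free_unit_def)
    \<comment> \<open>The coordinates of the unit vector leave only the term of exponent 0.\<close>
    have "act \<one>\<^bsub>?A\<^esub> x = rel.unit_vec 0 0 \<odot>\<^bsub>M\<^esub> (f ^^ 0) x \<oplus>\<^bsub>M\<^esub>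
        (\<Oplus>\<^bsub>M\<^esub>i\<in>{..<k}. rel.unit_vec 0 (Suc i) \<odot>\<^bsub>M\<^esub> (f ^^ Suc i) x)"
      unfolding act_def poly_act_def rel.adjoin_root_simps(2)
      using M.finsum_lessThan_Suc2[of "\<lambda>i. rel.unit_vec 0 i \<odot>\<^bsub>M\<^esub> (f ^^ i) x" k] uc fi
      unfolding k[symmetric] by auto
    also have "(\<Oplus>\<^bsub>M\<^esub>i\<in>{..<k}. rel.unit_vec 0 (Suc i) \<odot>\<^bsub>M\<^esub> (f ^^ Suc i) x) = (\<Oplus>\<^bsub>M\<^esub>i\<in>{..<k}. \<zero>\<^bsub>M\<^esub>)"
    proof (rule M.finsum_cong')
      fix i assume "i \<in> {..<k}"
      then show "rel.unit_vec 0 (Suc i) \<odot>\<^bsub>M\<^esub> (f ^^ Suc i) x = \<zero>\<^bsub>M\<^esub>" using u(2)[of i] k fi[of "Suc i"] by simp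
    qed simp_all
    finally show ?thesis using x u(1) by simp
  qed
  have root: "act rel.root x = f x" if x: "x \<in> carrier M" for x
    using rel.poly_act_companion[OF M f rel rel.unit_vec_carrier x, of 0] one[OF x]
    by (simp add: act_def rel.root_def rel.adjoin_root_simps)
  have minus: "act (v \<ominus>\<^bsub>?A\<^esub> w) x = act v x \<ominus>\<^bsub>M\<^esub> act w x"
    if v: "v \<in> carrier ?A" "w \<in> carrier ?A" and x: "x \<in> carrier M" for v w x
  proof -
    have vw: "v \<ominus>\<^bsub>?A\<^esub> w \<in> carrier ?A" using v by simp
    have "v = (v \<ominus>\<^bsub>?A\<^esub> w) \<oplus>\<^bsub>?A\<^esub> w" using v by algebra
    also have "\<dots> = (v \<ominus>\<^bsub>?A\<^esub> w) \<oplus>\<^bsub>rel.F\<^esub> w" by (simp only: rel.adjoin_root_simps(4))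
    finally have eq: "v = (v \<ominus>\<^bsub>?A\<^esub> w) \<oplus>\<^bsub>rel.F\<^esub> w" .
    have "v i = (v \<ominus>\<^bsub>?A\<^esub> w) i \<oplus> w i" if "i < d" for i
      using fun_cong[OF eq, of i] that by (simp only: rel.F_simps(3) lessThan_iff restrict_apply' if_True)
    then have "act v x = act (v \<ominus>\<^bsub>?A\<^esub> w) x \<oplus>\<^bsub>M\<^esub> act w x"
      using vw v unfolding act_def AF by (intro poly_act_add[OF M f _ _ x] rel.F_Pi) auto
    then show ?thesis using module_homD(1)[OF hom x] vw v
      by (simp add: a_minus_def M.a_assoc M.r_neg)
  qed
  have comm: "act v (act w x) = act w (act v x)"
    if "v \<in> carrier ?A" "w \<in> carrier ?A" "x \<in> carrier M" for v w x
    using mult[OF that] mult[OF that(2,1,3)] rel.A.m_comm[OF that(1,2)] by simp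
  obtain e q q' where eq: "e \<in> carrier ?A" "q \<in> carrier ?A" "q' \<in> carrier ?A"
    "e \<otimes>\<^bsub>?A\<^esub> e = e" "e = rel.root \<otimes>\<^bsub>?A\<^esub> q"
    "\<one>\<^bsub>?A\<^esub> \<ominus>\<^bsub>?A\<^esub> e = (\<one>\<^bsub>?A\<^esub> \<ominus>\<^bsub>?A\<^esub> rel.root) \<otimes>\<^bsub>?A\<^esub> q'"
    using rel.root_idempotent by blast
  note rc = rel.root_carrier
  have fc: "f x \<in> carrier M" if "x \<in> carrier M" for x using module_homD(1)[OF f that] .
  have "act e (act e x) = act e x \<and> act e x = f (act q x) \<and> act e x = act q (f x) \<and>
      x \<ominus>\<^bsub>M\<^esub> act e x = act q' (x \<ominus>\<^bsub>M\<^esub> f x) \<and> x \<ominus>\<^bsub>M\<^esub> act e x = act q' x \<ominus>\<^bsub>M\<^esub> f (act q' x)"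
    if x: "x \<in> carrier M" for x
  proof (intro conjI)
    show "act e (act e x) = act e x" using mult[OF eq(1,1) x] eq(4) by simp
    show 1: "act e x = f (act q x)"
      using mult[OF rc eq(2) x] eq(5) root module_homD(1)[OF hom[OF eq(2)] x] by simp
    show "act e x = act q (f x)"
      using 1 comm[OF rc eq(2) x] root x module_homD(1)[OF hom[OF eq(2)] x] by simp
    have qx: "act q' x \<in> carrier M" using module_homD(1)[OF hom[OF eq(3)] x] .
    have "x \<ominus>\<^bsub>M\<^esub> act e x = act (\<one>\<^bsub>?A\<^esub> \<ominus>\<^bsub>?A\<^esub> e) x" using minus[OF _ eq(1) x] one[OF x] by simp
    also have "\<dots> = act (\<one>\<^bsub>?A\<^esub> \<ominus>\<^bsub>?A\<^esub> rel.root) (act q' x)"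
      unfolding eq(6) using rc by (intro mult eq x) simp
    also have "\<dots> = act q' x \<ominus>\<^bsub>M\<^esub> f (act q' x)" using minus[OF _ rc qx] one[OF qx] root[OF qx] by simp
    finally show 2: "x \<ominus>\<^bsub>M\<^esub> act e x = act q' x \<ominus>\<^bsub>M\<^esub> f (act q' x)" .
    also have "\<dots> = act q' x \<ominus>\<^bsub>M\<^esub> act q' (f x)"
      using comm[OF rc eq(3) x] root[OF qx] root[OF x] by simp
    also have "\<dots> = act q' (x \<ominus>\<^bsub>M\<^esub> f x)"
      using module_hom_minus[OF M M hom[OF eq(3)] x fc[OF x]] by simp
    finally show "x \<ominus>\<^bsub>M\<^esub> act e x = act q' (x \<ominus>\<^bsub>M\<^esub> f x)" .
  qed
  then show ?thesis using hom eq by blast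
qed

text \<open>M is the direct sum of the images of e and 1 - e, so one of these vanishes. If e = 0,
  then q' is a two-sided inverse of 1 - f; if e = 1, then q is a two-sided inverse of f.\<close>

lemma (in complete_noetherian_local_ring) indecomposable_endo_local:
  assumes Mfg: "M \<in> fg_modules R" and ind: "indecomposable R M" and f: "f \<in> module_hom R M M"
  shows "bij_betw f (carrier M) (carrier M) \<or> bij_betw (\<lambda>x. x \<ominus>\<^bsub>M\<^esub> f x) (carrier M) (carrier M)"
proof -
  have M: "module R M" using Mfg by (rule fg_modules_module)
  interpret M: module R M by (rule M)
  obtain e q q' where e: "e \<in> module_hom R M M" and q: "q \<in> module_hom R M M" and q': "q' \<in> module_hom R M M"
    and ee: "\<And>x. x \<in> carrier M \<Longrightarrow> e (e x) = e x"
    and efq: "\<And>x. x \<in> carrier M \<Longrightarrow> e x = f (q x)" and eqf: "\<And>x. x \<in> carrier M \<Longrightarrow> e x = q (f x)"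
    and e1: "\<And>x. x \<in> carrier M \<Longrightarrow> x \<ominus>\<^bsub>M\<^esub> e x = q' (x \<ominus>\<^bsub>M\<^esub> f x)"
    and e2: "\<And>x. x \<in> carrier M \<Longrightarrow> x \<ominus>\<^bsub>M\<^esub> e x = q' x \<ominus>\<^bsub>M\<^esub> f (q' x)"
    using endo_split[OF Mfg f] by blast
  note ec = module_homD(1)[OF e] and fc = module_homD(1)[OF f]
  have canc: "e x \<oplus>\<^bsub>M\<^esub> (x \<ominus>\<^bsub>M\<^esub> e x) = x" if "x \<in> carrier M" for x
    using that ec[OF that] by (simp add: a_minus_def M.a_lcomm M.r_neg)
  define g where "g x = x \<ominus>\<^bsub>M\<^esub> e x" for x
  have g: "g \<in> module_hom R M M"
    unfolding g_def by (rule module_hom_diff[OF M M module_hom_id e])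
  let ?A = "M\<lparr>carrier := e ` carrier M\<rparr>" and ?B = "M\<lparr>carrier := g ` carrier M\<rparr>"
  have AB: "?A \<in> fg_modules R" "?B \<in> fg_modules R" using image_fg[OF Mfg M] e g by auto
  have eg: "e (g x) = \<zero>\<^bsub>M\<^esub>" if "x \<in> carrier M" for x
    using module_hom_minus[OF M M e that ec[OF that]] ee[OF that] ec[OF that]
    by (simp add: g_def a_minus_def M.r_neg)
  \<comment> \<open>The inverse map is addition of the two components, because e and g = 1 - e are
    complementary projections.\<close>
  let ?h = "\<lambda>x. (e x, g x)"
  have "?h \<in> module_hom R M (direct_sum ?A ?B)"
    using module_homD[OF e] module_homD[OF g] by (intro module_homI) (auto simp: direct_sum_def)
  moreover have "bij_betw ?h (carrier M) (carrier (direct_sum ?A ?B))"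
  proof (rule bij_betwI')
    fix x y assume xy: "x \<in> carrier M" "y \<in> carrier M"
    have "e x \<oplus>\<^bsub>M\<^esub> g x = x" "e y \<oplus>\<^bsub>M\<^esub> g y = y"
      using canc[OF xy(1)] canc[OF xy(2)] by (simp_all only: g_def)
    then show "(?h x = ?h y) = (x = y)" by (metis prod.inject)
    show "?h x \<in> carrier (direct_sum ?A ?B)" using xy by (auto simp: direct_sum_def)
  next
    fix p assume "p \<in> carrier (direct_sum ?A ?B)"
    then obtain a b where ab: "a \<in> carrier M" "b \<in> carrier M" "p = (e a, g b)" by (auto simp: direct_sum_def)
    have c: "e a \<in> carrier M" "g b \<in> carrier M" using ab ec module_homD(1)[OF g] by auto
    have "e (e a \<oplus>\<^bsub>M\<^esub> g b) = e a" using module_homD(2)[OF e c] ee eg ab ec by simp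
    moreover have "g (e a) = \<zero>\<^bsub>M\<^esub>" "g (g b) = g b"
      using ee[OF ab(1)] eg[OF ab(2)] c
      by (simp_all add: g_def[of "e a"] g_def[of "g b"] a_minus_def M.r_neg)
    then have "g (e a \<oplus>\<^bsub>M\<^esub> g b) = g b" using module_homD(2)[OF g c] c by simp
    ultimately show "\<exists>x\<in>carrier M. p = ?h x" using ab c by (intro bexI[of _ "e a \<oplus>\<^bsub>M\<^esub> g b"]) auto
  qed
  ultimately have "mod_iso R M (direct_sum ?A ?B)" unfolding mod_iso_def by blast
  then have "zero_module ?A \<or> zero_module ?B" using ind AB unfolding indecomposable_def by blast
  then show ?thesis
  proof
    assume "zero_module ?A"
    then have z: "e x = \<zero>\<^bsub>M\<^esub>" if "x \<in> carrier M" for x using that by (auto simp: zero_module_def)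
    have "q' (x \<ominus>\<^bsub>M\<^esub> f x) = x" "q' x \<ominus>\<^bsub>M\<^esub> f (q' x) = x" if "x \<in> carrier M" for x
    proof -
      have "x \<ominus>\<^bsub>M\<^esub> e x = x" unfolding z[OF that] using that by (simp add: a_minus_def)
      then show "q' (x \<ominus>\<^bsub>M\<^esub> f x) = x" "q' x \<ominus>\<^bsub>M\<^esub> f (q' x) = x"
        using e1[OF that] e2[OF that] by (simp_all only:)
    qed
    then have "bij_betw (\<lambda>x. x \<ominus>\<^bsub>M\<^esub> f x) (carrier M) (carrier M)"
      using fc module_homD(1)[OF q'] by (intro bij_betw_byWitness[of _ q']) auto
    then show ?thesis ..
  next
    assume "zero_module ?B"
    then have z: "g x = \<zero>\<^bsub>M\<^esub>" if "x \<in> carrier M" for x using that by (auto simp: zero_module_def)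
    have "e x = x" if "x \<in> carrier M" for x
      using canc[OF that] z[OF that] that ec[OF that] by (simp add: g_def)
    then have "bij_betw f (carrier M) (carrier M)"
      using fc module_homD(1)[OF q] efq eqf by (intro bij_betw_byWitness[of _ q]) auto
    then show ?thesis ..
  qed
qed

section \<open>Quotients of representable functors\<close>

lemma HomI: "\<lbrakk>f \<in> module_hom R M N; f \<in> extensional (carrier M)\<rbrakk> \<Longrightarrow> f \<in> Hom R M N"
  by (simp add: Hom_def)

lemma Hom_restrict:
  assumes M: "module R M" and f: "f \<in> module_hom R M N"
  shows "restrict f (carrier M) \<in> Hom R M N"
proof -
  interpret M: module R M by (rule M)
  show ?thesis using module_homD[OF f] by (intro HomI module_homI) auto
qed

lemma Hom_module_hom: "f \<in> Hom R M N \<Longrightarrow> f \<in> module_hom R M N"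
  by (simp add: Hom_def)

lemmas HomD = module_homD[OF Hom_module_hom]

lemma Hom_eqI:
  "\<lbrakk>f \<in> Hom R M N; g \<in> Hom R M N; \<And>x. x \<in> carrier M \<Longrightarrow> f x = g x\<rbrakk> \<Longrightarrow> f = g"
  unfolding Hom_def by (auto intro: extensionalityI)

lemma Hom_compose:
  assumes L: "module R L" and f: "f \<in> Hom R L M" and g: "g \<in> Hom R M N"
  shows "compose (carrier L) g f \<in> Hom R L N"
proof -
  interpret L: module R L by (rule L)
  show ?thesis
    using HomD[OF f] HomD[OF g] by (intro HomI module_homI) (auto simp: compose_def)
qed

lemma Hom_id: "module R M \<Longrightarrow> (\<lambda>x\<in>carrier M. x) \<in> Hom R M M"
  by (rule Hom_restrict[OF _ module_hom_id])

lemma compose_Hom_assoc: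
  assumes "f \<in> Hom R K L"
  shows "compose (carrier K) h (compose (carrier K) g f) = compose (carrier K) (compose (carrier L) h g) f"
  using HomD(1)[OF assms] by (auto simp: compose_def fun_eq_iff)

lemma compose_Hom_id: "f \<in> Hom R M N \<Longrightarrow> compose (carrier M) f (\<lambda>x\<in>carrier M. x) = f"
  "f \<in> Hom R M N \<Longrightarrow> compose (carrier M) (\<lambda>x\<in>carrier N. x) f = f"
  using HomD(1)[of f R M N] by (auto simp: compose_def Hom_def extensional_def fun_eq_iff)

lemma hom_group_simps:
  "carrier (hom_group R M N) = Hom R M N"
  "f \<otimes>\<^bsub>hom_group R M N\<^esub> g = (\<lambda>x\<in>carrier M. f x \<oplus>\<^bsub>N\<^esub> g x)"
  "\<one>\<^bsub>hom_group R M N\<^esub> = (\<lambda>x\<in>carrier M. \<zero>\<^bsub>N\<^esub>)"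
  by (simp_all add: hom_group_def)

lemma hom_group_comm_group:
  assumes M: "module R M" and N: "module R N"
  shows "comm_group (hom_group R M N)"
proof -
  interpret M: module R M by (rule M)
  interpret N: module R N by (rule N)
  show ?thesis
  proof (rule comm_groupI)
    fix f g assume f: "f \<in> carrier (hom_group R M N)" and g: "g \<in> carrier (hom_group R M N)"
    note fD = HomD[OF f[unfolded hom_group_simps]] and gD = HomD[OF g[unfolded hom_group_simps]]
    show "f \<otimes>\<^bsub>hom_group R M N\<^esub> g \<in> carrier (hom_group R M N)"
      unfolding hom_group_simps
      by (intro Hom_restrict[OF M] module_homI) (auto simp: fD gD N.a_ac N.smult_r_distr)
    show "f \<otimes>\<^bsub>hom_group R M N\<^esub> g = g \<otimes>\<^bsub>hom_group R M N\<^esub> f"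
      unfolding hom_group_simps by (intro restrict_ext) (auto simp: fD gD N.a_comm)
    fix h assume h: "h \<in> carrier (hom_group R M N)"
    note hD = HomD[OF h[unfolded hom_group_simps]]
    show "f \<otimes>\<^bsub>hom_group R M N\<^esub> g \<otimes>\<^bsub>hom_group R M N\<^esub> h =
        f \<otimes>\<^bsub>hom_group R M N\<^esub> (g \<otimes>\<^bsub>hom_group R M N\<^esub> h)"
      unfolding hom_group_simps by (intro restrict_ext) (auto simp: fD gD hD N.a_assoc)
  next
    show "\<one>\<^bsub>hom_group R M N\<^esub> \<in> carrier (hom_group R M N)"
      unfolding hom_group_simps by (intro Hom_restrict[OF M] module_homI) auto
  next
    fix f assume f: "f \<in> carrier (hom_group R M N)"
    note fH = f[unfolded hom_group_simps]
    note fD = HomD[OF fH]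
    show "\<one>\<^bsub>hom_group R M N\<^esub> \<otimes>\<^bsub>hom_group R M N\<^esub> f = f"
      unfolding hom_group_simps
      by (intro Hom_eqI[OF Hom_restrict[OF M] fH] module_homI) (auto simp: fD)
    have "(\<lambda>x\<in>carrier M. \<ominus>\<^bsub>N\<^esub> f x) \<in> Hom R M N"
      by (intro Hom_restrict[OF M] module_homI) (auto simp: fD N.minus_add N.smult_r_minus)
    then show "\<exists>g\<in>carrier (hom_group R M N). g \<otimes>\<^bsub>hom_group R M N\<^esub> f = \<one>\<^bsub>hom_group R M N\<^esub>"
      unfolding hom_group_simps
      by (rule bexI[rotated]) (auto simp: fD N.l_neg fun_eq_iff)
  qed
qed

lemma hom_group_inv:
  assumes M: "module R M" and N: "module R N" and f: "f \<in> Hom R M N"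
  shows "inv\<^bsub>hom_group R M N\<^esub> f = (\<lambda>x\<in>carrier M. \<ominus>\<^bsub>N\<^esub> f x)"
proof -
  interpret M: module R M by (rule M)
  interpret N: module R N by (rule N)
  interpret G: comm_group "hom_group R M N" by (rule hom_group_comm_group[OF M N])
  note fD = HomD[OF f]
  have "(\<lambda>x\<in>carrier M. \<ominus>\<^bsub>N\<^esub> f x) \<in> Hom R M N"
    by (intro Hom_restrict[OF M] module_homI) (auto simp: fD N.minus_add N.smult_r_minus)
  moreover have "(\<lambda>x\<in>carrier M. \<ominus>\<^bsub>N\<^esub> f x) \<otimes>\<^bsub>hom_group R M N\<^esub> f = \<one>\<^bsub>hom_group R M N\<^esub>"
    by (auto simp: hom_group_simps fD N.l_neg fun_eq_iff)
  ultimately show ?thesis using f by (intro G.inv_equality) (auto simp: hom_group_simps)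
qed

lemma compose_mult_left:
  assumes f: "f \<in> Hom R U V"
  shows "compose (carrier U) (s \<otimes>\<^bsub>hom_group R V M\<^esub> t) f =
    compose (carrier U) s f \<otimes>\<^bsub>hom_group R U M\<^esub> compose (carrier U) t f"
  using HomD(1)[OF f] by (auto simp: hom_group_simps compose_def fun_eq_iff)

lemma compose_mult_right:
  assumes f: "f \<in> Hom R U V" "g \<in> Hom R U V" and s: "s \<in> Hom R V M"
  shows "compose (carrier U) s (f \<otimes>\<^bsub>hom_group R U V\<^esub> g) =
    compose (carrier U) s f \<otimes>\<^bsub>hom_group R U M\<^esub> compose (carrier U) s g"
  using HomD(1)[OF f(1)] HomD(1)[OF f(2)] HomD(2)[OF s]
  by (auto simp: hom_group_simps compose_def fun_eq_iff)

lemma free_homs_Hom: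
  assumes "module R M"
  shows "free_homs R M N \<subseteq> Hom R M N"
  using Hom_compose[OF assms] by (auto simp: free_homs_def)

lemma free_homs_compose_left:
  assumes R: "cring R" and U: "module R U" and p: "p \<in> free_homs R U V" and s: "s \<in> Hom R V M"
  shows "compose (carrier U) s p \<in> free_homs R U M"
proof -
  obtain f g n where fg: "f \<in> Hom R U (free_mod R n)" "g \<in> Hom R (free_mod R n) V" "p = compose (carrier U) g f"
    using p by (auto simp: free_homs_def)
  have "compose (carrier (free_mod R n)) s g \<in> Hom R (free_mod R n) M"
    using fg s free_mod_module[OF R] by (intro Hom_compose) auto
  then show ?thesis
    unfolding fg(3) compose_Hom_assoc[OF fg(1)] free_homs_def using fg(1) by blast
qed

lemma free_homs_compose_right:
  assumes U: "module R U" and p: "p \<in> free_homs R V M" and f: "f \<in> Hom R U V"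
  shows "compose (carrier U) p f \<in> free_homs R U M"
proof -
  obtain h g n where hg: "h \<in> Hom R V (free_mod R n)" "g \<in> Hom R (free_mod R n) M" "p = compose (carrier V) g h"
    using p by (auto simp: free_homs_def)
  have "compose (carrier U) h f \<in> Hom R U (free_mod R n)"
    using hg f by (intro Hom_compose[OF U])
  then show ?thesis
    unfolding hg(3) compose_Hom_assoc[OF f, symmetric] free_homs_def using hg(2) by blast
qed

text \<open>The functor Hom(-, M)/K. The union over all representatives copies the form of
  \<open>stable_comp\<close>, so that the represented functor is literally the case where K consists
  of the stably trivial maps.\<close>

definition hom_quot ::
  "('a, 'r) ring_scheme \<Rightarrow> ('a, 'm) module \<Rightarrow> (('a, 'm) module \<Rightarrow> ('m \<Rightarrow> 'm) set)
    \<Rightarrow> ('a, 'm, ('m \<Rightarrow> 'm) set) contra_functor" where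
  "hom_quot R M K =
    \<lparr>fobj = (\<lambda>U. hom_group R U M Mod K U),
     fmap = (\<lambda>U V \<phi> S. \<Union>s\<in>S. \<Union>f\<in>\<phi>. K U #>\<^bsub>hom_group R U M\<^esub> compose (carrier U) s f)\<rparr>"

lemma representable_eq_hom_quot: "representable R M = hom_quot R M (\<lambda>U. free_homs R U M)"
  by (simp add: representable_def hom_quot_def stable_hom_def stable_comp_def stable_class_def fun_eq_iff)

lemma stable_comp_eq_fmap: "stable_comp R U V M \<psi> \<phi> = fmap (representable R M) U V \<phi> \<psi>"
  by (simp add: representable_def)

lemma stable_hom_carrierE:
  assumes "\<phi> \<in> carrier (stable_hom R U V)"
  obtains f where "f \<in> Hom R U V" "\<phi> = stable_class R U V f"
  using assms by (auto simp: stable_hom_def FactGroup_def RCOSETS_def stable_class_def hom_group_simps)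

lemma stable_class_carrier: "f \<in> Hom R U V \<Longrightarrow> stable_class R U V f \<in> carrier (stable_hom R U V)"
  by (auto simp: stable_hom_def FactGroup_def RCOSETS_def stable_class_def hom_group_simps)

lemma coset_eq_iff:
  assumes G: "comm_group G" and K: "subgroup K G" and ab: "a \<in> carrier G" "b \<in> carrier G"
  shows "K #>\<^bsub>G\<^esub> a = K #>\<^bsub>G\<^esub> b \<longleftrightarrow> a \<otimes>\<^bsub>G\<^esub> inv\<^bsub>G\<^esub> b \<in> K"
proof -
  interpret comm_group G by (rule G)
  show ?thesis
    using repr_independence[OF _ ab(2) K, of a] rcos_self[OF ab(1) K] subgroup.rcos_module[OF K group_axioms ab(2,1)]
    by metis
qed

text \<open>\<open>free\<close> lets stable morphisms act on the quotient, and \<open>right\<close>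
  makes K a subfunctor. \<open>free_sub\<close> is an assumption because closure of the stably
  trivial maps under sums is obtained later, from free covers inside \<open>\<C>\<close>.\<close>

locale hom_subfunctor =
  fixes R :: "('a, 'r) ring_scheme" and \<C> :: "('a, 'm) module set" and M :: "('a, 'm) module"
    and K :: "('a, 'm) module \<Rightarrow> ('m \<Rightarrow> 'm) set"
  assumes R: "cring R" and modules: "U \<in> \<C> \<Longrightarrow> module R U" and M: "M \<in> \<C>"
    and free_sub: "\<lbrakk>U \<in> \<C>; V \<in> \<C>\<rbrakk> \<Longrightarrow> subgroup (free_homs R U V) (hom_group R U V)"
    and sub: "U \<in> \<C> \<Longrightarrow> subgroup (K U) (hom_group R U M)"
    and free: "U \<in> \<C> \<Longrightarrow> free_homs R U M \<subseteq> K U"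
    and right: "\<lbrakk>U \<in> \<C>; V \<in> \<C>; s \<in> K V; f \<in> Hom R U V\<rbrakk> \<Longrightarrow> compose (carrier U) s f \<in> K U"
begin

abbreviation "F \<equiv> hom_quot R M K"

definition cls :: "('a, 'm) module \<Rightarrow> ('m \<Rightarrow> 'm) \<Rightarrow> ('m \<Rightarrow> 'm) set" where
  "cls U s = K U #>\<^bsub>hom_group R U M\<^esub> s"

lemma grp: "\<lbrakk>U \<in> \<C>; V \<in> \<C>\<rbrakk> \<Longrightarrow> comm_group (hom_group R U V)"
  by (intro hom_group_comm_group modules)

lemma K_Hom: "\<lbrakk>U \<in> \<C>; s \<in> K U\<rbrakk> \<Longrightarrow> s \<in> Hom R U M"
  using subgroup.subset[OF sub, of U] by (auto simp: hom_group_simps)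

lemma fobjE:
  assumes "S \<in> carrier (fobj F U)"
  obtains s where "s \<in> Hom R U M" "S = cls U s"
  using assms by (auto simp: hom_quot_def FactGroup_def RCOSETS_def cls_def hom_group_simps)

lemma cls_carrier: "s \<in> Hom R U M \<Longrightarrow> cls U s \<in> carrier (fobj F U)"
  by (auto simp: hom_quot_def FactGroup_def RCOSETS_def cls_def hom_group_simps)

lemma cls_mult:
  assumes "U \<in> \<C>" "s \<in> Hom R U M" "t \<in> Hom R U M"
  shows "cls U s \<otimes>\<^bsub>fobj F U\<^esub> cls U t = cls U (s \<otimes>\<^bsub>hom_group R U M\<^esub> t)"
  using normal.rcos_sum[OF comm_group.subgroup_imp_normal[OF grp[OF assms(1) M] sub[OF assms(1)]]] assms
  by (simp add: hom_quot_def FactGroup_def cls_def hom_group_simps)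

lemma cls_eq_one_iff:
  assumes "U \<in> \<C>" "s \<in> Hom R U M"
  shows "cls U s = \<one>\<^bsub>fobj F U\<^esub> \<longleftrightarrow> s \<in> K U"
proof -
  interpret comm_group "hom_group R U M" by (rule grp[OF assms(1) M])
  have "s \<in> carrier (hom_group R U M)" using assms by (simp add: hom_group_simps)
  then show ?thesis
    using coset_join1[of "K U" s] coset_join2[of s "K U"] sub[OF assms(1)]
    by (auto simp: hom_quot_def FactGroup_def cls_def)
qed

text \<open>Independence of representatives: (k + s)(p + f) differs from s f by k (p + f), which
  lies in K by \<open>right\<close>, and by s p, which is stably trivial and so lies in K by
  \<open>free\<close>.\<close>

lemma fmap_cls:
  assumes U: "U \<in> \<C>" and V: "V \<in> \<C>" and f: "f \<in> Hom R U V" and s: "s \<in> Hom R V M"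
  shows "fmap F U V (stable_class R U V f) (cls V s) = cls U (compose (carrier U) s f)"
proof -
  interpret UV: comm_group "hom_group R U V" by (rule grp[OF U V])
  interpret VM: comm_group "hom_group R V M" by (rule grp[OF V M])
  interpret UM: comm_group "hom_group R U M" by (rule grp[OF U M])
  have sf: "compose (carrier U) s f \<in> Hom R U M" using Hom_compose[OF modules[OF U] f s] .
  have eq: "K U #>\<^bsub>hom_group R U M\<^esub> compose (carrier U) s' f' = cls U (compose (carrier U) s f)"
    if s': "s' \<in> cls V s" and f': "f' \<in> stable_class R U V f" for s' f'
  proof -
    obtain k where k: "k \<in> K V" "s' = k \<otimes>\<^bsub>hom_group R V M\<^esub> s"
      using s' by (auto simp: cls_def r_coset_def)
    obtain p where p: "p \<in> free_homs R U V" "f' = p \<otimes>\<^bsub>hom_group R U V\<^esub> f"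
      using f' by (auto simp: stable_class_def r_coset_def)
    have pH: "p \<in> Hom R U V" using free_homs_Hom[OF modules[OF U]] p(1) by blast
    have f'H: "f' \<in> Hom R U V"
      using UV.m_closed[of p f] pH f unfolding p(2) hom_group_simps(1) by blast
    let ?kf = "compose (carrier U) k f'" and ?sp = "compose (carrier U) s p"
    have kf: "?kf \<in> K U" using right[OF U V k(1) f'H] .
    have sp: "?sp \<in> K U" using free_homs_compose_left[OF R modules[OF U] p(1) s] free[OF U] by blast
    have "compose (carrier U) s' f' = ?kf \<otimes>\<^bsub>hom_group R U M\<^esub> compose (carrier U) s f'"
      unfolding k(2) by (rule compose_mult_left[OF f'H])
    also have "compose (carrier U) s f' = ?sp \<otimes>\<^bsub>hom_group R U M\<^esub> compose (carrier U) s f"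
      unfolding p(2) by (rule compose_mult_right[OF pH f s])
    also have "?kf \<otimes>\<^bsub>hom_group R U M\<^esub> (?sp \<otimes>\<^bsub>hom_group R U M\<^esub> compose (carrier U) s f) =
        (?kf \<otimes>\<^bsub>hom_group R U M\<^esub> ?sp) \<otimes>\<^bsub>hom_group R U M\<^esub> compose (carrier U) s f"
      using K_Hom[OF U kf] K_Hom[OF U sp] sf by (intro UM.m_assoc[symmetric]) (simp_all add: hom_group_simps(1))
    finally have "compose (carrier U) s' f' \<in> cls U (compose (carrier U) s f)"
      using subgroup.m_closed[OF sub[OF U] kf sp] by (auto simp: cls_def r_coset_def)
    then show ?thesis
      using UM.repr_independence[of "compose (carrier U) s' f'" "K U" "compose (carrier U) s f"] sf sub[OF U]
      by (simp add: cls_def hom_group_simps(1))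
  qed
  have "s \<in> cls V s" "f \<in> stable_class R U V f"
    using VM.rcos_self[OF _ sub[OF V], of s] UV.rcos_self[OF _ free_sub[OF U V], of f] s f
    by (simp_all add: cls_def stable_class_def hom_group_simps(1))
  then show ?thesis
    using eq by (auto simp: hom_quot_def)
qed

end

text \<open>With this instance the calculus of cosets also computes composition and addition in the
  stable category.\<close>

lemma (in hom_subfunctor) representable_subfunctor:
  assumes "N \<in> \<C>"
  shows "hom_subfunctor R \<C> N (\<lambda>U. free_homs R U N)"
  using R modules assms free_sub free_homs_compose_right[OF modules]
  by (intro hom_subfunctor.intro) auto

context hom_subfunctor
begin

lemma stable_comp_class:
  assumes "U \<in> \<C>" "V \<in> \<C>" "N \<in> \<C>" "f \<in> Hom R U V" "g \<in> Hom R V N"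
  shows "stable_comp R U V N (stable_class R V N g) (stable_class R U V f) =
    stable_class R U N (compose (carrier U) g f)"
  using hom_subfunctor.fmap_cls[OF representable_subfunctor[OF assms(3)] assms(1,2,4,5)]
  by (simp add: stable_comp_eq_fmap representable_eq_hom_quot stable_class_def
      hom_subfunctor.cls_def[OF representable_subfunctor[OF assms(3)]])

lemma stable_class_mult:
  assumes "U \<in> \<C>" "V \<in> \<C>" "f \<in> Hom R U V" "g \<in> Hom R U V"
  shows "stable_class R U V f \<otimes>\<^bsub>stable_hom R U V\<^esub> stable_class R U V g =
    stable_class R U V (f \<otimes>\<^bsub>hom_group R U V\<^esub> g)"
  using hom_subfunctor.cls_mult[OF representable_subfunctor[OF assms(2)] assms(1,3,4)]
  by (simp add: representable_eq_hom_quot[symmetric] representable_def stable_class_def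
      hom_subfunctor.cls_def[OF representable_subfunctor[OF assms(2)]])

lemma stable_class_eq_iff:
  assumes "U \<in> \<C>" "V \<in> \<C>" "f \<in> Hom R U V" "g \<in> Hom R U V"
  shows "stable_class R U V f = stable_class R U V g \<longleftrightarrow>
    f \<otimes>\<^bsub>hom_group R U V\<^esub> inv\<^bsub>hom_group R U V\<^esub> g \<in> free_homs R U V"
  unfolding stable_class_def
  using assms by (intro coset_eq_iff grp free_sub) (simp_all add: hom_group_simps)

lemma hom_mult_closed:
  assumes "U \<in> \<C>" "V \<in> \<C>" "f \<in> Hom R U V" "g \<in> Hom R U V"
  shows "f \<otimes>\<^bsub>hom_group R U V\<^esub> g \<in> Hom R U V"
proof -
  interpret comm_group "hom_group R U V" by (rule grp[OF assms(1,2)])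
  show ?thesis using m_closed[of f g] assms(3,4) by (simp only: hom_group_simps(1))
qed

lemma additive_functor_hom_quot: "additive_functor R \<C> F"
  unfolding additive_functor_def
proof (intro conjI ballI)
  fix U assume U: "U \<in> \<C>"
  show "comm_group (fobj F U)"
    using comm_group.abelian_FactGroup[OF grp[OF U M] sub[OF U]] by (simp add: hom_quot_def)
  fix S assume "S \<in> carrier (fobj F U)"
  then obtain s where s: "s \<in> Hom R U M" "S = cls U s" by (rule fobjE)
  show "fmap F U U (stable_id R U) S = S"
    unfolding s(2) stable_id_def
    by (simp add: fmap_cls[OF U U Hom_id[OF modules[OF U]] s(1)] compose_Hom_id[OF s(1)])
next
  fix U V \<phi> assume U: "U \<in> \<C>" and V: "V \<in> \<C>" and "\<phi> \<in> carrier (stable_hom R U V)"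
  then obtain f where f: "f \<in> Hom R U V" "\<phi> = stable_class R U V f" by (auto elim: stable_hom_carrierE)
  note comp = Hom_compose[OF modules[OF U] f(1)]
  show "fmap F U V \<phi> \<in> hom (fobj F V) (fobj F U)"
  proof (rule homI)
    fix S assume "S \<in> carrier (fobj F V)"
    then obtain s where s: "s \<in> Hom R V M" "S = cls V s" by (rule fobjE)
    show "fmap F U V \<phi> S \<in> carrier (fobj F U)"
      unfolding s(2) f(2) fmap_cls[OF U V f(1) s(1)] by (intro cls_carrier comp s)
    fix Y assume "Y \<in> carrier (fobj F V)"
    then obtain t where t: "t \<in> Hom R V M" "Y = cls V t" by (rule fobjE)
    show "fmap F U V \<phi> (S \<otimes>\<^bsub>fobj F V\<^esub> Y) = fmap F U V \<phi> S \<otimes>\<^bsub>fobj F U\<^esub> fmap F U V \<phi> Y"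
      unfolding s(2) t(2) f(2) cls_mult[OF V s(1) t(1)] fmap_cls[OF U V f(1) s(1)]
        fmap_cls[OF U V f(1) t(1)] cls_mult[OF U comp[OF s(1)] comp[OF t(1)]]
        fmap_cls[OF U V f(1) hom_mult_closed[OF V M s(1) t(1)]]
      by (simp add: compose_mult_left[OF f(1)])
  qed
  { fix W \<psi> S assume W: "W \<in> \<C>" and "\<psi> \<in> carrier (stable_hom R V W)" and "S \<in> carrier (fobj F W)"
    then obtain g s where g: "g \<in> Hom R V W" "\<psi> = stable_class R V W g"
      and s: "s \<in> Hom R W M" "S = cls W s" by (auto elim!: stable_hom_carrierE fobjE)
    show "fmap F U W (stable_comp R U V W \<psi> \<phi>) S = fmap F U V \<phi> (fmap F V W \<psi> S)"
      unfolding s(2) f(2) g(2) stable_comp_class[OF U V W f(1) g(1)]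
        fmap_cls[OF U W comp[OF g(1)] s(1)] fmap_cls[OF V W g(1) s(1)]
        fmap_cls[OF U V f(1) Hom_compose[OF modules[OF V] g(1) s(1)]]
      by (simp add: compose_Hom_assoc[OF f(1)]) }
  fix \<psi> S assume "\<psi> \<in> carrier (stable_hom R U V)" and "S \<in> carrier (fobj F V)"
  then obtain g s where g: "g \<in> Hom R U V" "\<psi> = stable_class R U V g"
    and s: "s \<in> Hom R V M" "S = cls V s" by (auto elim!: stable_hom_carrierE fobjE)
  show "fmap F U V (\<phi> \<otimes>\<^bsub>stable_hom R U V\<^esub> \<psi>) S =
      fmap F U V \<phi> S \<otimes>\<^bsub>fobj F U\<^esub> fmap F U V \<psi> S"
    unfolding s(2) f(2) g(2) stable_class_mult[OF U V f(1) g(1)]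
      fmap_cls[OF U V f(1) s(1)] fmap_cls[OF U V g(1) s(1)]
      fmap_cls[OF U V hom_mult_closed[OF U V f(1) g(1)] s(1)]
      cls_mult[OF U comp[OF s(1)] Hom_compose[OF modules[OF U] g(1) s(1)]]
      compose_mult_right[OF f(1) g(1) s(1)] ..
qed

text \<open>The presentation is Hom(-, W) -> Hom(-, M) -> F -> 0 modulo stably trivial maps: its
  first map is composition with w, whose image is the kernel K of the second.\<close>

lemma finitely_presented_hom_quot:
  assumes W: "W \<in> \<C>" and w: "w \<in> Hom R W M"
    and K: "\<And>U. U \<in> \<C> \<Longrightarrow> K U = (\<lambda>s. compose (carrier U) w s) ` Hom R U W"
  shows "finitely_presented R \<C> F"
proof -
  define \<eta> where "\<eta> U \<phi> = stable_comp R U W M (stable_class R W M w) \<phi>" for U :: "('a, 'm) module" and \<phi>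
  \<comment> \<open>A coset of the stably trivial maps is enlarged to a coset of K; all its members
    give the same one, so the union is that coset.\<close>
  define \<epsilon> where "\<epsilon> U S = (\<Union>s\<in>S. cls U s)" for U S
  have \<eta>: "\<eta> U (stable_class R U W t) = stable_class R U M (compose (carrier U) w t)"
    if "U \<in> \<C>" "t \<in> Hom R U W" for U t
    unfolding \<eta>_def by (rule stable_comp_class[OF that(1) W M that(2) w])
  have \<epsilon>: "\<epsilon> U (stable_class R U M s) = cls U s" if U: "U \<in> \<C>" and s: "s \<in> Hom R U M" for U s
  proof -
    interpret UM: comm_group "hom_group R U M" by (rule grp[OF U M])
    have eq: "cls U s' = cls U s" if "s' \<in> stable_class R U M s" for s'
    proof -
      have "s' \<in> cls U s" using that free[OF U] by (auto simp: stable_class_def cls_def r_coset_def)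
      then show ?thesis
        using UM.repr_independence[of s' "K U" s] s sub[OF U] by (simp add: cls_def hom_group_simps(1))
    qed
    have self: "s \<in> stable_class R U M s"
      using UM.rcos_self[OF _ free_sub[OF U M], of s] s by (simp add: stable_class_def hom_group_simps(1))
    have "\<epsilon> U (stable_class R U M s) = (\<Union>s'\<in>stable_class R U M s. cls U s)"
      unfolding \<epsilon>_def by (intro SUP_cong refl eq)
    then show ?thesis using self by auto
  qed
  have rep: "fobj (representable R N) U = stable_hom R U N" for N U :: "('a, 'm) module" by (simp add: representable_def)
  have fr: "fmap (representable R N) U V (stable_class R U V f) (stable_class R V N s) =
      stable_class R U N (compose (carrier U) s f)"
    if "N \<in> \<C>" "U \<in> \<C>" "V \<in> \<C>" "f \<in> Hom R U V" "s \<in> Hom R V N" for N U V f s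
    using stable_comp_class[OF that(2,3,1,4,5)] by (simp add: stable_comp_eq_fmap)
  have cw: "compose (carrier U) w t \<in> Hom R U M" if "U \<in> \<C>" "t \<in> Hom R U W" for U t
    using Hom_compose[OF modules[OF that(1)] that(2) w] .
  have 1: "nat_trans R \<C> (representable R W) (representable R M) \<eta>"
    unfolding nat_trans_def rep
  proof (intro conjI ballI)
    fix U assume U: "U \<in> \<C>"
    show "\<eta> U \<in> hom (stable_hom R U W) (stable_hom R U M)"
    proof (rule homI)
      fix S assume "S \<in> carrier (stable_hom R U W)"
      then obtain s where s: "s \<in> Hom R U W" "S = stable_class R U W s" by (rule stable_hom_carrierE)
      show "\<eta> U S \<in> carrier (stable_hom R U M)"
        unfolding s(2) \<eta>[OF U s(1)] by (intro stable_class_carrier cw U s)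
      fix Y assume "Y \<in> carrier (stable_hom R U W)"
      then obtain t where t: "t \<in> Hom R U W" "Y = stable_class R U W t" by (rule stable_hom_carrierE)
      show "\<eta> U (S \<otimes>\<^bsub>stable_hom R U W\<^esub> Y) = \<eta> U S \<otimes>\<^bsub>stable_hom R U M\<^esub> \<eta> U Y"
        unfolding s(2) t(2) stable_class_mult[OF U W s(1) t(1)] \<eta>[OF U s(1)] \<eta>[OF U t(1)]
          \<eta>[OF U hom_mult_closed[OF U W s(1) t(1)]] compose_mult_right[OF s(1) t(1) w]
          stable_class_mult[OF U M cw[OF U s(1)] cw[OF U t(1)]] ..
    qed
  next
    fix U V \<phi> S assume U: "U \<in> \<C>" and V: "V \<in> \<C>" and "\<phi> \<in> carrier (stable_hom R U V)"
      and "S \<in> carrier (stable_hom R V W)"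
    then obtain f t where f: "f \<in> Hom R U V" "\<phi> = stable_class R U V f"
      and t: "t \<in> Hom R V W" "S = stable_class R V W t" by (auto elim!: stable_hom_carrierE)
    show "\<eta> U (fmap (representable R W) U V \<phi> S) = fmap (representable R M) U V \<phi> (\<eta> V S)"
      unfolding f(2) t(2) fr[OF W U V f(1) t(1)] \<eta>[OF V t(1)] fr[OF M U V f(1) cw[OF V t(1)]]
        \<eta>[OF U Hom_compose[OF modules[OF U] f(1) t(1)]] compose_Hom_assoc[OF f(1)] ..
  qed
  have 2: "nat_trans R \<C> (representable R M) F \<epsilon>"
    unfolding nat_trans_def rep
  proof (intro conjI ballI)
    fix U assume U: "U \<in> \<C>"
    show "\<epsilon> U \<in> hom (stable_hom R U M) (fobj F U)"
    proof (rule homI)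
      fix S assume "S \<in> carrier (stable_hom R U M)"
      then obtain s where s: "s \<in> Hom R U M" "S = stable_class R U M s" by (rule stable_hom_carrierE)
      show "\<epsilon> U S \<in> carrier (fobj F U)"
        unfolding s(2) \<epsilon>[OF U s(1)] by (intro cls_carrier s)
      fix Y assume "Y \<in> carrier (stable_hom R U M)"
      then obtain t where t: "t \<in> Hom R U M" "Y = stable_class R U M t" by (rule stable_hom_carrierE)
      show "\<epsilon> U (S \<otimes>\<^bsub>stable_hom R U M\<^esub> Y) = \<epsilon> U S \<otimes>\<^bsub>fobj F U\<^esub> \<epsilon> U Y"
        unfolding s(2) t(2) stable_class_mult[OF U M s(1) t(1)] \<epsilon>[OF U s(1)] \<epsilon>[OF U t(1)]
          \<epsilon>[OF U hom_mult_closed[OF U M s(1) t(1)]] cls_mult[OF U s(1) t(1)] ..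
    qed
  next
    fix U V \<phi> S assume U: "U \<in> \<C>" and V: "V \<in> \<C>" and "\<phi> \<in> carrier (stable_hom R U V)"
      and "S \<in> carrier (stable_hom R V M)"
    then obtain f t where f: "f \<in> Hom R U V" "\<phi> = stable_class R U V f"
      and t: "t \<in> Hom R V M" "S = stable_class R V M t" by (auto elim!: stable_hom_carrierE)
    show "\<epsilon> U (fmap (representable R M) U V \<phi> S) = fmap F U V \<phi> (\<epsilon> V S)"
      unfolding f(2) t(2) fr[OF M U V f(1) t(1)] \<epsilon>[OF V t(1)] fmap_cls[OF U V f(1) t(1)]
        \<epsilon>[OF U Hom_compose[OF modules[OF U] f(1) t(1)]] ..
  qed
  have 3: "\<eta> U ` carrier (stable_hom R U W) = kernel (stable_hom R U M) (fobj F U) (\<epsilon> U)" if U: "U \<in> \<C>" for U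
  proof (intro equalityI subsetI)
    fix S assume "S \<in> \<eta> U ` carrier (stable_hom R U W)"
    then obtain t where t: "t \<in> Hom R U W" "S = \<eta> U (stable_class R U W t)" by (auto elim!: stable_hom_carrierE)
    have "compose (carrier U) w t \<in> K U" using t(1) K[OF U] by blast
    then show "S \<in> kernel (stable_hom R U M) (fobj F U) (\<epsilon> U)"
      unfolding t(2) \<eta>[OF U t(1)] kernel_def
      using cw[OF U t(1)] by (simp add: stable_class_carrier \<epsilon>[OF U] cls_eq_one_iff[OF U])
  next
    fix S assume "S \<in> kernel (stable_hom R U M) (fobj F U) (\<epsilon> U)"
    then obtain s where s: "s \<in> Hom R U M" "S = stable_class R U M s" "\<epsilon> U S = \<one>\<^bsub>fobj F U\<^esub>"
      by (auto simp: kernel_def elim!: stable_hom_carrierE)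
    then have "s \<in> K U" using \<epsilon>[OF U s(1)] cls_eq_one_iff[OF U s(1)] by simp
    then obtain t where t: "t \<in> Hom R U W" "s = compose (carrier U) w t" using K[OF U] by blast
    then have "S = \<eta> U (stable_class R U W t)" using \<eta>[OF U t(1)] s(2) by simp
    then show "S \<in> \<eta> U ` carrier (stable_hom R U W)" using stable_class_carrier[OF t(1)] by blast
  qed
  have 4: "\<epsilon> U ` carrier (stable_hom R U M) = carrier (fobj F U)" if U: "U \<in> \<C>" for U
  proof (intro equalityI subsetI)
    fix S assume "S \<in> \<epsilon> U ` carrier (stable_hom R U M)"
    then show "S \<in> carrier (fobj F U)" by (auto elim!: stable_hom_carrierE simp: \<epsilon>[OF U] cls_carrier)
  next
    fix S assume "S \<in> carrier (fobj F U)"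
    then obtain s where s: "s \<in> Hom R U M" "S = cls U s" by (rule fobjE)
    then have "S = \<epsilon> U (stable_class R U M s)" using \<epsilon>[OF U s(1)] by simp
    then show "S \<in> \<epsilon> U ` carrier (stable_hom R U M)" using stable_class_carrier[OF s(1)] by blast
  qed
  show ?thesis
    unfolding finitely_presented_def rep using 1 2 3 4
    by (intro bexI[OF _ M] bexI[OF _ W] exI[of _ \<eta>] exI[of _ \<epsilon>] conjI ballI) auto
qed

lemma vanishes_hom_quot_iff:
  assumes U: "U \<in> \<C>"
  shows "vanishes F U \<longleftrightarrow> Hom R U M \<subseteq> K U"
proof -
  interpret FU: comm_group "fobj F U"
    using additive_functor_hom_quot U unfolding additive_functor_def by blast
  have car: "carrier (fobj F U) = cls U ` Hom R U M"
  proof (intro equalityI subsetI)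
    show "S \<in> cls U ` Hom R U M" if "S \<in> carrier (fobj F U)" for S
      using that by (rule fobjE) blast
  qed (auto simp: cls_carrier)
  have "vanishes F U \<longleftrightarrow> (\<forall>s\<in>Hom R U M. cls U s = \<one>\<^bsub>fobj F U\<^esub>)"
    unfolding vanishes_def car using FU.one_closed unfolding car by blast
  also have "\<dots> \<longleftrightarrow> Hom R U M \<subseteq> K U" using cls_eq_one_iff[OF U] by blast
  finally show ?thesis .
qed

end

section \<open>Free covers and presentations\<close>

lemma free_mod_hom:
  assumes W: "module R W" and y: "y \<in> {..<n} \<rightarrow> carrier W"
  shows "(\<lambda>v. \<Oplus>\<^bsub>W\<^esub>i\<in>{..<n}. v i \<odot>\<^bsub>W\<^esub> y i) \<in> module_hom R (free_mod R n) W"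
proof -
  interpret W: module R W by (rule W)
  note F = free_mod_simps[OF W.is_cring, of n]
  show ?thesis
  proof (rule module_homI)
    fix v assume v: "v \<in> carrier (free_mod R n)"
    then have vc: "v i \<in> carrier R" if "i < n" for i using that by (auto simp: F)
    show "(\<Oplus>\<^bsub>W\<^esub>i\<in>{..<n}. v i \<odot>\<^bsub>W\<^esub> y i) \<in> carrier W"
      using vc y by (intro W.finsum_closed) auto
    { fix w assume w: "w \<in> carrier (free_mod R n)"
      then have wc: "w i \<in> carrier R" if "i < n" for i using that by (auto simp: F)
      have "(\<Oplus>\<^bsub>W\<^esub>i\<in>{..<n}. (v \<oplus>\<^bsub>free_mod R n\<^esub> w) i \<odot>\<^bsub>W\<^esub> y i) =
          (\<Oplus>\<^bsub>W\<^esub>i\<in>{..<n}. v i \<odot>\<^bsub>W\<^esub> y i \<oplus>\<^bsub>W\<^esub> w i \<odot>\<^bsub>W\<^esub> y i)"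
        using vc wc y by (intro W.finsum_cong') (auto simp: F W.smult_l_distr Pi_iff)
      also have "\<dots> = (\<Oplus>\<^bsub>W\<^esub>i\<in>{..<n}. v i \<odot>\<^bsub>W\<^esub> y i) \<oplus>\<^bsub>W\<^esub> (\<Oplus>\<^bsub>W\<^esub>i\<in>{..<n}. w i \<odot>\<^bsub>W\<^esub> y i)"
        using vc wc y by (intro W.finsum_addf) (auto simp: Pi_iff)
      finally show "(\<Oplus>\<^bsub>W\<^esub>i\<in>{..<n}. (v \<oplus>\<^bsub>free_mod R n\<^esub> w) i \<odot>\<^bsub>W\<^esub> y i) =
          (\<Oplus>\<^bsub>W\<^esub>i\<in>{..<n}. v i \<odot>\<^bsub>W\<^esub> y i) \<oplus>\<^bsub>W\<^esub> (\<Oplus>\<^bsub>W\<^esub>i\<in>{..<n}. w i \<odot>\<^bsub>W\<^esub> y i)" . }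
    fix r assume r: "r \<in> carrier R"
    note scal = module_hom_scale[OF W r]
    have "(\<Oplus>\<^bsub>W\<^esub>i\<in>{..<n}. (r \<odot>\<^bsub>free_mod R n\<^esub> v) i \<odot>\<^bsub>W\<^esub> y i) =
        (\<Oplus>\<^bsub>W\<^esub>i\<in>{..<n}. r \<odot>\<^bsub>W\<^esub> (v i \<odot>\<^bsub>W\<^esub> y i))"
      using r vc y by (intro W.finsum_cong') (auto simp: F W.smult_assoc1 Pi_iff)
    also have "\<dots> = r \<odot>\<^bsub>W\<^esub> (\<Oplus>\<^bsub>W\<^esub>i\<in>{..<n}. v i \<odot>\<^bsub>W\<^esub> y i)"
      using vc y by (intro module_hom_finsum[OF W W scal, symmetric]) (auto simp: Pi_iff)
    finally show "(\<Oplus>\<^bsub>W\<^esub>i\<in>{..<n}. (r \<odot>\<^bsub>free_mod R n\<^esub> v) i \<odot>\<^bsub>W\<^esub> y i) =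
        r \<odot>\<^bsub>W\<^esub> (\<Oplus>\<^bsub>W\<^esub>i\<in>{..<n}. v i \<odot>\<^bsub>W\<^esub> y i)" .
  qed
qed

text \<open>Projectivity of free modules: preimages under w of the images of the basis vectors
  determine the lift.\<close>

lemma free_mod_lift:
  assumes W: "module R W" and N: "module R N" and g: "g \<in> Hom R (free_mod R n) N"
    and w: "w \<in> Hom R W N" "w ` carrier W = carrier N"
  shows "\<exists>t \<in> Hom R (free_mod R n) W. compose (carrier (free_mod R n)) w t = g"
proof -
  interpret W: module R W by (rule W)
  interpret N: module R N by (rule N)
  have R: "cring R" by (rule W.is_cring)
  interpret F: module R "free_mod R n" by (rule free_mod_module[OF R])
  note uc = free_unit_carrier[OF R, of n]
  have "\<exists>y \<in> carrier W. w y = g (free_unit R n i)" for i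
    using HomD(1)[OF g uc, of i] w(2) by (metis imageE)
  then obtain y where y: "\<And>i. y i \<in> carrier W" "\<And>i. w (y i) = g (free_unit R n i)" by metis
  let ?t = "\<lambda>v. \<Oplus>\<^bsub>W\<^esub>i\<in>{..<n}. v i \<odot>\<^bsub>W\<^esub> y i"
  have t: "?t \<in> module_hom R (free_mod R n) W" using y by (intro free_mod_hom[OF W]) auto
  have eq: "w (?t v) = g v" if v: "v \<in> carrier (free_mod R n)" for v
  proof -
    have vc: "v i \<in> carrier R" if "i < n" for i using v that by (auto simp: free_mod_simps[OF R])
    have "w (?t v) = (\<Oplus>\<^bsub>N\<^esub>i\<in>{..<n}. w (v i \<odot>\<^bsub>W\<^esub> y i))"
      using vc y by (intro module_hom_finsum[OF W N Hom_module_hom[OF w(1)]]) auto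
    also have "\<dots> = (\<Oplus>\<^bsub>N\<^esub>i\<in>{..<n}. g (v i \<odot>\<^bsub>free_mod R n\<^esub> free_unit R n i))"
      using vc y HomD(1)[OF g] uc
      by (intro N.finsum_cong') (auto simp: HomD(3)[OF w(1)] HomD(3)[OF g])
    also have "\<dots> = g (\<Oplus>\<^bsub>free_mod R n\<^esub>i\<in>{..<n}. v i \<odot>\<^bsub>free_mod R n\<^esub> free_unit R n i)"
      using vc uc by (intro module_hom_finsum[OF F.module_axioms N Hom_module_hom[OF g], symmetric]) auto
    finally show ?thesis by (simp add: free_mod_expand[OF R v])
  qed
  show ?thesis
  proof (rule bexI[OF _ Hom_restrict[OF F.module_axioms t]])
    show "compose (carrier (free_mod R n)) w (restrict ?t (carrier (free_mod R n))) = g"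
      using eq g by (auto simp: compose_def fun_eq_iff Hom_def extensional_def)
  qed
qed

lemma fg_modules_free_cover:
  assumes "N \<in> fg_modules R"
  shows "\<exists>n. \<exists>g \<in> Hom R (free_mod R n) N. g ` carrier (free_mod R n) = carrier N"
proof -
  obtain S where N: "module R N" and S: "finite S" "S \<subseteq> carrier N"
    and gen: "\<And>x. x \<in> carrier N \<Longrightarrow> \<exists>a \<in> S \<rightarrow> carrier R. x = (\<Oplus>\<^bsub>N\<^esub>v\<in>S. a v \<odot>\<^bsub>N\<^esub> v)"
    using fg_modulesE[OF assms] by blast
  interpret N: module R N by (rule N)
  have R: "cring R" by (rule N.is_cring)
  obtain h where h: "bij_betw h {..<card S} S"
    using ex_bij_betw_nat_finite[OF S(1)] by (auto simp: lessThan_atLeast0)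
  have hS: "h i \<in> S" if "i < card S" for i using h that by (auto simp: bij_betw_def)
  let ?n = "card S"
  let ?g = "\<lambda>v. \<Oplus>\<^bsub>N\<^esub>i\<in>{..<?n}. v i \<odot>\<^bsub>N\<^esub> h i"
  have g: "?g \<in> module_hom R (free_mod R ?n) N"
    using hS S(2) by (intro free_mod_hom[OF N]) auto
  have "x \<in> ?g ` carrier (free_mod R ?n)" if x: "x \<in> carrier N" for x
  proof -
    obtain a where a: "a \<in> S \<rightarrow> carrier R" "x = (\<Oplus>\<^bsub>N\<^esub>v\<in>S. a v \<odot>\<^bsub>N\<^esub> v)" using gen[OF x] by blast
    have "x = (\<Oplus>\<^bsub>N\<^esub>v\<in>h ` {..<?n}. a v \<odot>\<^bsub>N\<^esub> v)" using a(2) h by (simp add: bij_betw_def)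
    also have "\<dots> = (\<Oplus>\<^bsub>N\<^esub>i\<in>{..<?n}. a (h i) \<odot>\<^bsub>N\<^esub> h i)"
      using a(1) h hS S(2) by (intro N.finsum_reindex) (auto simp: bij_betw_def)
    also have "\<dots> = ?g (\<lambda>i\<in>{..<?n}. a (h i))"
      using a(1) hS S(2) by (intro N.finsum_cong') (auto simp: Pi_iff subset_iff)
    finally have "x = ?g (\<lambda>i\<in>{..<?n}. a (h i))" .
    moreover have "(\<lambda>i\<in>{..<?n}. a (h i)) \<in> carrier (free_mod R ?n)"
      using a(1) hS by (auto simp: free_mod_simps[OF R])
    ultimately show ?thesis by blast
  qed
  then have "restrict ?g (carrier (free_mod R ?n)) ` carrier (free_mod R ?n) = carrier N"
    using module_homD(1)[OF g] by auto
  then show ?thesis using Hom_restrict[OF free_mod_module[OF R] g] by blast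
qed

lemma free_mod_fg:
  assumes R: "cring R"
  shows "free_mod R n \<in> fg_modules R"
proof -
  interpret F: module R "free_mod R n" by (rule free_mod_module[OF R])
  let ?S = "free_unit R n ` {..<n}"
  have S: "?S \<subseteq> carrier (free_mod R n)" using free_unit_carrier[OF R] by auto
  have sub: "submodule R (F.span ?S) (free_mod R n)" using S by (rule F.span_is_submodule)
  have "v \<in> F.span ?S" if v: "v \<in> carrier (free_mod R n)" for v
  proof -
    have vc: "v i \<in> carrier R" if "i < n" for i using v that by (auto simp: free_mod_simps[OF R])
    have "(\<Oplus>\<^bsub>free_mod R n\<^esub>i\<in>{..<n}. v i \<odot>\<^bsub>free_mod R n\<^esub> free_unit R n i) \<in> F.span ?S"
    proof (rule F.finsum_mem)
      fix i assume "i \<in> {..<n}"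
      then show "v i \<odot>\<^bsub>free_mod R n\<^esub> free_unit R n i \<in> F.span ?S"
        using vc F.in_own_span[OF S] by (intro submodule.smult_closed[OF sub]) auto
    qed (simp_all add: submodule.subset[OF sub] submodule.zero_closed[OF sub] submodule.m_closed[OF sub])
    then show ?thesis by (simp add: free_mod_expand[OF R v])
  qed
  then have "F.span ?S = carrier (free_mod R n)" using submodule.subset[OF sub] by blast
  then show ?thesis using F.module_axioms S unfolding fg_modules_def by blast
qed

text \<open>The image of Hom(-, w) inside Hom(-, M). In this form the module W can serve as the
  second object in a presentation of the quotient functor.\<close>

definition image_homs ::
  "('a, 'r) ring_scheme \<Rightarrow> ('a, 'u) module \<Rightarrow> ('a, 'w) module \<Rightarrow> ('w \<Rightarrow> 'm) \<Rightarrow> ('u \<Rightarrow> 'm) set" where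
  "image_homs R U W w = (\<lambda>s. compose (carrier U) w s) ` Hom R U W"

lemma image_homs_iff:
  assumes U: "module R U" and w: "w \<in> Hom R W M" and s: "s \<in> Hom R U M"
  shows "s \<in> image_homs R U W w \<longleftrightarrow> (\<exists>t \<in> Hom R U W. \<forall>x \<in> carrier U. s x = w (t x))"
proof
  assume "\<exists>t \<in> Hom R U W. \<forall>x \<in> carrier U. s x = w (t x)"
  then obtain t where t: "t \<in> Hom R U W" "\<forall>x \<in> carrier U. s x = w (t x)" by blast
  then have "s = compose (carrier U) w t"
    using Hom_compose[OF U t(1) w] s by (intro Hom_eqI) (auto simp: compose_def)
  then show "s \<in> image_homs R U W w" using t(1) by (auto simp: image_homs_def)
qed (auto simp: image_homs_def compose_def)

lemma image_homs_Hom: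
  "\<lbrakk>module R U; w \<in> Hom R W M\<rbrakk> \<Longrightarrow> image_homs R U W w \<subseteq> Hom R U M"
  using Hom_compose by (auto simp: image_homs_def)

lemma image_homs_subgroup:
  assumes U: "module R U" and W: "module R W" and M: "module R M" and w: "w \<in> Hom R W M"
  shows "subgroup (image_homs R U W w) (hom_group R U M)"
proof -
  interpret UM: comm_group "hom_group R U M" by (rule hom_group_comm_group[OF U M])
  interpret UW: comm_group "hom_group R U W" by (rule hom_group_comm_group[OF U W])
  interpret h: group_hom "hom_group R U W" "hom_group R U M" "\<lambda>s. compose (carrier U) w s"
    using Hom_compose[OF U _ w] compose_mult_right[OF _ _ w]
    by unfold_locales (auto simp: hom_def hom_group_simps(1))
  show ?thesis using h.img_is_subgroup by (simp add: image_homs_def hom_group_simps(1))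
qed

lemma image_homs_right:
  assumes U: "module R U" and s: "s \<in> image_homs R V W w" and f: "f \<in> Hom R U V"
  shows "compose (carrier U) s f \<in> image_homs R U W w"
proof -
  obtain t where t: "t \<in> Hom R V W" "s = compose (carrier V) w t" using s by (auto simp: image_homs_def)
  have "compose (carrier U) s f = compose (carrier U) w (compose (carrier U) t f)"
    unfolding t(2) by (rule compose_Hom_assoc[OF f, symmetric])
  then show ?thesis using Hom_compose[OF U f t(1)] by (auto simp: image_homs_def)
qed

text \<open>A map out of a free module lifts along the surjection w, so whatever factors through a
  free module also factors through w.\<close>

lemma free_homs_subset_image_homs:
  assumes W: "module R W" and M: "module R M"
    and w: "w \<in> Hom R W M" "w ` carrier W = carrier M" and U: "module R U"
  shows "free_homs R U M \<subseteq> image_homs R U W w"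
proof
  fix p assume "p \<in> free_homs R U M"
  then obtain f g n where fg: "f \<in> Hom R U (free_mod R n)" "g \<in> Hom R (free_mod R n) M"
      "p = compose (carrier U) g f" by (auto simp: free_homs_def)
  obtain t where t: "t \<in> Hom R (free_mod R n) W" "compose (carrier (free_mod R n)) w t = g"
    using free_mod_lift[OF W M fg(2) w] by blast
  have "p = compose (carrier U) w (compose (carrier U) t f)"
    unfolding fg(3) t(2)[symmetric] by (rule compose_Hom_assoc[OF fg(1), symmetric])
  then show "p \<in> image_homs R U W w" using Hom_compose[OF U fg(1) t(1)] by (auto simp: image_homs_def)
qed

section \<open>Constructions inside the subcategory: covers, sums and pullbacks\<close>

locale stable_setting = complete_noetherian_local_ring R \<mm>
  for R (structure) and \<mm> +
  fixes \<C> :: "'a rmodule set"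
  assumes C_additive: "additive_subcategory R \<C>" and C_free: "contains_free R \<C>" and C_ker: "closed_under_epi_kernels R \<C>"
begin

lemma C_fg: "M \<in> \<C> \<Longrightarrow> M \<in> fg_modules R"
  using C_additive by (auto simp: additive_subcategory_def)

lemma C_module: "M \<in> \<C> \<Longrightarrow> module R M"
  using C_fg fg_modules_module by blast

lemma free_cover:
  assumes M: "M \<in> \<C>"
  shows "\<exists>P \<in> \<C>. \<exists>\<pi> \<in> Hom R P M. \<pi> ` carrier P = carrier M \<and> is_free R P"
proof -
  obtain n g where g: "g \<in> Hom R (free_mod R n) M" "g ` carrier (free_mod R n) = carrier M"
    using fg_modules_free_cover[OF C_fg[OF M]] by blast
  have Fm: "module R (free_mod R n)" by (rule free_mod_module[OF is_cring])
  \<comment> \<open>\<open>free_mod R n\<close> has elements of another type and cannot belong to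
    \<open>\<C>\<close>; an isomorphic copy of the right type takes its place.\<close>
  obtain P :: "'a rmodule" where P: "P \<in> fg_modules R" "mod_iso R (free_mod R n) P"
    using fg_modules_universal[OF free_mod_fg[OF is_cring]] by blast
  have isoP: "mod_iso R P (free_mod R n)" by (rule mod_iso_sym[OF Fm P(2)])
  then have free: "is_free R P" by (auto simp: is_free_def)
  have PC: "P \<in> \<C>" using C_free P(1) free by (auto simp: contains_free_def)
  obtain f where f: "f \<in> module_hom R P (free_mod R n)" "bij_betw f (carrier P) (carrier (free_mod R n))"
    using isoP by (auto simp: mod_iso_def)
  have "restrict (\<lambda>x. g (f x)) (carrier P) \<in> Hom R P M"
    by (rule Hom_restrict[OF C_module[OF PC] module_hom_comp[OF f(1) Hom_module_hom[OF g(1)]]])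
  moreover have "restrict (\<lambda>x. g (f x)) (carrier P) ` carrier P = carrier M"
  proof -
    have "(\<lambda>x. g (f x)) ` carrier P = g ` f ` carrier P" by (simp add: image_image)
    then show ?thesis using f(2) g(2) by (simp add: bij_betw_def)
  qed
  ultimately show ?thesis using PC free by blast
qed

text \<open>The detour over \<open>free_mod R n\<close> goes along an isomorphism with P, because
  \<open>free_homs\<close> refers to the standard free modules only.\<close>

lemma image_homs_free:
  assumes P: "P \<in> \<C>" "is_free R P" and \<pi>: "\<pi> \<in> Hom R P M" and U: "module R U"
  shows "image_homs R U P \<pi> \<subseteq> free_homs R U M"
proof
  fix p assume "p \<in> image_homs R U P \<pi>"
  then obtain s where s: "s \<in> Hom R U P" "p = compose (carrier U) \<pi> s" by (auto simp: image_homs_def)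
  interpret U: module R U by (rule U)
  obtain n f where f: "f \<in> module_hom R P (free_mod R n)" "bij_betw f (carrier P) (carrier (free_mod R n))"
    using P(2) by (auto simp: is_free_def mod_iso_def)
  obtain g where g: "g \<in> module_hom R (free_mod R n) P" "\<And>x. x \<in> carrier P \<Longrightarrow> g (f x) = x"
    by (rule module_hom_inverse[OF C_module[OF P(1)] f]) (rule that, assumption, assumption)
  let ?a = "restrict (\<lambda>x. f (s x)) (carrier U)"
  let ?b = "restrict (\<lambda>v. \<pi> (g v)) (carrier (free_mod R n))"
  have "?a \<in> Hom R U (free_mod R n)"
    by (rule Hom_restrict[OF U module_hom_comp[OF Hom_module_hom[OF s(1)] f(1)]])
  moreover have "?b \<in> Hom R (free_mod R n) M"
    by (rule Hom_restrict[OF free_mod_module[OF is_cring] module_hom_comp[OF g(1) Hom_module_hom[OF \<pi>]]])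
  moreover have "p = compose (carrier U) ?b ?a"
    unfolding s(2) using HomD(1)[OF s(1)] module_homD(1)[OF f(1)] g(2) by (auto simp: compose_def fun_eq_iff)
  ultimately show "p \<in> free_homs R U M" unfolding free_homs_def by blast
qed

text \<open>One cover serves all U at once. Stable equality of two maps into M thus becomes an
  equation with a single unknown map into P.\<close>

lemma free_homs_eq_image_homs:
  assumes M: "M \<in> \<C>"
  shows "\<exists>P \<in> \<C>. \<exists>\<pi> \<in> Hom R P M. \<pi> ` carrier P = carrier M \<and> is_free R P \<and>
    (\<forall>U \<in> \<C>. free_homs R U M = image_homs R U P \<pi>)"
proof -
  obtain P \<pi> where P: "P \<in> \<C>" "\<pi> \<in> Hom R P M" "\<pi> ` carrier P = carrier M" "is_free R P"
    using free_cover[OF M] by blast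
  have "free_homs R U M = image_homs R U P \<pi>" if "U \<in> \<C>" for U
    using free_homs_subset_image_homs[OF C_module[OF P(1)] C_module[OF M] P(2,3) C_module[OF that]]
      image_homs_free[OF P(1,4,2) C_module[OF that]] by blast
  then show ?thesis using P by blast
qed

text \<open>Two stably trivial maps may factor through different free modules; the fixed cover of V
  makes them summable without changing the module.\<close>

lemma free_homs_subgroup:
  assumes "U \<in> \<C>" "V \<in> \<C>"
  shows "subgroup (free_homs R U V) (hom_group R U V)"
proof -
  obtain P \<pi> where "P \<in> \<C>" "\<pi> \<in> Hom R P V" "free_homs R U V = image_homs R U P \<pi>"
    using free_homs_eq_image_homs[OF assms(2)] assms(1) by blast
  then show ?thesis using image_homs_subgroup C_module assms by metis
qed

lemma hom_subfunctor_image_homs: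
  assumes M: "M \<in> \<C>" and W: "W \<in> \<C>" and w: "w \<in> Hom R W M" "w ` carrier W = carrier M"
  shows "hom_subfunctor R \<C> M (\<lambda>U. image_homs R U W w)"
  using is_cring C_module M free_homs_subgroup
    image_homs_subgroup[OF C_module C_module[OF W] C_module[OF M] w(1)]
    free_homs_subset_image_homs[OF C_module[OF W] C_module[OF M] w C_module]
    image_homs_right[OF C_module]
  by (intro hom_subfunctor.intro) auto

lemma hom_quot_image_homs_mod_stable:
  assumes "M \<in> \<C>" "W \<in> \<C>" "w \<in> Hom R W M" "w ` carrier W = carrier M"
  shows "hom_quot R M (\<lambda>U. image_homs R U W w) \<in> mod_stable R \<C>"
    and "U \<in> \<C> \<Longrightarrow> vanishes (hom_quot R M (\<lambda>U. image_homs R U W w)) U \<longleftrightarrow>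
      Hom R U M \<subseteq> image_homs R U W w"
proof -
  interpret hom_subfunctor R \<C> M "\<lambda>U. image_homs R U W w"
    using hom_subfunctor_image_homs[OF assms] .
  show "hom_quot R M (\<lambda>U. image_homs R U W w) \<in> mod_stable R \<C>"
    using additive_functor_hom_quot finitely_presented_hom_quot[OF assms(2,3)]
    by (simp add: mod_stable_def image_homs_def)
  show "vanishes (hom_quot R M (\<lambda>U. image_homs R U W w)) U \<longleftrightarrow>
      Hom R U M \<subseteq> image_homs R U W w" if "U \<in> \<C>"
    using vanishes_hom_quot_iff[OF that] .
qed

text \<open>\<open>direct_sum\<close> consists of pairs and so leaves the type of
  \<open>\<C>\<close>. Only the two projections and their joint bijectivity are retained, which is
  all that later arguments use.\<close>

lemma biproduct:
  assumes "A \<in> \<C>" "B \<in> \<C>"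
  shows "\<exists>S \<in> \<C>. \<exists>p \<in> module_hom R S A. \<exists>q \<in> module_hom R S B.
    bij_betw (\<lambda>x. (p x, q x)) (carrier S) (carrier A \<times> carrier B)"
proof -
  obtain S f where S: "S \<in> \<C>" "f \<in> module_hom R S (direct_sum A B)"
      "bij_betw f (carrier S) (carrier (direct_sum A B))"
    using C_additive assms unfolding additive_subcategory_def mod_iso_def by blast
  have "fst \<in> module_hom R (direct_sum A B) A" "snd \<in> module_hom R (direct_sum A B) B"
    by (rule module_homI; auto simp: direct_sum_def)+
  then have "(\<lambda>x. fst (f x)) \<in> module_hom R S A" "(\<lambda>x. snd (f x)) \<in> module_hom R S B"
    using module_hom_comp[OF S(2)] by auto
  moreover have "bij_betw (\<lambda>x. (fst (f x), snd (f x))) (carrier S) (carrier A \<times> carrier B)"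
    using S(3) by (simp add: direct_sum_def)
  ultimately show ?thesis
    by (intro bexI[OF _ S(1)] bexI[of _ "\<lambda>x. fst (f x)"] bexI[of _ "\<lambda>x. snd (f x)"])
qed

text \<open>The universal property of the product; linearity of the pairing follows from joint
  injectivity of the projections.\<close>

lemma biproduct_pairing:
  assumes S: "module R S" and U: "module R U" and p: "p \<in> module_hom R S A" and q: "q \<in> module_hom R S B"
    and bij: "bij_betw (\<lambda>x. (p x, q x)) (carrier S) (carrier A \<times> carrier B)"
    and s: "s \<in> module_hom R U A" and t: "t \<in> module_hom R U B"
  shows "\<exists>r \<in> Hom R U S. \<forall>x \<in> carrier U. p (r x) = s x \<and> q (r x) = t x"
proof -
  interpret S: module R S by (rule S)
  interpret U: module R U by (rule U)
  note pD = module_homD[OF p] and qD = module_homD[OF q] and sD = module_homD[OF s] and tD = module_homD[OF t]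
  have "\<exists>y \<in> carrier S. p y = s x \<and> q y = t x" if "x \<in> carrier U" for x
  proof -
    have "(s x, t x) \<in> (\<lambda>x. (p x, q x)) ` carrier S"
      using bij sD(1)[OF that] tD(1)[OF that] by (simp add: bij_betw_def)
    then show ?thesis by auto
  qed
  then obtain r where r: "\<And>x. x \<in> carrier U \<Longrightarrow> r x \<in> carrier S"
      "\<And>x. x \<in> carrier U \<Longrightarrow> p (r x) = s x" "\<And>x. x \<in> carrier U \<Longrightarrow> q (r x) = t x" by metis
  have inj: "y = z" if "y \<in> carrier S" "z \<in> carrier S" "p y = p z" "q y = q z" for y z
    using inj_onD[OF bij_betw_imp_inj_on[OF bij], of y z] that by simp
  have "r \<in> module_hom R U S"
  proof (rule module_homI)
    fix x y assume xy: "x \<in> carrier U" "y \<in> carrier U"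
    show "r (x \<oplus>\<^bsub>U\<^esub> y) = r x \<oplus>\<^bsub>S\<^esub> r y"
      using xy by (intro inj) (simp_all add: r pD qD sD tD)
  next
    fix c x assume cx: "c \<in> carrier R" "x \<in> carrier U"
    show "r (c \<odot>\<^bsub>U\<^esub> x) = c \<odot>\<^bsub>S\<^esub> r x"
      using cx by (intro inj) (simp_all add: r pD qD sD tD)
  qed (rule r(1))
  then show ?thesis using Hom_restrict[OF U] r(2,3) by (intro bexI[of _ "restrict r (carrier U)"]) auto
qed

text \<open>W is the direct sum of W1 and W2, and w adds the values of w1 and w2. It is onto because
  the elements (y, 0) already reach all of M through w1.\<close>

lemma image_homs_sum:
  assumes M: "M \<in> \<C>" and W1: "W1 \<in> \<C>" and W2: "W2 \<in> \<C>"
    and w1: "w1 \<in> Hom R W1 M" "w1 ` carrier W1 = carrier M" and w2: "w2 \<in> Hom R W2 M"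
  shows "\<exists>W \<in> \<C>. \<exists>w \<in> Hom R W M. w ` carrier W = carrier M \<and>
    (\<forall>U \<in> \<C>. \<forall>s \<in> Hom R U M. s \<in> image_homs R U W w \<longleftrightarrow>
      (\<exists>s1 \<in> image_homs R U W1 w1. \<exists>s2 \<in> image_homs R U W2 w2. \<forall>x \<in> carrier U. s x = s1 x \<oplus>\<^bsub>M\<^esub> s2 x))"
proof -
  obtain W p q where W: "W \<in> \<C>" and p: "p \<in> module_hom R W W1" and q: "q \<in> module_hom R W W2"
    and bij: "bij_betw (\<lambda>x. (p x, q x)) (carrier W) (carrier W1 \<times> carrier W2)"
    using biproduct[OF W1 W2] by blast
  interpret M: module R M by (rule C_module[OF M])
  interpret W1: module R W1 by (rule C_module[OF W1])
  interpret W2: module R W2 by (rule C_module[OF W2])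
  note Wm = C_module[OF W]
  define w where "w = restrict (\<lambda>x. w1 (p x) \<oplus>\<^bsub>M\<^esub> w2 (q x)) (carrier W)"
  have w: "w \<in> Hom R W M"
    unfolding w_def
    by (rule Hom_restrict[OF Wm module_hom_add[OF Wm M.module_axioms
          module_hom_comp[OF p Hom_module_hom[OF w1(1)]] module_hom_comp[OF q Hom_module_hom[OF w2]]]])
  have im: "w ` carrier W = carrier M"
  proof (intro equalityI subsetI)
    fix m assume "m \<in> carrier M"
    then obtain y where y: "y \<in> carrier W1" "m = w1 y" using w1(2) by blast
    have "(y, \<zero>\<^bsub>W2\<^esub>) \<in> (\<lambda>x. (p x, q x)) ` carrier W" using bij y by (simp add: bij_betw_def)
    then obtain x where x: "x \<in> carrier W" "p x = y" "q x = \<zero>\<^bsub>W2\<^esub>" by auto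
    have "w2 \<zero>\<^bsub>W2\<^esub> = \<zero>\<^bsub>M\<^esub>"
      by (rule module_hom_zero[OF W2.module_axioms M.module_axioms Hom_module_hom[OF w2]])
    then have "w x = m" using x y \<open>m \<in> carrier M\<close> by (simp add: w_def)
    then show "m \<in> w ` carrier W" using x(1) by blast
  qed (use HomD(1)[OF w] in auto)
  have iff: "s \<in> image_homs R U W w \<longleftrightarrow>
      (\<exists>s1 \<in> image_homs R U W1 w1. \<exists>s2 \<in> image_homs R U W2 w2. \<forall>x \<in> carrier U. s x = s1 x \<oplus>\<^bsub>M\<^esub> s2 x)"
    if U: "U \<in> \<C>" and s: "s \<in> Hom R U M" for U s
  proof
    note Um = C_module[OF U]
    assume "s \<in> image_homs R U W w"
    then obtain t where t: "t \<in> Hom R U W" "\<And>x. x \<in> carrier U \<Longrightarrow> s x = w (t x)"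
      using image_homs_iff[OF Um w s] by blast
    have "compose (carrier U) w1 (restrict (\<lambda>x. p (t x)) (carrier U)) \<in> image_homs R U W1 w1"
      unfolding image_homs_def
      by (rule imageI[OF Hom_restrict[OF Um module_hom_comp[OF Hom_module_hom[OF t(1)] p]]])
    moreover have "compose (carrier U) w2 (restrict (\<lambda>x. q (t x)) (carrier U)) \<in> image_homs R U W2 w2"
      unfolding image_homs_def
      by (rule imageI[OF Hom_restrict[OF Um module_hom_comp[OF Hom_module_hom[OF t(1)] q]]])
    moreover have "s x = compose (carrier U) w1 (restrict (\<lambda>x. p (t x)) (carrier U)) x \<oplus>\<^bsub>M\<^esub>
        compose (carrier U) w2 (restrict (\<lambda>x. q (t x)) (carrier U)) x" if "x \<in> carrier U" for x
      using that t(2)[OF that] HomD(1)[OF t(1) that] by (simp add: compose_def w_def)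
    ultimately show "\<exists>s1 \<in> image_homs R U W1 w1. \<exists>s2 \<in> image_homs R U W2 w2.
        \<forall>x \<in> carrier U. s x = s1 x \<oplus>\<^bsub>M\<^esub> s2 x" by blast
  next
    note Um = C_module[OF U]
    assume "\<exists>s1 \<in> image_homs R U W1 w1. \<exists>s2 \<in> image_homs R U W2 w2. \<forall>x \<in> carrier U. s x = s1 x \<oplus>\<^bsub>M\<^esub> s2 x"
    then obtain t1 t2 where t: "t1 \<in> Hom R U W1" "t2 \<in> Hom R U W2"
        "\<And>x. x \<in> carrier U \<Longrightarrow> s x = w1 (t1 x) \<oplus>\<^bsub>M\<^esub> w2 (t2 x)"
      by (auto simp: image_homs_def compose_def)
    obtain r where r: "r \<in> Hom R U W" "\<And>x. x \<in> carrier U \<Longrightarrow> p (r x) = t1 x \<and> q (r x) = t2 x"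
      using biproduct_pairing[OF Wm Um p q bij Hom_module_hom[OF t(1)] Hom_module_hom[OF t(2)]] by blast
    have "s x = w (r x)" if "x \<in> carrier U" for x
      using t(3)[OF that] r(2)[OF that] HomD(1)[OF r(1) that] by (simp add: w_def)
    then show "s \<in> image_homs R U W w" using image_homs_iff[OF Um w s] r(1) by blast
  qed
  show ?thesis
    by (intro bexI[OF _ W] bexI[OF _ w] conjI ballI im) (rule iff)
qed

text \<open>The pullback of \<open>\<alpha>\<close> along \<open>\<beta>\<close> and a free cover \<open>\<pi>\<close>, realised as the kernel of an
  epimorphism, represents the maps \<open>s\<close> for which \<open>\<alpha> s\<close> factors stably through \<open>\<beta>\<close>.\<close>

lemma stable_pullback:
  assumes M: "M \<in> \<C>" and M1: "M1 \<in> \<C>" and N1: "N1 \<in> \<C>"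
    and \<alpha>: "\<alpha> \<in> Hom R M M1" and \<beta>: "\<beta> \<in> Hom R N1 M1"
  shows "\<exists>W \<in> \<C>. \<exists>w \<in> Hom R W M. w ` carrier W = carrier M \<and>
    (\<forall>U \<in> \<C>. \<forall>s \<in> Hom R U M. s \<in> image_homs R U W w \<longleftrightarrow>
      (\<exists>t \<in> Hom R U N1. stable_class R U M1 (compose (carrier U) \<alpha> s) =
        stable_class R U M1 (compose (carrier U) \<beta> t)))"
proof -
  \<comment> \<open>Through this cover, stable equality of \<alpha> s and \<beta> t becomes the
    honest equation \<alpha> s - \<beta> t = \<pi> r.\<close>
  obtain P \<pi> where P: "P \<in> \<C>" and \<pi>: "\<pi> \<in> Hom R P M1" "\<pi> ` carrier P = carrier M1"
    and free: "\<And>U. U \<in> \<C> \<Longrightarrow> free_homs R U M1 = image_homs R U P \<pi>"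
    using free_homs_eq_image_homs[OF M1] by blast
  obtain S p q where S: "S \<in> \<C>" and p: "p \<in> module_hom R S M" and q: "q \<in> module_hom R S N1"
    and bijS: "bij_betw (\<lambda>x. (p x, q x)) (carrier S) (carrier M \<times> carrier N1)"
    using biproduct[OF M N1] by blast
  obtain T u v where T: "T \<in> \<C>" and u: "u \<in> module_hom R T S" and v: "v \<in> module_hom R T P"
    and bijT: "bij_betw (\<lambda>x. (u x, v x)) (carrier T) (carrier S \<times> carrier P)"
    using biproduct[OF S P] by blast
  interpret M: module R M by (rule C_module[OF M])
  interpret M1: module R M1 by (rule C_module[OF M1])
  interpret N1: module R N1 by (rule C_module[OF N1])
  interpret P: module R P by (rule C_module[OF P])
  note Sm = C_module[OF S] and Tm = C_module[OF T]
  interpret sub: hom_subfunctor R \<C> M1 "\<lambda>U. image_homs R U P \<pi>"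
    using hom_subfunctor_image_homs[OF M1 P \<pi>] .
  note \<alpha>D = HomD[OF \<alpha>] and \<beta>D = HomD[OF \<beta>] and \<pi>D = HomD[OF \<pi>(1)]
  note pD = module_homD[OF p] and qD = module_homD[OF q] and uD = module_homD[OF u] and vD = module_homD[OF v]
  have triple: "\<exists>x \<in> carrier T. p (u x) = a \<and> q (u x) = b \<and> v x = c"
    if "a \<in> carrier M" "b \<in> carrier N1" "c \<in> carrier P" for a b c
  proof -
    have "(a, b) \<in> (\<lambda>x. (p x, q x)) ` carrier S" using that bijS by (simp add: bij_betw_def)
    then obtain y where y: "y \<in> carrier S" "p y = a" "q y = b" by auto
    have "(y, c) \<in> (\<lambda>x. (u x, v x)) ` carrier T" using that y bijT by (simp add: bij_betw_def)
    then show ?thesis using y by auto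
  qed
  \<comment> \<open>T is the sum of M, N1 and P, with projections p u, q u and v. The kernel of
    \<delta> consists of the solutions (s, t, r) of that equation.\<close>
  define \<delta> where "\<delta> x = (\<alpha> (p (u x)) \<ominus>\<^bsub>M1\<^esub> \<beta> (q (u x))) \<ominus>\<^bsub>M1\<^esub> \<pi> (v x)" for x
  have \<delta>: "\<delta> \<in> module_hom R T M1"
    unfolding \<delta>_def
    by (intro module_hom_diff[OF Tm M1.module_axioms]
        module_hom_comp[OF module_hom_comp[OF u p] Hom_module_hom[OF \<alpha>]]
        module_hom_comp[OF module_hom_comp[OF u q] Hom_module_hom[OF \<beta>]]
        module_hom_comp[OF v Hom_module_hom[OF \<pi>(1)]])
  \<comment> \<open>The summand P alone makes \<delta> surjective, and this is what brings its
    kernel into \<open>\<C>\<close>.\<close>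
  have "\<delta> ` carrier T = carrier M1"
  proof (intro equalityI subsetI)
    fix z assume z: "z \<in> carrier M1"
    then have "\<ominus>\<^bsub>M1\<^esub> z \<in> \<pi> ` carrier P" using \<pi>(2) by simp
    then obtain c where c: "c \<in> carrier P" "\<pi> c = \<ominus>\<^bsub>M1\<^esub> z" by auto
    obtain x where x: "x \<in> carrier T" "p (u x) = \<zero>\<^bsub>M\<^esub>" "q (u x) = \<zero>\<^bsub>N1\<^esub>" "v x = c"
      using triple[OF M.zero_closed N1.zero_closed c(1)] by blast
    have "\<alpha> \<zero>\<^bsub>M\<^esub> = \<zero>\<^bsub>M1\<^esub>" "\<beta> \<zero>\<^bsub>N1\<^esub> = \<zero>\<^bsub>M1\<^esub>"
      using module_hom_zero[OF M.module_axioms M1.module_axioms Hom_module_hom[OF \<alpha>]]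
        module_hom_zero[OF N1.module_axioms M1.module_axioms Hom_module_hom[OF \<beta>]] by auto
    then have "\<delta> x = z" using x c z by (simp add: \<delta>_def a_minus_def)
    then show "z \<in> \<delta> ` carrier T" using x(1) by blast
  qed (use module_homD(1)[OF \<delta>] in auto)
  define W where "W = T\<lparr>carrier := {x \<in> carrier T. \<delta> x = \<zero>\<^bsub>M1\<^esub>}\<rparr>"
  have W: "W \<in> \<C>"
    unfolding W_def using C_ker \<open>\<delta> ` carrier T = carrier M1\<close> \<delta> T M1
    unfolding closed_under_epi_kernels_def by blast
  note Wm = C_module[OF W]
  have Wc: "carrier W = {x \<in> carrier T. \<delta> x = \<zero>\<^bsub>M1\<^esub>}" by (simp add: W_def)
  have incl: "(\<lambda>x. x) \<in> module_hom R W T" by (rule module_homI) (auto simp: W_def)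
  define w where "w = restrict (\<lambda>x. p (u x)) (carrier W)"
  have w: "w \<in> Hom R W M"
    unfolding w_def by (rule Hom_restrict[OF Wm module_hom_comp[OF module_hom_comp[OF incl u] p]])
  have \<delta>0: "\<delta> x = \<zero>\<^bsub>M1\<^esub> \<longleftrightarrow> \<alpha> (p (u x)) \<ominus>\<^bsub>M1\<^esub> \<beta> (q (u x)) = \<pi> (v x)" if "x \<in> carrier T" for x
    unfolding \<delta>_def using that uD(1) vD(1) pD(1) qD(1) \<alpha>D(1) \<beta>D(1) \<pi>D(1)
    by (intro M1.minus_eq_zero_iff) auto
  \<comment> \<open>The element m lifts to (m, 0, c) with \<pi> c = \<alpha> m, again thanks to the
    cover.\<close>
  have im: "w ` carrier W = carrier M"
  proof (intro equalityI subsetI)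
    fix m assume m: "m \<in> carrier M"
    then have "\<alpha> m \<in> \<pi> ` carrier P" using \<alpha>D(1) \<pi>(2) by simp
    then obtain c where c: "c \<in> carrier P" "\<pi> c = \<alpha> m" by auto
    obtain x where x: "x \<in> carrier T" "p (u x) = m" "q (u x) = \<zero>\<^bsub>N1\<^esub>" "v x = c"
      using triple[OF m N1.zero_closed c(1)] by blast
    have "\<beta> \<zero>\<^bsub>N1\<^esub> = \<zero>\<^bsub>M1\<^esub>"
      using module_hom_zero[OF N1.module_axioms M1.module_axioms Hom_module_hom[OF \<beta>]] .
    then have "x \<in> carrier W"
      using x c m \<alpha>D(1) by (simp add: Wc \<delta>0 a_minus_def)
    then show "m \<in> w ` carrier W" using x(2) by (auto simp: w_def)
  qed (use HomD(1)[OF w] in auto)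
  have iff: "s \<in> image_homs R U W w \<longleftrightarrow>
      (\<exists>t \<in> Hom R U N1. stable_class R U M1 (compose (carrier U) \<alpha> s) =
        stable_class R U M1 (compose (carrier U) \<beta> t))"
    if U: "U \<in> \<C>" and s: "s \<in> Hom R U M" for U s
  proof -
    note Um = C_module[OF U]
    interpret UM1: comm_group "hom_group R U M1" by (rule hom_group_comm_group[OF Um M1.module_axioms])
    have eq: "stable_class R U M1 (compose (carrier U) \<alpha> s) = stable_class R U M1 (compose (carrier U) \<beta> t) \<longleftrightarrow>
        (\<exists>r \<in> Hom R U P. \<forall>x \<in> carrier U. \<alpha> (s x) \<ominus>\<^bsub>M1\<^esub> \<beta> (t x) = \<pi> (r x))"
      if t: "t \<in> Hom R U N1" for t
    proof -
      let ?a = "compose (carrier U) \<alpha> s" and ?b = "compose (carrier U) \<beta> t"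
      have a: "?a \<in> Hom R U M1" and b: "?b \<in> Hom R U M1" using Hom_compose[OF Um] s t \<alpha> \<beta> by auto
      let ?d = "?a \<otimes>\<^bsub>hom_group R U M1\<^esub> inv\<^bsub>hom_group R U M1\<^esub> ?b"
      have d: "?d \<in> Hom R U M1"
        using UM1.m_closed[OF _ UM1.inv_closed, of ?a ?b] a b by (simp only: hom_group_simps(1))
      have dx: "?d x = \<alpha> (s x) \<ominus>\<^bsub>M1\<^esub> \<beta> (t x)" if "x \<in> carrier U" for x
        using that unfolding hom_group_inv[OF Um M1.module_axioms b]
        by (simp add: hom_group_simps(2) compose_def a_minus_def)
      have "stable_class R U M1 ?a = stable_class R U M1 ?b \<longleftrightarrow> ?d \<in> image_homs R U P \<pi>"
        using sub.stable_class_eq_iff[OF U M1 a b] free[OF U] by simp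
      also have "\<dots> \<longleftrightarrow> (\<exists>r \<in> Hom R U P. \<forall>x \<in> carrier U. \<alpha> (s x) \<ominus>\<^bsub>M1\<^esub> \<beta> (t x) = \<pi> (r x))"
        unfolding image_homs_iff[OF Um \<pi>(1) d] by (simp add: dx)
      finally show ?thesis .
    qed
    show ?thesis
    proof
      assume "s \<in> image_homs R U W w"
      then obtain f where f: "f \<in> Hom R U W" "\<And>x. x \<in> carrier U \<Longrightarrow> s x = w (f x)"
        using image_homs_iff[OF Um w s] by blast
      have fT: "f \<in> module_hom R U T" using module_hom_comp[OF Hom_module_hom[OF f(1)] incl] by simp
      let ?t = "restrict (\<lambda>x. q (u (f x))) (carrier U)" and ?r = "restrict (\<lambda>x. v (f x)) (carrier U)"
      have t: "?t \<in> Hom R U N1"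
        by (rule Hom_restrict[OF Um module_hom_comp[OF module_hom_comp[OF fT u] q]])
      have r: "?r \<in> Hom R U P" by (rule Hom_restrict[OF Um module_hom_comp[OF fT v]])
      have "\<alpha> (s x) \<ominus>\<^bsub>M1\<^esub> \<beta> (?t x) = \<pi> (?r x)" if x: "x \<in> carrier U" for x
      proof -
        have "f x \<in> carrier T" "\<delta> (f x) = \<zero>\<^bsub>M1\<^esub>" "s x = p (u (f x))"
          using HomD(1)[OF f(1) x] f(2)[OF x] by (simp_all add: Wc w_def)
        then show ?thesis using \<delta>0 x by simp
      qed
      then show "\<exists>t \<in> Hom R U N1. stable_class R U M1 (compose (carrier U) \<alpha> s) =
          stable_class R U M1 (compose (carrier U) \<beta> t)"
        using eq[OF t] t r by blast
    next
      assume "\<exists>t \<in> Hom R U N1. stable_class R U M1 (compose (carrier U) \<alpha> s) =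
          stable_class R U M1 (compose (carrier U) \<beta> t)"
      then obtain t r where t: "t \<in> Hom R U N1" and r: "r \<in> Hom R U P"
        and eq: "\<And>x. x \<in> carrier U \<Longrightarrow> \<alpha> (s x) \<ominus>\<^bsub>M1\<^esub> \<beta> (t x) = \<pi> (r x)" using eq by blast
      obtain g where g: "g \<in> Hom R U S" "\<And>x. x \<in> carrier U \<Longrightarrow> p (g x) = s x \<and> q (g x) = t x"
        using biproduct_pairing[OF Sm Um p q bijS Hom_module_hom[OF s] Hom_module_hom[OF t]] by blast
      obtain f where f: "f \<in> Hom R U T" "\<And>x. x \<in> carrier U \<Longrightarrow> u (f x) = g x \<and> v (f x) = r x"
        using biproduct_pairing[OF Tm Um u v bijT Hom_module_hom[OF g(1)] Hom_module_hom[OF r]] by blast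
      have fW: "f x \<in> carrier W" if x: "x \<in> carrier U" for x
        using eq[OF x] g(2)[OF x] f(2)[OF x] HomD(1)[OF f(1) x] by (simp add: Wc \<delta>0)
      \<comment> \<open>W carries the operations of T, so a homomorphism into T with values in the
        kernel is one into W.\<close>
      have "f \<in> Hom R U W"
        using HomD(2,3)[OF f(1)] fW f(1)
        by (intro HomI module_homI) (auto simp: W_def Hom_def)
      moreover have "s x = w (f x)" if x: "x \<in> carrier U" for x
        using fW[OF x] g(2)[OF x] f(2)[OF x] by (simp add: w_def)
      ultimately show "s \<in> image_homs R U W w" using image_homs_iff[OF Um w s] by blast
    qed
  qed
  show ?thesis
    by (intro bexI[OF _ W] bexI[OF _ w] conjI ballI im) (rule iff)
qed

end

section \<open>Finitely presented functors and indecomposable modules\<close>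

lemma mod_stableD:
  assumes F: "F \<in> mod_stable R \<C>"
  shows "U \<in> \<C> \<Longrightarrow> comm_group (fobj F U)"
    and "\<lbrakk>U \<in> \<C>; V \<in> \<C>; \<phi> \<in> carrier (stable_hom R U V)\<rbrakk> \<Longrightarrow> fmap F U V \<phi> \<in> hom (fobj F V) (fobj F U)"
    and "\<lbrakk>U \<in> \<C>; a \<in> carrier (fobj F U)\<rbrakk> \<Longrightarrow> fmap F U U (stable_id R U) a = a"
    and "\<lbrakk>U \<in> \<C>; V \<in> \<C>; W \<in> \<C>; \<phi> \<in> carrier (stable_hom R U V); \<psi> \<in> carrier (stable_hom R V W);
      a \<in> carrier (fobj F W)\<rbrakk>
      \<Longrightarrow> fmap F U W (stable_comp R U V W \<psi> \<phi>) a = fmap F U V \<phi> (fmap F V W \<psi> a)"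
proof -
  have ax: "additive_functor R \<C> F" using F by (simp add: mod_stable_def)
  note ax = ax[unfolded additive_functor_def]
  show "U \<in> \<C> \<Longrightarrow> comm_group (fobj F U)" by (rule ax[THEN conjunct1, rule_format])
  show "\<lbrakk>U \<in> \<C>; V \<in> \<C>; \<phi> \<in> carrier (stable_hom R U V)\<rbrakk> \<Longrightarrow> fmap F U V \<phi> \<in> hom (fobj F V) (fobj F U)"
    by (rule ax[THEN conjunct2, THEN conjunct1, rule_format])
  show "\<lbrakk>U \<in> \<C>; a \<in> carrier (fobj F U)\<rbrakk> \<Longrightarrow> fmap F U U (stable_id R U) a = a"
    by (rule ax[THEN conjunct2, THEN conjunct2, THEN conjunct1, rule_format])
  show "\<lbrakk>U \<in> \<C>; V \<in> \<C>; W \<in> \<C>; \<phi> \<in> carrier (stable_hom R U V); \<psi> \<in> carrier (stable_hom R V W);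
      a \<in> carrier (fobj F W)\<rbrakk>
      \<Longrightarrow> fmap F U W (stable_comp R U V W \<psi> \<phi>) a = fmap F U V \<phi> (fmap F V W \<psi> a)"
    by (rule ax[THEN conjunct2, THEN conjunct2, THEN conjunct2, THEN conjunct1, rule_format])
qed

lemma mod_stable_presentation:
  assumes F: "F \<in> mod_stable R \<C>"
  obtains M N \<eta> \<epsilon> where "M \<in> \<C>" "N \<in> \<C>"
    "\<And>U. U \<in> \<C> \<Longrightarrow> \<eta> U \<in> hom (stable_hom R U N) (stable_hom R U M)"
    "\<And>U V \<phi> a. \<lbrakk>U \<in> \<C>; V \<in> \<C>; \<phi> \<in> carrier (stable_hom R U V); a \<in> carrier (stable_hom R V N)\<rbrakk>
      \<Longrightarrow> \<eta> U (stable_comp R U V N a \<phi>) = stable_comp R U V M (\<eta> V a) \<phi>"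
    "\<And>U V \<phi> a. \<lbrakk>U \<in> \<C>; V \<in> \<C>; \<phi> \<in> carrier (stable_hom R U V); a \<in> carrier (stable_hom R V M)\<rbrakk>
      \<Longrightarrow> \<epsilon> U (stable_comp R U V M a \<phi>) = fmap F U V \<phi> (\<epsilon> V a)"
    "\<And>U. U \<in> \<C> \<Longrightarrow> \<eta> U ` carrier (stable_hom R U N) = kernel (stable_hom R U M) (fobj F U) (\<epsilon> U)"
    "\<And>U. U \<in> \<C> \<Longrightarrow> \<epsilon> U ` carrier (stable_hom R U M) = carrier (fobj F U)"
proof -
  have "finitely_presented R \<C> F" using F by (simp add: mod_stable_def)
  then obtain M N \<eta> \<epsilon> where MN: "M \<in> \<C>" "N \<in> \<C>"
    and pres: "nat_trans R \<C> (representable R N) (representable R M) \<eta> \<and>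
      nat_trans R \<C> (representable R M) F \<epsilon> \<and>
      (\<forall>U \<in> \<C>.
         \<eta> U ` carrier (fobj (representable R N) U) =
           kernel (fobj (representable R M) U) (fobj F U) (\<epsilon> U) \<and>
         \<epsilon> U ` carrier (fobj (representable R M) U) = carrier (fobj F U))"
    unfolding finitely_presented_def by (elim bexE exE)
  note p = pres[unfolded nat_trans_def representable_def contra_functor.simps]
  show thesis
    using that[OF MN p[THEN conjunct1, THEN conjunct1, rule_format]
        p[THEN conjunct1, THEN conjunct2, rule_format]
        p[THEN conjunct2, THEN conjunct1, THEN conjunct2, rule_format]
        p[THEN conjunct2, THEN conjunct2, rule_format, THEN conjunct1]
        p[THEN conjunct2, THEN conjunct2, rule_format, THEN conjunct2]] .
qed

section \<open>Sums of endomorphisms of an indecomposable module\<close>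

context complete_noetherian_local_ring
begin

text \<open>Composing with the inverse k of f + g reduces to summands of the identity: k f or 1 - k
  f is bijective, and applying f + g to these gives f and g.\<close>

lemma indecomposable_add_bij:
  assumes Mfg: "M \<in> fg_modules R" and ind: "indecomposable R M"
    and f: "f \<in> module_hom R M M" and g: "g \<in> module_hom R M M"
    and bij: "bij_betw (\<lambda>x. f x \<oplus>\<^bsub>M\<^esub> g x) (carrier M) (carrier M)"
  shows "bij_betw f (carrier M) (carrier M) \<or> bij_betw g (carrier M) (carrier M)"
proof -
  have M: "module R M" using Mfg by (rule fg_modules_module)
  interpret M: module R M by (rule M)
  let ?s = "\<lambda>x. f x \<oplus>\<^bsub>M\<^esub> g x"
  have s: "?s \<in> module_hom R M M" by (rule module_hom_add[OF M M f g])
  obtain k where k: "k \<in> module_hom R M M" "\<And>y. y \<in> carrier M \<Longrightarrow> ?s (k y) = y"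
    by (rule module_hom_inverse[OF M s bij]) (rule that, assumption, assumption)
  note fD = module_homD[OF f] and gD = module_homD[OF g] and kD = module_homD[OF k(1)]
  have "(\<lambda>x. k (f x)) \<in> module_hom R M M" by (rule module_hom_comp[OF f k(1)])
  from indecomposable_endo_local[OF Mfg ind this] show ?thesis
  proof
    assume "bij_betw (\<lambda>x. k (f x)) (carrier M) (carrier M)"
    from bij_betw_trans[OF this bij] have "bij_betw (\<lambda>x. ?s (k (f x))) (carrier M) (carrier M)"
      by (simp add: comp_def)
    moreover have "?s (k (f x)) = f x" if "x \<in> carrier M" for x using k(2) fD(1) that by blast
    ultimately show ?thesis using bij_betw_cong[of "carrier M" "\<lambda>x. ?s (k (f x))" f] by blast
  next
    assume "bij_betw (\<lambda>x. x \<ominus>\<^bsub>M\<^esub> k (f x)) (carrier M) (carrier M)"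
    from bij_betw_trans[OF this bij]
    have "bij_betw (\<lambda>x. ?s (x \<ominus>\<^bsub>M\<^esub> k (f x))) (carrier M) (carrier M)" by (simp add: comp_def)
    \<comment> \<open>As \<open>?s\<close> = f + g undoes k, it sends x - k (f x) to (f x + g x) - f
      x.\<close>
    moreover have "?s (x \<ominus>\<^bsub>M\<^esub> k (f x)) = g x" if x: "x \<in> carrier M" for x
    proof -
      have "?s (x \<ominus>\<^bsub>M\<^esub> k (f x)) = ?s x \<ominus>\<^bsub>M\<^esub> ?s (k (f x))"
        using module_hom_minus[OF M M s x kD(1)[OF fD(1)[OF x]]] .
      also have "\<dots> = (f x \<oplus>\<^bsub>M\<^esub> g x) \<ominus>\<^bsub>M\<^esub> f x" using k(2)[OF fD(1)[OF x]] by simp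
      also have "\<dots> = g x" using fD(1)[OF x] gD(1)[OF x]
        by (subst M.a_comm) (simp_all add: a_minus_def M.a_assoc M.r_neg)
      finally show ?thesis .
    qed
    ultimately show ?thesis using bij_betw_cong[of "carrier M" "\<lambda>x. ?s (x \<ominus>\<^bsub>M\<^esub> k (f x))" g] by blast
  qed
qed

lemma indecomposable_sum_bij:
  fixes n :: nat
  assumes Mfg: "M \<in> fg_modules R" and ind: "indecomposable R M"
    and h: "\<And>i. i < n \<Longrightarrow> h i \<in> module_hom R M M"
    and bij: "bij_betw (\<lambda>x. \<Oplus>\<^bsub>M\<^esub>i\<in>{..<n}. h i x) (carrier M) (carrier M)"
  shows "\<exists>i<n. bij_betw (h i) (carrier M) (carrier M)"
proof -
  have M: "module R M" using Mfg by (rule fg_modules_module)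
  interpret M: module R M by (rule M)
  show ?thesis using h bij
  proof (induction n)
    case 0
    \<comment> \<open>The empty sum is the zero map, which is bijective only on the zero module;
      indecomposability rules that out.\<close>
    then have "(\<lambda>x. \<zero>\<^bsub>M\<^esub>) ` carrier M = carrier M" by (simp add: bij_betw_def)
    then have "carrier M = {\<zero>\<^bsub>M\<^esub>}" using M.zero_closed by blast
    then show ?case using ind by (simp add: indecomposable_def zero_module_def)
  next
    case (Suc n)
    have hc: "h i x \<in> carrier M" if "i < Suc n" "x \<in> carrier M" for i x
      using module_homD(1)[OF Suc.prems(1)[OF that(1)] that(2)] .
    let ?g = "\<lambda>m x. \<Oplus>\<^bsub>M\<^esub>i\<in>{..<m}. h i x"
    have g: "?g m \<in> module_hom R M M" if "m \<le> n" for m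
      using that
    proof (induction m)
      case 0 show ?case by (rule module_homI) auto
    next
      case (Suc m)
      have "?g (Suc m) x = h m x \<oplus>\<^bsub>M\<^esub> ?g m x" if "x \<in> carrier M" for x
        using Suc.prems hc that by (intro M.finsum_lessThan_Suc) auto
      moreover have "(\<lambda>x. h m x \<oplus>\<^bsub>M\<^esub> ?g m x) \<in> module_hom R M M"
        using Suc \<open>\<And>i. i < Suc n \<Longrightarrow> h i \<in> module_hom R M M\<close> by (intro module_hom_add[OF M M]) auto
      ultimately show ?case by (auto simp: module_hom_def)
    qed
    have eq: "?g (Suc n) x = h n x \<oplus>\<^bsub>M\<^esub> ?g n x" if "x \<in> carrier M" for x
      using hc that by (intro M.finsum_lessThan_Suc) auto
    then have "bij_betw (\<lambda>x. h n x \<oplus>\<^bsub>M\<^esub> ?g n x) (carrier M) (carrier M)"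
      using Suc.prems(2) bij_betw_cong[of "carrier M" "?g (Suc n)" "\<lambda>x. h n x \<oplus>\<^bsub>M\<^esub> ?g n x"] by blast
    then have "bij_betw (h n) (carrier M) (carrier M) \<or> bij_betw (?g n) (carrier M) (carrier M)"
      using Suc.prems(1) g by (intro indecomposable_add_bij[OF Mfg ind]) auto
    then show ?case
    proof
      assume "bij_betw (h n) (carrier M) (carrier M)"
      then show ?thesis by (intro exI[of _ n]) simp
    next
      assume "bij_betw (?g n) (carrier M) (carrier M)"
      then have "\<exists>i<n. bij_betw (h i) (carrier M) (carrier M)"
        using Suc.prems(1) by (intro Suc.IH) auto
      then obtain i where "i < n" "bij_betw (h i) (carrier M) (carrier M)" by (elim exE conjE)
      then show ?thesis by (intro exI[of _ i]) simp
    qed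
  qed
qed

text \<open>If \<open>x \<mapsto> l x \<odot> y\<close> is bijective, with \<open>l\<close> linear, then \<open>y\<close> freely generates \<open>M\<close>.\<close>

lemma rank_one_bij_imp_free:
  assumes M: "module R M" and nz: "\<not> zero_module M" and y: "y \<in> carrier M"
    and l: "\<And>x. x \<in> carrier M \<Longrightarrow> l x \<in> carrier R"
    and ls: "\<And>r x. \<lbrakk>r \<in> carrier R; x \<in> carrier M\<rbrakk> \<Longrightarrow> l (r \<odot>\<^bsub>M\<^esub> x) = r \<otimes> l x"
    and bij: "bij_betw (\<lambda>x. l x \<odot>\<^bsub>M\<^esub> y) (carrier M) (carrier M)"
  shows "mod_iso R M (free_mod R 1)"
proof -
  interpret M: module R M by (rule M)
  note F = free_mod_simps[OF is_cring, of "Suc 0"]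
  have surj: "\<exists>x \<in> carrier M. m = l x \<odot>\<^bsub>M\<^esub> y" if "m \<in> carrier M" for m
  proof -
    have "m \<in> (\<lambda>x. l x \<odot>\<^bsub>M\<^esub> y) ` carrier M" using bij that by (simp add: bij_betw_def)
    then show ?thesis by auto
  qed
  have inj: "x = x'" if "x \<in> carrier M" "x' \<in> carrier M" "l x \<odot>\<^bsub>M\<^esub> y = l x' \<odot>\<^bsub>M\<^esub> y" for x x'
    using inj_onD[OF bij_betw_imp_inj_on[OF bij]] that by blast
  \<comment> \<open>Surjectivity at y itself yields a scalar u = l(x0) that fixes y; everything
    below rests on u being a unit.\<close>
  obtain x0 where x0: "x0 \<in> carrier M" "y = l x0 \<odot>\<^bsub>M\<^esub> y" using surj[OF y] ..
  have ynz: "y \<noteq> \<zero>\<^bsub>M\<^esub>"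
  proof
    assume "y = \<zero>\<^bsub>M\<^esub>"
    then have "m = \<zero>\<^bsub>M\<^esub>" if "m \<in> carrier M" for m using surj[OF that] l by auto
    then show False using nz by (auto simp: zero_module_def)
  qed
  define u where "u = l x0"
  have u: "u \<in> carrier R" using l x0 by (simp add: u_def)
  \<comment> \<open>Otherwise 1 - u would be a unit, but it annihilates y, which is nonzero.\<close>
  have "u \<notin> \<mm>"
  proof
    assume um: "u \<in> \<mm>"
    have "\<one> \<ominus> u \<notin> \<mm>"
    proof
      assume "\<one> \<ominus> u \<in> \<mm>"
      then have "(\<one> \<ominus> u) \<oplus> u \<in> \<mm>"
        using um additive_subgroup.a_closed[OF ideal.axioms(1)[OF \<mm>_ideal]] by blast
      moreover have "(\<one> \<ominus> u) \<oplus> u = \<one>" using u by algebra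
      ultimately have "\<mm> = carrier R" using ideal.one_imp_carrier[OF \<mm>_ideal] by simp
      then show False using maximalideal.I_notcarr[OF maximal] by simp
    qed
    then obtain v where v: "v \<in> carrier R" "v \<otimes> (\<one> \<ominus> u) = \<one>"
      using left_inverse_if_notin_\<mm>[of "\<one> \<ominus> u"] u by auto
    have "(\<one> \<ominus> u) \<odot>\<^bsub>M\<^esub> y = y \<ominus>\<^bsub>M\<^esub> u \<odot>\<^bsub>M\<^esub> y"
      using u y by (simp add: a_minus_def M.smult_l_distr M.smult_l_minus)
    also have "\<dots> = \<zero>\<^bsub>M\<^esub>" using x0(2) u y M.minus_eq_zero_iff[of y "u \<odot>\<^bsub>M\<^esub> y"] by (simp add: u_def)
    finally have "v \<odot>\<^bsub>M\<^esub> ((\<one> \<ominus> u) \<odot>\<^bsub>M\<^esub> y) = \<zero>\<^bsub>M\<^esub>" using v by simp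
    then show False using v u y ynz M.smult_assoc1[of v "\<one> \<ominus> u" y] by simp
  qed
  then obtain v where v: "v \<in> carrier R" "v \<otimes> u = \<one>" using left_inverse_if_notin_\<mm>[OF u] by blast
  \<comment> \<open>If r y = 0, then r x0 and 0 have the same image under the bijection, so r x0 =
    0; applying l gives r u = 0, and u is a unit.\<close>
  have ann: "r = \<zero>" if r: "r \<in> carrier R" "r \<odot>\<^bsub>M\<^esub> y = \<zero>\<^bsub>M\<^esub>" for r
  proof -
    have l0: "l \<zero>\<^bsub>M\<^esub> = \<zero>" using ls[of \<zero> "\<zero>\<^bsub>M\<^esub>"] l[of "\<zero>\<^bsub>M\<^esub>"] by simp
    have "l (r \<odot>\<^bsub>M\<^esub> x0) \<odot>\<^bsub>M\<^esub> y = r \<odot>\<^bsub>M\<^esub> (l x0 \<odot>\<^bsub>M\<^esub> y)"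
      using ls[OF r(1) x0(1)] r x0(1) l y by (simp add: M.smult_assoc1)
    also have "\<dots> = l \<zero>\<^bsub>M\<^esub> \<odot>\<^bsub>M\<^esub> y" using r(2) x0(2) l0 y by simp
    finally have "r \<odot>\<^bsub>M\<^esub> x0 = \<zero>\<^bsub>M\<^esub>" by (rule inj[rotated 2]) (simp_all add: r(1) x0(1))
    then have "r \<otimes> u = \<zero>" using ls[OF r(1) x0(1)] l0 by (simp add: u_def)
    moreover have "r = v \<otimes> (r \<otimes> u)"
    proof -
      have "v \<otimes> (r \<otimes> u) = r \<otimes> (v \<otimes> u)" using r v u by algebra
      then show ?thesis using v r by simp
    qed
    ultimately show ?thesis using v by simp
  qed
  let ?g = "\<lambda>w. w 0 \<odot>\<^bsub>M\<^esub> y"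
  have w0: "w 0 \<in> carrier R" if "w \<in> carrier (free_mod R 1)" for w using that by (auto simp: F)
  have "?g \<in> module_hom R (free_mod R 1) M"
  proof (rule module_homI)
    fix w w' assume "w \<in> carrier (free_mod R 1)" "w' \<in> carrier (free_mod R 1)"
    then show "?g (w \<oplus>\<^bsub>free_mod R 1\<^esub> w') = ?g w \<oplus>\<^bsub>M\<^esub> ?g w'"
      using w0 y by (simp add: F M.smult_l_distr)
  next
    fix r w assume "r \<in> carrier R" "w \<in> carrier (free_mod R 1)"
    then show "?g (r \<odot>\<^bsub>free_mod R 1\<^esub> w) = r \<odot>\<^bsub>M\<^esub> ?g w"
      using w0 y by (simp add: F M.smult_assoc1)
  qed (use w0 y in simp)
  moreover have "bij_betw ?g (carrier (free_mod R 1)) (carrier M)"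
  proof (rule bij_betwI')
    fix w w' assume w: "w \<in> carrier (free_mod R 1)" "w' \<in> carrier (free_mod R 1)"
    show "(?g w = ?g w') = (w = w')"
    proof
      assume "?g w = ?g w'"
      then have "(w 0 \<ominus> w' 0) \<odot>\<^bsub>M\<^esub> y = \<zero>\<^bsub>M\<^esub>"
        using w0[OF w(1)] w0[OF w(2)] y by (simp add: a_minus_def M.smult_l_distr M.smult_l_minus M.r_neg)
      then have "w 0 \<ominus> w' 0 = \<zero>" using w0[OF w(1)] w0[OF w(2)] by (intro ann) auto
      then have "w 0 = w' 0" using w0[OF w(1)] w0[OF w(2)] by (simp add: r_right_minus_eq)
      then show "w = w'" using w unfolding One_nat_def F(1) by (intro PiE_ext) auto
    qed simp
    show "?g w \<in> carrier M" using w0[OF w(1)] y by simp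
  next
    fix m assume "m \<in> carrier M"
    from surj[OF this] obtain x where x: "x \<in> carrier M" "m = l x \<odot>\<^bsub>M\<^esub> y" ..
    then have "(\<lambda>i\<in>{..<1}. l x) \<in> carrier (free_mod R 1)" using l by (auto simp: F)
    moreover have "m = ?g (\<lambda>i\<in>{..<1::nat}. l x)" using x by simp
    ultimately show "\<exists>w\<in>carrier (free_mod R 1). m = ?g w" by blast
  qed
  ultimately have "mod_iso R (free_mod R 1) M" by (auto simp: mod_iso_def)
  then show ?thesis by (rule mod_iso_sym[OF free_mod_module[OF is_cring]])
qed

text \<open>A factorisation of the identity through R^n writes it as a sum of n endomorphisms of the
  form x -> l(x) y with l linear. One of them is bijective, and then M is free of rank one.\<close>

lemma indecomposable_free_summand:
  assumes Mfg: "M \<in> fg_modules R" and ind: "indecomposable R M"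
    and id: "(\<lambda>x\<in>carrier M. x) \<in> free_homs R M M"
  shows "mod_iso R M (free_mod R 1)"
proof -
  have M: "module R M" using Mfg by (rule fg_modules_module)
  interpret M: module R M by (rule M)
  obtain f g n where f: "f \<in> Hom R M (free_mod R n)" and g: "g \<in> Hom R (free_mod R n) M"
    and gf: "(\<lambda>x\<in>carrier M. x) = compose (carrier M) g f"
    using id by (auto simp: free_homs_def)
  interpret F: module R "free_mod R n" by (rule free_mod_module[OF is_cring])
  note Fs = free_mod_simps[OF is_cring, of n]
  \<comment> \<open>The i-th summand multiplies the i-th coordinate of f x by the image
    \<open>y i\<close> of the i-th basis vector.\<close>
  define y where "y i = g (free_unit R n i)" for i
  have y: "y i \<in> carrier M" for i unfolding y_def by (rule HomD(1)[OF g free_unit_carrier[OF is_cring]])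
  have fc: "f x i \<in> carrier R" if "x \<in> carrier M" "i < n" for x i
    using HomD(1)[OF f that(1)] that(2) by (auto simp: Fs)
  let ?h = "\<lambda>i x. f x i \<odot>\<^bsub>M\<^esub> y i"
  have sum: "(\<Oplus>\<^bsub>M\<^esub>i\<in>{..<n}. ?h i x) = x" if x: "x \<in> carrier M" for x
  proof -
    have "x = g (f x)" using fun_cong[OF gf, of x] x by (simp add: compose_def)
    also have "f x = (\<Oplus>\<^bsub>free_mod R n\<^esub>i\<in>{..<n}. f x i \<odot>\<^bsub>free_mod R n\<^esub> free_unit R n i)"
      by (rule free_mod_expand[OF is_cring HomD(1)[OF f x], symmetric])
    also have "g \<dots> = (\<Oplus>\<^bsub>M\<^esub>i\<in>{..<n}. g (f x i \<odot>\<^bsub>free_mod R n\<^esub> free_unit R n i))"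
      using fc[OF x] free_unit_carrier[OF is_cring]
      by (intro module_hom_finsum[OF F.module_axioms M Hom_module_hom[OF g]]) auto
    also have "\<dots> = (\<Oplus>\<^bsub>M\<^esub>i\<in>{..<n}. ?h i x)"
      using fc[OF x] y HomD(3)[OF g _ free_unit_carrier[OF is_cring]]
      by (intro M.finsum_cong') (auto simp: y_def)
    finally show ?thesis by simp
  qed
  have h: "?h i \<in> module_hom R M M" if i: "i < n" for i
  proof (rule module_homI)
    fix x x' assume "x \<in> carrier M" "x' \<in> carrier M"
    then show "?h i (x \<oplus>\<^bsub>M\<^esub> x') = ?h i x \<oplus>\<^bsub>M\<^esub> ?h i x'"
      using HomD(2)[OF f] fc y i by (simp add: Fs M.smult_l_distr)
  next
    fix r x assume "r \<in> carrier R" "x \<in> carrier M"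
    then show "?h i (r \<odot>\<^bsub>M\<^esub> x) = r \<odot>\<^bsub>M\<^esub> ?h i x"
      using HomD(3)[OF f] fc y i by (simp add: Fs M.smult_assoc1)
  qed (use fc y i in simp)
  have "bij_betw (\<lambda>x. \<Oplus>\<^bsub>M\<^esub>i\<in>{..<n}. ?h i x) (carrier M) (carrier M)"
    using sum by (intro bij_betw_byWitness[of _ "\<lambda>x. x"]) auto
  from indecomposable_sum_bij[OF Mfg ind h this]
  obtain i where i: "i < n" "bij_betw (?h i) (carrier M) (carrier M)" by blast
  show ?thesis
  proof (rule rank_one_bij_imp_free[OF M _ y[of i] _ _ i(2)])
    show "\<not> zero_module M" using ind by (simp add: indecomposable_def)
    show "f x i \<in> carrier R" if "x \<in> carrier M" for x using fc that i(1) by blast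
    show "f (r \<odot>\<^bsub>M\<^esub> x) i = r \<otimes> f x i" if "r \<in> carrier R" "x \<in> carrier M" for r x
      using HomD(3)[OF f that] i(1) by (simp add: Fs)
  qed
qed

end

section \<open>Annihilators of elements, and the closure operator\<close>

context stable_setting
begin

lemma stable_comp_class:
  assumes "U \<in> \<C>" "V \<in> \<C>" "N \<in> \<C>" "f \<in> Hom R U V" "g \<in> Hom R V N"
  shows "stable_comp R U V N (stable_class R V N g) (stable_class R U V f) =
    stable_class R U N (compose (carrier U) g f)"
proof -
  obtain P \<pi> where "P \<in> \<C>" "\<pi> \<in> Hom R P N" "\<pi> ` carrier P = carrier N"
    using free_cover[OF assms(3)] by blast
  then interpret hom_subfunctor R \<C> N "\<lambda>U. image_homs R U P \<pi>"
    by (intro hom_subfunctor_image_homs assms)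
  show ?thesis by (rule stable_comp_class[OF assms])
qed

lemma fmap_compose:
  assumes F: "F \<in> mod_stable R \<C>" and UVN: "U \<in> \<C>" "V \<in> \<C>" "N \<in> \<C>"
    and f: "f \<in> Hom R U V" and g: "g \<in> Hom R V N" and a: "a \<in> carrier (fobj F N)"
  shows "fmap F U N (stable_class R U N (compose (carrier U) g f)) a =
    fmap F U V (stable_class R U V f) (fmap F V N (stable_class R V N g) a)"
  using mod_stableD(4)[OF F UVN stable_class_carrier[OF f] stable_class_carrier[OF g] a]
    stable_comp_class[OF UVN f g] by simp

text \<open>Lift a to \<alpha> : M -> M1 in the presentation. Then s annihilates a iff the class of
  \<alpha> s lies in the kernel of \<epsilon>, which is the image of \<eta>; that is, iff \<alpha> s
  is stably equal to some \<beta> t. This is the condition that \<open>stable_pullback\<close>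
  represents.\<close>

lemma element_kernel_image_homs:
  assumes F: "F \<in> mod_stable R \<C>" and M: "M \<in> \<C>" and a: "a \<in> carrier (fobj F M)"
  shows "\<exists>W \<in> \<C>. \<exists>w \<in> Hom R W M. w ` carrier W = carrier M \<and>
    (\<forall>U \<in> \<C>. \<forall>s \<in> Hom R U M. s \<in> image_homs R U W w \<longleftrightarrow>
      fmap F U M (stable_class R U M s) a = \<one>\<^bsub>fobj F U\<^esub>)"
proof -
  obtain M1 N1 \<eta> \<epsilon> where M1: "M1 \<in> \<C>" and N1: "N1 \<in> \<C>"
    and \<eta>: "\<And>U. U \<in> \<C> \<Longrightarrow> \<eta> U \<in> hom (stable_hom R U N1) (stable_hom R U M1)"
      "\<And>U V \<phi> a. \<lbrakk>U \<in> \<C>; V \<in> \<C>; \<phi> \<in> carrier (stable_hom R U V); a \<in> carrier (stable_hom R V N1)\<rbrakk>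
        \<Longrightarrow> \<eta> U (stable_comp R U V N1 a \<phi>) = stable_comp R U V M1 (\<eta> V a) \<phi>"
    and \<epsilon>: "\<And>U V \<phi> a. \<lbrakk>U \<in> \<C>; V \<in> \<C>; \<phi> \<in> carrier (stable_hom R U V); a \<in> carrier (stable_hom R V M1)\<rbrakk>
        \<Longrightarrow> \<epsilon> U (stable_comp R U V M1 a \<phi>) = fmap F U V \<phi> (\<epsilon> V a)"
    and exact: "\<And>U. U \<in> \<C> \<Longrightarrow> \<eta> U ` carrier (stable_hom R U N1) = kernel (stable_hom R U M1) (fobj F U) (\<epsilon> U)"
    and surj: "\<And>U. U \<in> \<C> \<Longrightarrow> \<epsilon> U ` carrier (stable_hom R U M1) = carrier (fobj F U)"
    by (rule mod_stable_presentation[OF F]) (rule that, assumption+)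
  have "a \<in> \<epsilon> M ` carrier (stable_hom R M M1)" using a surj[OF M] by simp
  then obtain \<alpha> where \<alpha>: "\<alpha> \<in> Hom R M M1" "a = \<epsilon> M (stable_class R M M1 \<alpha>)"
    by (auto elim: stable_hom_carrierE)
  note idN = Hom_id[OF C_module[OF N1]]
  \<comment> \<open>By Yoneda \<eta> is composition with the image \<beta> of the identity of
    N1.\<close>
  have "\<eta> N1 (stable_class R N1 N1 (\<lambda>x\<in>carrier N1. x)) \<in> carrier (stable_hom R N1 M1)"
    using \<eta>(1)[OF N1] stable_class_carrier[OF idN] by (auto simp: hom_def)
  then obtain \<beta> where \<beta>: "\<beta> \<in> Hom R N1 M1"
      "\<eta> N1 (stable_class R N1 N1 (\<lambda>x\<in>carrier N1. x)) = stable_class R N1 M1 \<beta>"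
    by (auto elim: stable_hom_carrierE)
  obtain W w where W: "W \<in> \<C>" and w: "w \<in> Hom R W M" and im: "w ` carrier W = carrier M"
    and iff: "\<forall>U \<in> \<C>. \<forall>s \<in> Hom R U M. s \<in> image_homs R U W w \<longleftrightarrow>
      (\<exists>t \<in> Hom R U N1. stable_class R U M1 (compose (carrier U) \<alpha> s) =
        stable_class R U M1 (compose (carrier U) \<beta> t))"
    using stable_pullback[OF M M1 N1 \<alpha>(1) \<beta>(1)] by (elim bexE conjE)
  have "s \<in> image_homs R U W w \<longleftrightarrow> fmap F U M (stable_class R U M s) a = \<one>\<^bsub>fobj F U\<^esub>"
    if U: "U \<in> \<C>" and s: "s \<in> Hom R U M" for U s
  proof -
    let ?c = "stable_class R U M1 (compose (carrier U) \<alpha> s)"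
    have c: "?c \<in> carrier (stable_hom R U M1)"
      by (rule stable_class_carrier[OF Hom_compose[OF C_module[OF U] s \<alpha>(1)]])
    have "fmap F U M (stable_class R U M s) a = \<epsilon> U ?c"
      unfolding \<alpha>(2) using \<epsilon>[OF U M stable_class_carrier[OF s] stable_class_carrier[OF \<alpha>(1)]]
        stable_comp_class[OF U M M1 s \<alpha>(1)] by simp
    then have "fmap F U M (stable_class R U M s) a = \<one>\<^bsub>fobj F U\<^esub> \<longleftrightarrow> ?c \<in> \<eta> U ` carrier (stable_hom R U N1)"
      using c exact[OF U] by (simp add: kernel_def)
    also have "carrier (stable_hom R U N1) = stable_class R U N1 ` Hom R U N1"
      using stable_class_carrier by (auto elim: stable_hom_carrierE)
    also have "\<eta> U ` stable_class R U N1 ` Hom R U N1 =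
        (\<lambda>t. stable_class R U M1 (compose (carrier U) \<beta> t)) ` Hom R U N1"
      unfolding image_image
    proof (rule image_cong[OF refl])
      fix t assume t: "t \<in> Hom R U N1"
      have "\<eta> U (stable_comp R U N1 N1 (stable_class R N1 N1 (\<lambda>x\<in>carrier N1. x)) (stable_class R U N1 t)) =
          stable_comp R U N1 M1 (stable_class R N1 M1 \<beta>) (stable_class R U N1 t)"
        using \<eta>(2)[OF U N1 stable_class_carrier[OF t] stable_class_carrier[OF idN]] \<beta>(2) by simp
      then show "\<eta> U (stable_class R U N1 t) = stable_class R U M1 (compose (carrier U) \<beta> t)"
        by (simp add: stable_comp_class[OF U N1 N1 t idN] stable_comp_class[OF U N1 M1 t \<beta>(1)]
            compose_Hom_id(2)[OF t])
    qed
    finally show ?thesis using iff U s by blast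
  qed
  then show ?thesis by (intro bexI[OF _ W] bexI[OF _ w] conjI ballI im)
qed

text \<open>For the inverse g of f, functoriality gives F(g) F(f) = F(f g) = 1, so F(f) has trivial
  kernel.\<close>

lemma bij_fmap_eq_one:
  assumes F: "F \<in> mod_stable R \<C>" and U: "U \<in> \<C>" and V: "V \<in> \<C>" and f: "f \<in> Hom R U V"
    and bij: "bij_betw f (carrier U) (carrier V)" and a: "a \<in> carrier (fobj F V)"
    and one: "fmap F U V (stable_class R U V f) a = \<one>\<^bsub>fobj F U\<^esub>"
  shows "a = \<one>\<^bsub>fobj F V\<^esub>"
proof -
  obtain g where g: "g \<in> module_hom R V U" "\<And>y. y \<in> carrier V \<Longrightarrow> f (g y) = y"
    by (rule module_hom_inverse[OF C_module[OF U] Hom_module_hom[OF f] bij]) (rule that, assumption, assumption)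
  let ?g = "restrict g (carrier V)"
  have gH: "?g \<in> Hom R V U" by (rule Hom_restrict[OF C_module[OF V] g(1)])
  have "compose (carrier V) f ?g = (\<lambda>x\<in>carrier V. x)" using g(2) by (auto simp: compose_def fun_eq_iff)
  then have "a = fmap F V U (stable_class R V U ?g) (fmap F U V (stable_class R U V f) a)"
    using fmap_compose[OF F V U V gH f a] mod_stableD(3)[OF F V a] by (simp add: stable_id_def)
  also have "\<dots> = \<one>\<^bsub>fobj F V\<^esub>"
  proof -
    interpret FU: comm_group "fobj F U" by (rule mod_stableD(1)[OF F U])
    interpret FV: comm_group "fobj F V" by (rule mod_stableD(1)[OF F V])
    interpret h: group_hom "fobj F U" "fobj F V" "fmap F V U (stable_class R V U ?g)"
      using mod_stableD(2)[OF F V U stable_class_carrier[OF gH]] by unfold_locales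
    show ?thesis unfolding one by (rule h.hom_one)
  qed
  finally show ?thesis .
qed

text \<open>\<open>Sigma_sub\<close> and \<open>gamma_sub\<close> quantify over all members of an
  isomorphism class; this permits passage to a single representative.\<close>

lemma vanishes_iso:
  assumes F: "F \<in> mod_stable R \<C>" and U: "U \<in> \<C>" and V: "V \<in> \<C>" and iso: "mod_iso R U V"
    and van: "vanishes F U"
  shows "vanishes F V"
proof -
  obtain f where f: "f \<in> module_hom R U V" "bij_betw f (carrier U) (carrier V)"
    using iso by (auto simp: mod_iso_def)
  let ?f = "restrict f (carrier U)"
  have fH: "?f \<in> Hom R U V" by (rule Hom_restrict[OF C_module[OF U] f(1)])
  have bij: "bij_betw ?f (carrier U) (carrier V)" by (rule iffD1[OF bij_betw_cong f(2)]) simp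
  interpret FV: comm_group "fobj F V" by (rule mod_stableD(1)[OF F V])
  have "a = \<one>\<^bsub>fobj F V\<^esub>" if a: "a \<in> carrier (fobj F V)" for a
  proof (rule bij_fmap_eq_one[OF F U V fH bij a])
    have "fmap F U V (stable_class R U V ?f) a \<in> carrier (fobj F U)"
      using mod_stableD(2)[OF F U V stable_class_carrier[OF fH]] a by (auto simp: hom_def)
    then show "fmap F U V (stable_class R U V ?f) a = \<one>\<^bsub>fobj F U\<^esub>" using van by (simp add: vanishes_def)
  qed
  then show ?thesis unfolding vanishes_def using FV.one_closed by blast
qed

lemma not_vanishesE:
  assumes "F \<in> mod_stable R \<C>" "U \<in> \<C>" "\<not> vanishes F U"
  obtains a where "a \<in> carrier (fobj F U)" "a \<noteq> \<one>\<^bsub>fobj F U\<^esub>"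
proof -
  interpret FU: comm_group "fobj F U" by (rule mod_stableD(1)[OF assms(1,2)])
  show thesis using assms(3) FU.one_closed that unfolding vanishes_def by blast
qed

lemma SpE:
  assumes "c \<in> Sp R \<C>"
  obtains M where "M \<in> c" "M \<in> \<C>" "indecomposable R M" "\<not> mod_iso R M (free_mod R 1)"
    "\<And>N. N \<in> c \<Longrightarrow> N \<in> \<C> \<and> mod_iso R M N"
proof -
  obtain M where M: "c = iso_class R \<C> M" "M \<in> \<C>" "indecomposable R M" "\<not> mod_iso R M (free_mod R 1)"
    using assms by (auto simp: Sp_def)
  have "mod_iso R M M"
    unfolding mod_iso_def by (rule bexI[OF _ module_hom_id]) (simp add: bij_betw_def)
  then have "M \<in> c" using M by (simp add: iso_class_def)
  then show thesis
  proof (rule that[OF _ M(2-4)])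
    show "N \<in> \<C> \<and> mod_iso R M N" if "N \<in> c" for N
      using that M(1) mod_iso_sym[OF C_module[of N]] by (auto simp: iso_class_def)
  qed
qed

lemma gamma_Sigma_empty: "gamma_sub R \<C> (Sigma_sub R \<C> {}) = {}"
proof -
  have False if c: "c \<in> gamma_sub R \<C> (Sigma_sub R \<C> {})" for c
  proof -
    have "c \<in> Sp R \<C>" using c by (simp add: gamma_sub_def)
    then obtain M where M: "M \<in> c" "M \<in> \<C>" "indecomposable R M" "\<not> mod_iso R M (free_mod R 1)"
      by (rule SpE)
    obtain P \<pi> where P: "P \<in> \<C>" "\<pi> \<in> Hom R P M" "\<pi> ` carrier P = carrier M" "is_free R P"
      using free_cover[OF M(2)] by blast
    \<comment> \<open>On \<open>\<C>\<close> the maps that factor through the free cover \<pi> are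
      the stably trivial ones. So this is the functor represented by M, in a form whose finite
      presentation is already available.\<close>
    let ?F = "hom_quot R M (\<lambda>U. image_homs R U P \<pi>)"
    have "?F \<in> Sigma_sub R \<C> {}"
      using hom_quot_image_homs_mod_stable(1)[OF M(2) P(1-3)] by (simp add: Sigma_sub_def)
    then have "vanishes ?F M" using c M(1) unfolding gamma_sub_def by blast
    then have "(\<lambda>x\<in>carrier M. x) \<in> image_homs R M P \<pi>"
      using hom_quot_image_homs_mod_stable(2)[OF M(2) P(1-3) M(2)] Hom_id[OF C_module[OF M(2)]] by blast
    then have "(\<lambda>x\<in>carrier M. x) \<in> free_homs R M M"
      using image_homs_free[OF P(1,4,2) C_module[OF M(2)]] by blast
    then show False using indecomposable_free_summand[OF C_fg[OF M(2)] M(3)] M(4) by blast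
  qed
  then show ?thesis by blast
qed

lemma gamma_Sigma_Un_subset:
  fixes As Bs :: "'a rmodule set set"
  assumes AB: "As \<subseteq> Sp R \<C>" "Bs \<subseteq> Sp R \<C>"
  shows "gamma_sub R \<C> (Sigma_sub R \<C> (As \<union> Bs)) \<subseteq>
    gamma_sub R \<C> (Sigma_sub R \<C> As) \<union> gamma_sub R \<C> (Sigma_sub R \<C> Bs)"
proof (rule subsetI, rule ccontr)
  fix c assume c: "c \<in> gamma_sub R \<C> (Sigma_sub R \<C> (As \<union> Bs))"
    and nc: "c \<notin> gamma_sub R \<C> (Sigma_sub R \<C> As) \<union> gamma_sub R \<C> (Sigma_sub R \<C> Bs)"
  have cSp: "c \<in> Sp R \<C>" using c by (simp add: gamma_sub_def)
  then obtain M where M: "M \<in> c" "M \<in> \<C>" "indecomposable R M"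
    and cM: "\<And>N. N \<in> c \<Longrightarrow> N \<in> \<C> \<and> mod_iso R M N"
    by (rule SpE) (rule that, assumption+)
  interpret M: module R M by (rule C_module[OF M(2)])
  \<comment> \<open>A functor that excludes c may be nonzero at some other member of the class;
    isomorphism invariance moves this to M.\<close>
  have witness: "\<exists>F \<in> Sigma_sub R \<C> Ds. \<not> vanishes F M" if notin: "c \<notin> gamma_sub R \<C> (Sigma_sub R \<C> Ds)" for Ds
  proof -
    obtain F N where F: "F \<in> Sigma_sub R \<C> Ds" "N \<in> c" "\<not> vanishes F N"
      using notin cSp unfolding gamma_sub_def by blast
    then show ?thesis using vanishes_iso[of F M N] cM[OF F(2)] M(2) unfolding Sigma_sub_def by blast
  qed
  obtain F where F: "F \<in> Sigma_sub R \<C> As" "\<not> vanishes F M" using witness nc by blast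
  obtain G where G: "G \<in> Sigma_sub R \<C> Bs" "\<not> vanishes G M" using witness nc by blast
  have Fm: "F \<in> mod_stable R \<C>" and Gm: "G \<in> mod_stable R \<C>" using F G by (auto simp: Sigma_sub_def)
  obtain a where a: "a \<in> carrier (fobj F M)" "a \<noteq> \<one>\<^bsub>fobj F M\<^esub>" by (rule not_vanishesE[OF Fm M(2) F(2)])
  obtain b where b: "b \<in> carrier (fobj G M)" "b \<noteq> \<one>\<^bsub>fobj G M\<^esub>" by (rule not_vanishesE[OF Gm M(2) G(2)])
  obtain W1 w1 where W1: "W1 \<in> \<C>" and w1: "w1 \<in> Hom R W1 M" "w1 ` carrier W1 = carrier M"
    and ann1: "\<forall>U \<in> \<C>. \<forall>s \<in> Hom R U M. s \<in> image_homs R U W1 w1 \<longleftrightarrow>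
      fmap F U M (stable_class R U M s) a = \<one>\<^bsub>fobj F U\<^esub>"
    using element_kernel_image_homs[OF Fm M(2) a(1)] by (elim bexE conjE)
  obtain W2 w2 where W2: "W2 \<in> \<C>" and w2: "w2 \<in> Hom R W2 M" "w2 ` carrier W2 = carrier M"
    and ann2: "\<forall>U \<in> \<C>. \<forall>s \<in> Hom R U M. s \<in> image_homs R U W2 w2 \<longleftrightarrow>
      fmap G U M (stable_class R U M s) b = \<one>\<^bsub>fobj G U\<^esub>"
    using element_kernel_image_homs[OF Gm M(2) b(1)] by (elim bexE conjE)
  obtain W w where W: "W \<in> \<C>" and w: "w \<in> Hom R W M" "w ` carrier W = carrier M"
    and sum: "\<forall>U \<in> \<C>. \<forall>s \<in> Hom R U M. s \<in> image_homs R U W w \<longleftrightarrow>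
      (\<exists>s1 \<in> image_homs R U W1 w1. \<exists>s2 \<in> image_homs R U W2 w2. \<forall>x \<in> carrier U. s x = s1 x \<oplus>\<^bsub>M\<^esub> s2 x)"
    using image_homs_sum[OF M(2) W1 W2 w1 w2(1)] by (elim bexE conjE)
  have zero_in: "(\<lambda>x\<in>carrier U. \<zero>\<^bsub>M\<^esub>) \<in> image_homs R U V v"
    if "U \<in> \<C>" "V \<in> \<C>" "v \<in> Hom R V M" for U V v
    using subgroup.one_closed[OF image_homs_subgroup[OF C_module[OF that(1)] C_module[OF that(2)] M.module_axioms that(3)]]
    by (simp add: hom_group_simps(3))
  \<comment> \<open>The quotient of Hom(-, M) by the sum of the annihilators of a and b.\<close>
  let ?H = "hom_quot R M (\<lambda>U. image_homs R U W w)"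
  have ann_van: "fmap F' U M (stable_class R U M s) a' = \<one>\<^bsub>fobj F' U\<^esub>"
    if "F' \<in> mod_stable R \<C>" "vanishes F' U" "U \<in> \<C>" "s \<in> Hom R U M" "a' \<in> carrier (fobj F' M)" for F' U s a'
  proof -
    have "fmap F' U M (stable_class R U M s) a' \<in> carrier (fobj F' U)"
      using mod_stableD(2)[OF that(1,3) M(2) stable_class_carrier[OF that(4)]] that(5) by (auto simp: hom_def)
    then show ?thesis using that(2) by (simp add: vanishes_def)
  qed
  \<comment> \<open>Where F or G vanishes, every map U -> M annihilates a or b respectively; the
    zero map serves as the other summand.\<close>
  have "vanishes ?H U" if d: "d \<in> As \<union> Bs" "U \<in> d" for d U
  proof -
    have "d \<in> Sp R \<C>" using d(1) AB by blast
    then have U: "U \<in> \<C>" by (rule SpE) (use d(2) in blast)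
    have "s \<in> image_homs R U W w" if s: "s \<in> Hom R U M" for s
    proof (cases "d \<in> As")
      case True
      then have "vanishes F U" using F(1) d(2) unfolding Sigma_sub_def by blast
      then have "s \<in> image_homs R U W1 w1" using ann_van[OF Fm _ U s a(1)] ann1 U s by blast
      moreover have "\<forall>x \<in> carrier U. s x = s x \<oplus>\<^bsub>M\<^esub> (\<lambda>x\<in>carrier U. \<zero>\<^bsub>M\<^esub>) x" using HomD(1)[OF s] by simp
      ultimately show ?thesis using sum[rule_format, OF U s] zero_in[OF U W2 w2(1)] by blast
    next
      case False
      then have "vanishes G U" using G(1) d unfolding Sigma_sub_def by blast
      then have "s \<in> image_homs R U W2 w2" using ann_van[OF Gm _ U s b(1)] ann2 U s by blast
      moreover have "\<forall>x \<in> carrier U. s x = (\<lambda>x\<in>carrier U. \<zero>\<^bsub>M\<^esub>) x \<oplus>\<^bsub>M\<^esub> s x" using HomD(1)[OF s] by simp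
      ultimately show ?thesis using sum[rule_format, OF U s] zero_in[OF U W1 w1(1)] by blast
    qed
    then show ?thesis using hom_quot_image_homs_mod_stable(2)[OF M(2) W w U] by blast
  qed
  then have "?H \<in> Sigma_sub R \<C> (As \<union> Bs)"
    using hom_quot_image_homs_mod_stable(1)[OF M(2) W w] by (simp add: Sigma_sub_def)
  then have "vanishes ?H M" using c M(1) unfolding gamma_sub_def by blast
  then have "(\<lambda>x\<in>carrier M. x) \<in> image_homs R M W w"
    using hom_quot_image_homs_mod_stable(2)[OF M(2) W w M(2)] Hom_id[OF C_module[OF M(2)]] by blast
  then obtain f g where f: "f \<in> image_homs R M W1 w1" and g: "g \<in> image_homs R M W2 w2"
    and fg: "\<forall>x \<in> carrier M. (\<lambda>x\<in>carrier M. x) x = f x \<oplus>\<^bsub>M\<^esub> g x"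
    using sum[rule_format, OF M(2) Hom_id[OF C_module[OF M(2)]]] by blast
  have fH: "f \<in> Hom R M M" using image_homs_Hom[OF M.module_axioms w1(1)] f by blast
  have gH: "g \<in> Hom R M M" using image_homs_Hom[OF M.module_axioms w2(1)] g by blast
  have "bij_betw (\<lambda>x. f x \<oplus>\<^bsub>M\<^esub> g x) (carrier M) (carrier M)"
    using fg by (intro bij_betw_byWitness[of _ "\<lambda>x. x"]) auto
  from indecomposable_add_bij[OF C_fg[OF M(2)] M(3) Hom_module_hom[OF fH] Hom_module_hom[OF gH] this]
  show False
  proof
    \<comment> \<open>F(f) kills a although f is invertible, so a is trivial.\<close>
    assume "bij_betw f (carrier M) (carrier M)"
    then have "a = \<one>\<^bsub>fobj F M\<^esub>" using ann1 M(2) fH f by (intro bij_fmap_eq_one[OF Fm M(2) M(2) fH _ a(1)]) auto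
    then show False using a(2) by simp
  next
    assume "bij_betw g (carrier M) (carrier M)"
    then have "b = \<one>\<^bsub>fobj G M\<^esub>" using ann2 M(2) gH g by (intro bij_fmap_eq_one[OF Gm M(2) M(2) gH _ b(1)]) auto
    then show False using b(2) by simp
  qed
qed

lemma gamma_Sigma_Un:
  assumes "As \<subseteq> Sp R \<C>" "Bs \<subseteq> Sp R \<C>"
  shows "gamma_sub R \<C> (Sigma_sub R \<C> (As \<union> Bs)) =
    gamma_sub R \<C> (Sigma_sub R \<C> As) \<union> gamma_sub R \<C> (Sigma_sub R \<C> Bs)"
proof
  show "gamma_sub R \<C> (Sigma_sub R \<C> As) \<union> gamma_sub R \<C> (Sigma_sub R \<C> Bs)
      \<subseteq> gamma_sub R \<C> (Sigma_sub R \<C> (As \<union> Bs))"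
    unfolding gamma_sub_def Sigma_sub_def by blast
qed (rule gamma_Sigma_Un_subset[OF assms])

end

section \<open>Formal consequences of the Galois connection\<close>

lemma subset_gamma_Sigma:
  "As \<subseteq> Sp R \<C> \<Longrightarrow> As \<subseteq> gamma_sub R \<C> (Sigma_sub R \<C> As)"
  unfolding gamma_sub_def Sigma_sub_def by blast

text \<open>A set and its closure are annihilated by the same functors: the closure is the larger
  set, and by definition every functor that vanishes on the set vanishes on the closure.\<close>

lemma gamma_Sigma_idem:
  assumes "As \<subseteq> Sp R \<C>"
  shows "gamma_sub R \<C> (Sigma_sub R \<C> (gamma_sub R \<C> (Sigma_sub R \<C> As))) =
    gamma_sub R \<C> (Sigma_sub R \<C> As)"
proof -
  have "Sigma_sub R \<C> (gamma_sub R \<C> (Sigma_sub R \<C> As)) = Sigma_sub R \<C> As"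
    using assms unfolding gamma_sub_def Sigma_sub_def by blast
  then show ?thesis by simp
qed

theorem theorem2p6:
  fixes R :: "('a, 'r) ring_scheme"
    and \<mm> :: "'a set"
    and \<C> :: "'a rmodule set"
    and \<X> \<Y> :: "'a rmodule set set"
  assumes "complete_noetherian_local_ring R \<mm>"
    and "algebraically_closed (R Quot \<mm>)"
    and "additive_subcategory R \<C>"
    and "iso_closed R \<C>"
    and "contains_free R \<C>"
    and "closed_under_epi_kernels R \<C>"
    and "\<X> \<subseteq> Sp R \<C>"
    and "\<Y> \<subseteq> Sp R \<C>"
  shows "gamma_sub R \<C> (Sigma_sub R \<C> {}) = {} \<and>
    \<X> \<subseteq> gamma_sub R \<C> (Sigma_sub R \<C> \<X>) \<and>
    gamma_sub R \<C> (Sigma_sub R \<C> (\<X> \<union> \<Y>)) =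
      gamma_sub R \<C> (Sigma_sub R \<C> \<X>) \<union> gamma_sub R \<C> (Sigma_sub R \<C> \<Y>) \<and>
    gamma_sub R \<C> (Sigma_sub R \<C> (gamma_sub R \<C> (Sigma_sub R \<C> \<X>))) =
      gamma_sub R \<C> (Sigma_sub R \<C> \<X>)"
proof -
  have "stable_setting R \<mm> \<C>"
    by (intro stable_setting.intro stable_setting_axioms.intro assms(1,3,5,6))
  from stable_setting.gamma_Sigma_empty[OF this] stable_setting.gamma_Sigma_Un[OF this assms(7,8)]
    subset_gamma_Sigma[OF assms(7)] gamma_Sigma_idem[OF assms(7)]
  show ?thesis by (intro conjI)
qed

end
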